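(* Assume $R_{\mathrm{FB}}>0$. For every strictly less-noisy discrete memoryless broadcast channel (DMBC) with rate-limited feedback of rate $R_{\mathrm{FB}}$ from Receiver 1, the following hold. 1) Every rate pair $(R_1,R_2)$ with $R_1>0$ and $R_2>0$ that lies on the boundary of $\mathcal C_{\mathrm{NoFB}}$ but not on the boundary of $\mathcal C_{\mathrm{Enh}}$ can be improved with rate-limited feedback: if $R_1>0$, $R_2>0$ and $(R_1,R_2)\in \mathrm{bd}(\mathcal C_{\mathrm{NoFB}})\cap \mathrm{int}(\mathcal C_{\mathrm{Enh}})$, then $$(R_1,R_2)\in \mathrm{int}\big(\mathcal C_{\mathrm{FB}}(R_{\mathrm{FB}})\big).$$ 2) Whenever $\mathcal C_{\mathrm{NoFB}}$ does not coincide with $\mathcal C_{\mathrm{Enh}}$, the feedback capacity region is strictly larger than the no-feedback capacity region: $$\mathcal C_{\mathrm{NoFB}}\subsetneq \mathcal C_{\mathrm{Enh}}\ \Longrightarrow\ \mathcal C_{\mathrm{NoFB}}\subsetneq \mathcal C_{\mathrm{FB}}(R_{\mathrm{FB}}).$$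
   Context: All logarithms are base 2. For a set $\mathcal S\subseteq\mathbb R^2$ of rate pairs, $\mathrm{bd}(\mathcal S)$ and $\mathrm{int}(\mathcal S)$ denote its boundary and interior. A discrete memoryless broadcast channel (DMBC) is given by a finite input alphabet $\mathcal X$, finite output alphabets $\mathcal Y_1,\mathcal Y_2$ and a channel law $P_{Y_1Y_2|X}$: if at time $t$ the transmitter sends $x_t\in\mathcal X$, then, independently of the past given $x_t$, Receiver $i\in\{1,2\}$ observes $Y_{i,t}\in\mathcal Y_i$ with $(Y_{1,t},Y_{2,t})\sim P_{Y_1Y_2|X}(\cdot,\cdot|x_t)$. Rate-limited feedback from Receiver 1: there is a nonnegative feedback rate $R_{\mathrm{FB}}$. For blocklength $N$, after observing $Y_{1,t}$, Receiver 1 sends a symbol $V_t=\psi_t^{(N)}(Y_{1,1},\dots,Y_{1,t})\in\mathcal V_t$ to the transmitter over a noiseless instantaneous link, where the finite alphabets $\mathcal V_1,\dots,\mathcal V_N$ are design parameters subject to $|\mathcal V_1|\cdots|\mathcal V_N|\le 2^{NR_{\mathrm{FB}}}$. Independent messages $M_i$ are uniform on $\mathcal M_i=\{1,\dots,\lfloor 2^{NR_i}\rfloor\}$, $i=1,2$. The channel inputs are $X_t=f_t^{(N)}(M_1,M_2,V_1,\dots,V_{t-1})$ with $f_t^{(N)}:\mathcal M_1\times\mathcal M_2\times\mathcal V_1\times\cdots\times\mathcal V_{t-1}\to\mathcal X$. Receiver $i$ produces the guess $\hat M_i=\Phi_i^{(N)}(Y_{i,1},\dots,Y_{i,N})\in\mathcal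 M_i$. A (nonnegative) rate pair $(R_1,R_2)$ is achievable if for every $N$ there exist encoding functions, decoding functions, feedback alphabets satisfying $|\mathcal V_1|\cdots|\mathcal V_N|\le 2^{NR_{\mathrm{FB}}}$, and feedback-encoding functions such that $\Pr(M_1\neq\hat M_1\text{ or }M_2\ne\hat M_2)\to0$ as $N\to\infty$. The feedback capacity region $\mathcal C_{\mathrm{FB}}(R_{\mathrm{FB}})$ is the closure of the set of achievable rate pairs. $\mathcal C_{\mathrm{NoFB}}:=\mathcal C_{\mathrm{FB}}(0)$ is the no-feedback capacity region. A DMBC is less-noisy if $I(U;Y_2)\ge I(U;Y_1)$ holds for every pmf of the form $P_{UX}P_{Y_1Y_2|X}$ (with $U$ an auxiliary random variable on a finite alphabet). It is strictly less-noisy if, moreover, this inequality is strict whenever $I(U;Y_1)>0$. For less-noisy DMBCs it is known that $\mathcal C_{\mathrm{NoFB}}$ is the set of all nonnegative $(R_1,R_2)$ with $R_1\le I(U;Y_1)$ and $R_2\le I(X;Y_2|U)$ for some pmf $P_{UX}$, where $U$ can be restricted to $|\mathcal U|\le\min\{|\mathcal X|,|\mathcal Y_1|,|\mathcal Y_2|\}+1$. The enhanced DMBC is obtained from the original DMBC by additionally revealing Receiver 1's outputs to Receiver 2, i.e. Receiver 2 observes $(Y_1,Y_2)$. It is physically degraded, and its capacity region (the same with and without feedback), denoted $\mathcal C_{\mathrm{Enh}}$, is the set of all nonnegative $(R_1,R_2)$ with $R_1\le I(U;Y_1)$ and $R_2\le I(X;Y_1,Y_2|U)$ for some pmf $P_{UX}$,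 with $(Y_1,Y_2)\sim P_{Y_1Y_2|X}$ given $X$.
   Formalization: Part 2 is proved under the added assumption that I(U;Y1)>0 for some P_UX; without it the claim fails: for Z uniform binary independent of X, Y1=Z, Y2=X+Z mod 2, both C_NoFB and C_FB are {(0,0)} while C_Enh={0}×[0,1]. *)

theory Defs
  imports "HOL-Probability.Probability"
begin

type_synonym ('x, 'y1, 'y2) dmbc = "'x \<Rightarrow> ('y1 \<times> 'y2) pmf"

(* The input and output alphabets are types, required to be of class finite in the theorem. *)

subsection \<open>Less-noisy channels\<close>

definition UXY_pmf :: "('u \<times> 'x) pmf \<Rightarrow> ('x, 'y1, 'y2) dmbc \<Rightarrow> ('u \<times> 'x \<times> 'y1 \<times> 'y2) pmf" where
  "UXY_pmf P W = bind_pmf P (\<lambda>(u, x). map_pmf (\<lambda>(y1, y2). (u, x, y1, y2)) (W x))"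

(* Mutual information in bits between two discrete random variables on the space q. *)
abbreviation mutual_info :: "'a pmf \<Rightarrow> ('a \<Rightarrow> 'b) \<Rightarrow> ('a \<Rightarrow> 'c) \<Rightarrow> real" where
  "mutual_info q X Y \<equiv>
     prob_space.mutual_information (measure_pmf q) 2 (count_space UNIV) (count_space UNIV) X Y"

definition I_U_Y1 :: "('u \<times> 'x) pmf \<Rightarrow> ('x, 'y1, 'y2) dmbc \<Rightarrow> real" where
  "I_U_Y1 P W = mutual_info (UXY_pmf P W) (\<lambda>(u, x, y1, y2). u) (\<lambda>(u, x, y1, y2). y1)"

definition I_U_Y2 :: "('u \<times> 'x) pmf \<Rightarrow> ('x, 'y1, 'y2) dmbc \<Rightarrow> real" where
  "I_U_Y2 P W = mutual_info (UXY_pmf P W) (\<lambda>(u, x, y1, y2). u) (\<lambda>(u, x, y1, y2). y2)"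

(* Every finite alphabet embeds into nat, so an auxiliary variable on an arbitrary finite
   alphabet is rendered as a nat-valued one with finite support. *)
definition less_noisy :: "('x, 'y1, 'y2) dmbc \<Rightarrow> bool" where
  "less_noisy W \<longleftrightarrow>
     (\<forall>P :: (nat \<times> 'x) pmf. finite (set_pmf P) \<longrightarrow> I_U_Y2 P W \<ge> I_U_Y1 P W)"

definition strictly_less_noisy :: "('x, 'y1, 'y2) dmbc \<Rightarrow> bool" where
  "strictly_less_noisy W \<longleftrightarrow> less_noisy W \<and>
     (\<forall>P :: (nat \<times> 'x) pmf. finite (set_pmf P) \<and> I_U_Y1 P W > 0 \<longrightarrow> I_U_Y2 P W > I_U_Y1 P W)"

(* The strictness clause above is not vacuous, i.e. Y1 is not independent of the input.
   Without this the feedback carries no information about the transmission: for uniform binary Z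
   independent of X, the channel Y1 = Z, Y2 = X + Z (mod 2) is strictly less-noisy, both its
   no-feedback region and its feedback region are {(0, 0)}, but the capacity region of its
   enhanced channel is {0} \<times> {0..1}. *)
definition receiver1_informed :: "('x, 'y1, 'y2) dmbc \<Rightarrow> bool" where
  "receiver1_informed W \<longleftrightarrow> (\<exists>P :: (nat \<times> 'x) pmf. finite (set_pmf P) \<and> I_U_Y1 P W > 0)"

subsection \<open>Block codes with rate-limited feedback from Receiver 1\<close>

(* Times run from 1 to N.  fb_enc c t gets Y_{1,1}, ..., Y_{1,t}; enc c t gets the two messages
   and V_1, ..., V_{t-1}, all as lists in chronological order.  The alphabet V_t is a set of
   naturals, which fixes the names of its symbols only. *)
record ('x, 'y1, 'y2) fb_code =
  fb_alph :: "nat \<Rightarrow> nat set"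
  fb_enc :: "nat \<Rightarrow> 'y1 list \<Rightarrow> nat"
  enc :: "nat \<Rightarrow> nat \<Rightarrow> nat \<Rightarrow> nat list \<Rightarrow> 'x"
  dec1 :: "'y1 list \<Rightarrow> nat"
  dec2 :: "'y2 list \<Rightarrow> nat"

definition messages :: "nat \<Rightarrow> real \<Rightarrow> nat set" where
  "messages N R = {1..nat \<lfloor>2 powr (real N * R)\<rfloor>}"

(* Alphabets are nonempty because fb_enc takes values in them. *)
definition valid_code ::
  "real \<Rightarrow> nat \<Rightarrow> real \<Rightarrow> real \<Rightarrow> ('x, 'y1, 'y2) fb_code \<Rightarrow> bool" where
  "valid_code R_FB N R1 R2 c \<longleftrightarrow>
     (\<forall>t\<in>{1..N}. finite (fb_alph c t) \<and> (\<forall>ys. length ys = t \<longrightarrow> fb_enc c t ys \<in> fb_alph c t)) \<and>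
     real (\<Prod>t=1..N. card (fb_alph c t)) \<le> 2 powr (real N * R_FB) \<and>
     (\<forall>ys. length ys = N \<longrightarrow> dec1 c ys \<in> messages N R1) \<and>
     (\<forall>ys. length ys = N \<longrightarrow> dec2 c ys \<in> messages N R2)"

definition feedback :: "('x, 'y1, 'y2) fb_code \<Rightarrow> 'y1 list \<Rightarrow> nat list" where
  "feedback c ys = map (\<lambda>t. fb_enc c t (take t ys)) [1..<Suc (length ys)]"

(* Law of (Y_{1,1}, Y_{2,1}), ..., (Y_{1,t}, Y_{2,t}) given the messages m1 and m2. *)
primrec outputs ::
  "('x, 'y1, 'y2) dmbc \<Rightarrow> ('x, 'y1, 'y2) fb_code \<Rightarrow> nat \<Rightarrow> nat \<Rightarrow> nat \<Rightarrow> ('y1 \<times> 'y2) list pmf" where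
  "outputs W c m1 m2 0 = return_pmf []"
| "outputs W c m1 m2 (Suc t) =
     bind_pmf (outputs W c m1 m2 t) (\<lambda>ys.
       map_pmf (\<lambda>y. ys @ [y]) (W (enc c (Suc t) m1 m2 (feedback c (map fst ys)))))"

definition messages_outputs ::
  "('x, 'y1, 'y2) dmbc \<Rightarrow> nat \<Rightarrow> real \<Rightarrow> real \<Rightarrow> ('x, 'y1, 'y2) fb_code \<Rightarrow>
   ((nat \<times> nat) \<times> ('y1 \<times> 'y2) list) pmf" where
  "messages_outputs W N R1 R2 c =
     bind_pmf (pair_pmf (pmf_of_set (messages N R1)) (pmf_of_set (messages N R2)))
       (\<lambda>(m1, m2). map_pmf (\<lambda>ys. ((m1, m2), ys)) (outputs W c m1 m2 N))"

definition error_prob ::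
  "('x, 'y1, 'y2) dmbc \<Rightarrow> nat \<Rightarrow> real \<Rightarrow> real \<Rightarrow> ('x, 'y1, 'y2) fb_code \<Rightarrow> real" where
  "error_prob W N R1 R2 c = measure_pmf.prob (messages_outputs W N R1 R2 c)
     {((m1, m2), ys). m1 \<noteq> dec1 c (map fst ys) \<or> m2 \<noteq> dec2 c (map snd ys)}"

definition achievable :: "('x, 'y1, 'y2) dmbc \<Rightarrow> real \<Rightarrow> real \<Rightarrow> real \<Rightarrow> bool" where
  "achievable W R_FB R1 R2 \<longleftrightarrow> R1 \<ge> 0 \<and> R2 \<ge> 0 \<and>
     (\<exists>c :: nat \<Rightarrow> ('x, 'y1, 'y2) fb_code.
        (\<forall>N\<ge>1. valid_code R_FB N R1 R2 (c N)) \<and>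
        (\<lambda>N. error_prob W N R1 R2 (c N)) \<longlonglongrightarrow> 0)"

subsection \<open>Capacity regions\<close>

definition C_FB :: "('x, 'y1, 'y2) dmbc \<Rightarrow> real \<Rightarrow> (real \<times> real) set" where
  "C_FB W R_FB = closure {(R1, R2). achievable W R_FB R1 R2}"

definition C_NoFB :: "('x, 'y1, 'y2) dmbc \<Rightarrow> (real \<times> real) set" where
  "C_NoFB W = C_FB W 0"

definition enhanced :: "('x, 'y1, 'y2) dmbc \<Rightarrow> ('x, 'y1, 'y1 \<times> 'y2) dmbc" where
  "enhanced W = (\<lambda>x. map_pmf (\<lambda>(y1, y2). (y1, (y1, y2))) (W x))"

(* The enhanced channel is physically degraded, so feedback does not change its capacity region. *)
definition C_Enh :: "('x, 'y1, 'y2) dmbc \<Rightarrow> (real \<times> real) set" where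
  "C_Enh W = C_NoFB (enhanced W)"

end

theory Submission
  imports Defs "HOL-Real_Asymp.Real_Asymp"
begin

text \<open>The gain comes from the slack \<open>I(U;Y\<^sub>2) - I(U;Y\<^sub>1) > 0\<close> at Receiver 2 in a superposition code for a
  strictly less-noisy channel. Let \<open>(R\<^sub>1, R\<^sub>2)\<close> be in the no-feedback region with \<open>R\<^sub>1 > 0\<close>, and let \<open>P\<close> be any
  point of the enhanced region. For a small fraction \<open>\<gamma>\<close> of the time a code for the enhanced channel with
  rates \<open>P\<close> is used, and Receiver 1 feeds back its raw outputs. For the rest of the time a superposition code is
  used whose cloud centers carry, besides a message for Receiver 1, these outputs. Receiver 1 knows them already,
  so they do not cost any of its rate, and the slack lets Receiver 2 decode them too; it can then decode as the
  second receiver of the enhanced channel. Hence \<open>\<gamma> P + (1 - \<gamma>) (R\<^sub>1, R\<^sub>2)\<close> is in the feedback region, with the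
  same \<open>\<gamma>\<close> for all \<open>P\<close>. If \<open>(R\<^sub>1, R\<^sub>2)\<close> is interior to the enhanced region, letting \<open>P\<close> range over a ball around
  it gives the first claim. The second follows by applying this to the last point in the no-feedback region
  of a segment from a point with \<open>R\<^sub>1 > 0\<close> in it to a point of the enhanced region outside it.

  That \<open>\<gamma>\<close> does not depend on how closely the codes approach \<open>(R\<^sub>1, R\<^sub>2)\<close> requires the slack to be bounded away
  from \<open>0\<close> uniformly in \<open>U\<close> whenever \<open>I(U;Y\<^sub>1)\<close> is, which is a compactness argument.\<close>

subsection \<open>Entropy\<close>

text \<open>Both regions are closures of operationally achievable rates, and no single-letter
  formula is taken for granted. Of the enhanced channel only its codes are used: at zero feedback
  rate the inputs are functions of the messages, so these codes run unchanged on the original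
  channel, and only their second decoder needs \<open>Y1\<close>. For the no-feedback region an
  auxiliary variable has to be extracted from a rate pair. This is the converse half of the
  less-noisy capacity theorem; it gives one auxiliary variable for each tolerance, with no bound on
  its alphabet, whence the need for a uniform slack \<open>\<kappa>\<close>. The fraction
  \<open>\<gamma>\<close> then obeys two constraints: raw outputs cost the feedback rate
  \<open>\<gamma> log |Y1|\<close>, and they add \<open>\<gamma> / (1 - \<gamma>) log |Y1|\<close>
  to the rate that Receiver 2 resolves in the second phase, which must fit into
  \<open>\<kappa>\<close>. Neither involves \<open>P\<close>. The less-noisy condition enters the
  converse and the merging of values of \<open>U\<close> through a single fact:
  \<open>H(Y2) - H(Y1)\<close> is concave in the input law.\<close>

abbreviation mean :: "'a pmf \<Rightarrow> ('a \<Rightarrow> real) \<Rightarrow> real" where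
  "mean p f \<equiv> measure_pmf.expectation p f"

lemma mean_finite: "finite (set_pmf p) \<Longrightarrow> mean p f = (\<Sum>x\<in>set_pmf p. pmf p x * f x)"
  by (subst integral_measure_pmf_real[of "set_pmf p"]) (auto simp: mult.commute)

lemma mean_cong: "(\<And>x. x \<in> set_pmf p \<Longrightarrow> f x = g x) \<Longrightarrow> mean p f = mean p g"
  by (intro integral_cong_AE) (auto simp: AE_measure_pmf_iff)

lemma mean_mono:
  "finite (set_pmf p) \<Longrightarrow> (\<And>x. x \<in> set_pmf p \<Longrightarrow> f x \<le> g x) \<Longrightarrow> mean p f \<le> mean p g"
  by (simp add: mean_finite sum_mono mult_left_mono)

lemma mean_add: "finite (set_pmf p) \<Longrightarrow> mean p (\<lambda>x. f x + g x) = mean p f + mean p g"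
  by (simp add: mean_finite sum.distrib algebra_simps)

lemma mean_diff: "finite (set_pmf p) \<Longrightarrow> mean p (\<lambda>x. f x - g x) = mean p f - mean p g"
  by (simp add: mean_finite sum_subtractf algebra_simps)

lemma mean_bind:
  assumes "finite (set_pmf p)" "\<And>x. x \<in> set_pmf p \<Longrightarrow> finite (set_pmf (k x))"
  shows "mean (bind_pmf p k) f = mean p (\<lambda>x. mean (k x) f)"
  using assms by (subst pmf_expectation_bind[of "set_pmf p"]) (auto simp: mean_finite)

definition ent :: "'a pmf \<Rightarrow> real" where
  "ent p = mean p (\<lambda>x. - log 2 (pmf p x))"

lemma ent_return [simp]: "ent (return_pmf x) = 0"
  by (simp add: ent_def)

lemma ent_pmf_of_set: "finite A \<Longrightarrow> A \<noteq> {} \<Longrightarrow> ent (pmf_of_set A) = log 2 (card A)"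
  unfolding ent_def
  by (subst mean_cong[where g = "\<lambda>_. log 2 (card A)"]) (auto simp: log_divide card_gt_0_iff)

lemma ent_map_inj:
  assumes "inj_on f (set_pmf p)"
  shows "ent (map_pmf f p) = ent p"
  unfolding ent_def integral_map_pmf
  by (rule mean_cong) (simp add: pmf_map_inj[OF assms])

text \<open>By \<open>ln t \<le> t - 1\<close>. It suffices that \<open>q\<close> has mass at most 1
  on the support of \<open>p\<close>; this covers a mixture restricted to the support of one
  component as well as the estimate in Fano's inequality.\<close>

lemma gibbs:
  assumes fin: "finite (set_pmf p)" and pos: "\<And>x. x \<in> set_pmf p \<Longrightarrow> q x > 0"
    and le: "sum q (set_pmf p) \<le> 1"
  shows "ent p \<le> mean p (\<lambda>x. - log 2 (q x))"
proof -
  have "ent p - mean p (\<lambda>x. - log 2 (q x)) = mean p (\<lambda>x. log 2 (q x) - log 2 (pmf p x))"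
    unfolding ent_def mean_diff[OF fin, symmetric] by (rule mean_cong) simp
  also have "\<dots> \<le> mean p (\<lambda>x. (q x / pmf p x - 1) / ln 2)"
  proof (rule mean_mono[OF fin])
    fix x assume x: "x \<in> set_pmf p"
    have "log 2 (q x) - log 2 (pmf p x) = ln (q x / pmf p x) / ln 2"
      using pos[OF x] pmf_positive[OF x] by (simp add: log_def ln_div diff_divide_distrib)
    also have "\<dots> \<le> (q x / pmf p x - 1) / ln 2"
      using pos[OF x] pmf_positive[OF x] by (intro divide_right_mono ln_le_minus_one) auto
    finally show "log 2 (q x) - log 2 (pmf p x) \<le> (q x / pmf p x - 1) / ln 2" .
  qed
  also have "\<dots> = (\<Sum>x\<in>set_pmf p. q x - pmf p x) / ln 2"
    unfolding mean_finite[OF fin] sum_divide_distrib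
    by (rule sum.cong) (auto simp: field_simps dest: pmf_positive)
  also have "\<dots> = (sum q (set_pmf p) - 1) / ln 2"
    by (simp add: sum_subtractf sum_pmf_eq_1 fin)
  also have "\<dots> \<le> 0"
    using le by (simp add: divide_nonpos_pos)
  finally show ?thesis by simp
qed

text \<open>An input law followed by a channel. Joint laws are brought into this form because the
  marginals and the chain rule are immediate for it.\<close>

definition joint :: "'a pmf \<Rightarrow> ('a \<Rightarrow> 'b pmf) \<Rightarrow> ('a \<times> 'b) pmf" where
  "joint \<nu> k = bind_pmf \<nu> (\<lambda>s. map_pmf (Pair s) (k s))"

lemma set_joint [simp]: "set_pmf (joint \<nu> k) = Sigma (set_pmf \<nu>) (\<lambda>s. set_pmf (k s))"
  by (auto simp: joint_def)

lemma map_fst_joint [simp]: "map_pmf fst (joint \<nu> k) = \<nu>"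
  by (simp add: joint_def map_bind_pmf map_pmf_comp bind_return_pmf')

lemma map_snd_joint [simp]: "map_pmf snd (joint \<nu> k) = bind_pmf \<nu> k"
  by (simp add: joint_def map_bind_pmf map_pmf_comp)

lemma pmf_joint [simp]: "pmf (joint \<nu> k) (s, y) = pmf \<nu> s * pmf (k s) y"
proof -
  have "pmf (joint \<nu> k) (s, y) = mean \<nu> (\<lambda>t. pmf (map_pmf (Pair t) (k t)) (s, y))"
    by (simp add: joint_def pmf_bind)
  also have "\<dots> = mean \<nu> (\<lambda>t. indicator {s} t * pmf (k s) y)"
  proof (rule mean_cong)
    fix t
    have "Pair t -` {(s, y)} = (if t = s then {y} else {})" by auto
    then show "pmf (map_pmf (Pair t) (k t)) (s, y) = indicator {s} t * pmf (k s) y"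
      by (simp add: pmf_map measure_pmf_single)
  qed
  also have "\<dots> = pmf \<nu> s * pmf (k s) y"
    by (simp add: measure_pmf_single)
  finally show ?thesis .
qed

lemma mean_joint:
  assumes "finite (set_pmf \<nu>)" "\<And>s. s \<in> set_pmf \<nu> \<Longrightarrow> finite (set_pmf (k s))"
  shows "mean (joint \<nu> k) f = mean \<nu> (\<lambda>s. mean (k s) (\<lambda>y. f (s, y)))"
  unfolding joint_def using assms by (subst mean_bind) auto

text \<open>Chain rule: on the support the logarithm of the product mass function splits.\<close>

lemma ent_joint:
  assumes fin: "finite (set_pmf \<nu>)" "\<And>s. s \<in> set_pmf \<nu> \<Longrightarrow> finite (set_pmf (k s))"
  shows "ent (joint \<nu> k) = ent \<nu> + mean \<nu> (\<lambda>s. ent (k s))"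
proof -
  have "ent (joint \<nu> k) = mean \<nu> (\<lambda>s. mean (k s) (\<lambda>y. - log 2 (pmf \<nu> s) + - log 2 (pmf (k s) y)))"
    unfolding ent_def mean_joint[of \<nu> k, OF fin, simplified]
    by (intro mean_cong) (auto simp: log_mult dest!: pmf_positive)
  also have "\<dots> = mean \<nu> (\<lambda>s. - log 2 (pmf \<nu> s) + ent (k s))"
    unfolding ent_def by (intro mean_cong) (subst mean_add, auto simp: fin)
  also have "\<dots> = ent \<nu> + mean \<nu> (\<lambda>s. ent (k s))"
    unfolding ent_def by (rule mean_add[OF fin(1)])
  finally show ?thesis .
qed

text \<open>Gibbs' inequality for each \<open>k s\<close> against the mixture; the averaged cross
  entropies make up the entropy of the mixture. In other words,
  \<open>H(Y|S) \<le> H(Y)\<close>.\<close>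

lemma ent_concave:
  assumes fin: "finite (set_pmf \<nu>)" "\<And>s. s \<in> set_pmf \<nu> \<Longrightarrow> finite (set_pmf (k s))"
  shows "mean \<nu> (\<lambda>s. ent (k s)) \<le> ent (bind_pmf \<nu> k)"
proof -
  let ?q = "pmf (bind_pmf \<nu> k)"
  have "mean \<nu> (\<lambda>s. ent (k s)) \<le> mean \<nu> (\<lambda>s. mean (k s) (\<lambda>y. - log 2 (?q y)))"
  proof (intro mean_mono gibbs fin)
    fix s assume s: "s \<in> set_pmf \<nu>"
    show "?q x > 0" if "x \<in> set_pmf (k s)" for x
      using s that by (intro pmf_positive) auto
    have "sum ?q (set_pmf (k s)) = measure (bind_pmf \<nu> k) (set_pmf (k s))"
      by (simp add: measure_measure_pmf_finite fin s)
    then show "sum ?q (set_pmf (k s)) \<le> 1" by simp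
  qed auto
  also have "\<dots> = ent (bind_pmf \<nu> k)"
    unfolding ent_def by (rule mean_bind[symmetric]) (use fin in auto)
  finally show ?thesis .
qed

subsection \<open>Conditioning on a random variable\<close>

text \<open>The law of the whole experiment rather than of one variable, so that conditioning can be
  iterated. It is meaningful only for values \<open>s\<close> of positive probability, hence the
  side conditions below.\<close>

definition cnd :: "'a pmf \<Rightarrow> ('a \<Rightarrow> 's) \<Rightarrow> 's \<Rightarrow> 'a pmf" where
  "cnd B S s = cond_pmf B (S -` {s})"

lemma set_cnd: "s \<in> S ` set_pmf B \<Longrightarrow> set_pmf (cnd B S s) = set_pmf B \<inter> S -` {s}"
  unfolding cnd_def by (subst set_cond_pmf) auto

lemma pmf_cnd:
  "s \<in> S ` set_pmf B \<Longrightarrow>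
    pmf (cnd B S s) x = (if S x = s then pmf B x / pmf (map_pmf S B) s else 0)"
  unfolding cnd_def by (subst pmf_cond) (auto simp: pmf_map)

lemma bind_cnd: "bind_pmf (map_pmf S B) (cnd B S) = B"
proof -
  have "bind_pmf (map_pmf S B) (\<lambda>s. cond_pmf B {\<omega>. s = S \<omega>}) = B"
    by (rule bind_cond_pmf_cancel)
       (auto intro!: arg_cong[where f = "measure_pmf.prob B"])
  then show ?thesis by (simp add: cnd_def[abs_def] vimage_def eq_commute)
qed

text \<open>Disintegration: any pair of variables is a law followed by a channel, so facts about
  \<open>joint\<close> reach arbitrary variables.\<close>

lemma joint_cnd: "map_pmf (\<lambda>\<omega>. (S \<omega>, X \<omega>)) B = joint (map_pmf S B) (\<lambda>s. map_pmf X (cnd B S s))"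
proof -
  have "map_pmf (\<lambda>\<omega>. (S \<omega>, X \<omega>)) B = map_pmf (\<lambda>\<omega>. (S \<omega>, X \<omega>)) (bind_pmf (map_pmf S B) (cnd B S))"
    by (simp add: bind_cnd)
  also have "\<dots> = joint (map_pmf S B) (\<lambda>s. map_pmf X (cnd B S s))"
    unfolding joint_def map_bind_pmf map_pmf_comp
    by (intro bind_pmf_cong refl map_pmf_cong) (auto simp: set_cnd)
  finally show ?thesis .
qed

lemma finite_set_cnd:
  "finite (set_pmf B) \<Longrightarrow> s \<in> S ` set_pmf B \<Longrightarrow> finite (set_pmf (cnd B S s))"
  by (simp add: set_cnd)

lemma mean_cnd:
  assumes "finite (set_pmf B)"
  shows "mean B f = mean (map_pmf S B) (\<lambda>s. mean (cnd B S s) f)"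
proof -
  have "mean B f = mean (bind_pmf (map_pmf S B) (cnd B S)) f"
    by (simp add: bind_cnd)
  also have "\<dots> = mean (map_pmf S B) (\<lambda>s. mean (cnd B S s) f)"
    by (rule mean_bind) (auto simp: assms finite_set_cnd)
  finally show ?thesis .
qed

lemma cnd_cnd:
  assumes "s \<in> S ` set_pmf B" "t \<in> T ` set_pmf (cnd B S s)"
  shows "cnd (cnd B S s) T t = cnd B (\<lambda>\<omega>. (S \<omega>, T \<omega>)) (s, t)"
proof (rule pmf_eqI)
  fix \<omega>
  have st: "(s, t) \<in> (\<lambda>\<omega>. (S \<omega>, T \<omega>)) ` set_pmf B"
    using assms(2) unfolding set_cnd[OF assms(1)] by auto
  have "pmf (map_pmf (\<lambda>\<omega>. (S \<omega>, T \<omega>)) B) (s, t) = pmf (map_pmf S B) s * pmf (map_pmf T (cnd B S s)) t"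
    by (simp add: joint_cnd)
  moreover have "pmf (map_pmf S B) s \<noteq> 0"
    using assms(1) by (metis set_map_pmf pmf_positive less_irrefl)
  ultimately show "pmf (cnd (cnd B S s) T t) \<omega> = pmf (cnd B (\<lambda>\<omega>. (S \<omega>, T \<omega>)) (s, t)) \<omega>"
    by (simp add: pmf_cnd assms st)
qed

lemma ent_pair:
  assumes "finite (set_pmf B)"
  shows "ent (map_pmf (\<lambda>\<omega>. (S \<omega>, X \<omega>)) B) =
    ent (map_pmf S B) + mean (map_pmf S B) (\<lambda>s. ent (map_pmf X (cnd B S s)))"
  unfolding joint_cnd by (rule ent_joint) (auto simp: assms finite_set_cnd)

text \<open>Jensen's inequality in barycentric form: \<open>\<mu>\<close> is a law on laws with
  barycenter \<open>bind_pmf \<mu> id\<close>. A general \<open>G\<close> is allowed because both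
  the entropy and \<open>outent_gap\<close> are to be inserted.\<close>

definition concave_pmf :: "('x pmf \<Rightarrow> real) \<Rightarrow> bool" where
  "concave_pmf G \<longleftrightarrow> (\<forall>\<mu>. finite (set_pmf \<mu>) \<longrightarrow> (\<forall>p\<in>set_pmf \<mu>. finite (set_pmf p)) \<longrightarrow>
     mean \<mu> G \<le> G (bind_pmf \<mu> id))"

lemma concave_pmfD:
  assumes "concave_pmf G" "finite (set_pmf \<nu>)" "\<And>s. s \<in> set_pmf \<nu> \<Longrightarrow> finite (set_pmf (k s))"
  shows "mean \<nu> (\<lambda>s. G (k s)) \<le> G (bind_pmf \<nu> k)"
  using assms(1)[unfolded concave_pmf_def, rule_format, of "map_pmf k \<nu>"] assms(2,3)
  by (force simp: bind_map_pmf)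

lemma concave_ent: "concave_pmf ent"
  unfolding concave_pmf_def using ent_concave[where k = id] by auto

text \<open>Given \<open>S = s\<close>, the posterior of \<open>X\<close> is the average over
  \<open>T\<close> of the posteriors given both, so Jensen applies for each \<open>s\<close>. With
  \<open>ent\<close> this says that conditioning reduces entropy; with \<open>outent_gap\<close> it
  is the conditional less-noisy inequality.\<close>

lemma concave_pmf_cnd:
  assumes G: "concave_pmf G" and fin: "finite (set_pmf B)"
  shows "mean (map_pmf (\<lambda>\<omega>. (S \<omega>, T \<omega>)) B) (\<lambda>st. G (map_pmf X (cnd B (\<lambda>\<omega>. (S \<omega>, T \<omega>)) st)))
     \<le> mean (map_pmf S B) (\<lambda>s. G (map_pmf X (cnd B S s)))"
proof -
  have "mean (map_pmf (\<lambda>\<omega>. (S \<omega>, T \<omega>)) B) (\<lambda>st. G (map_pmf X (cnd B (\<lambda>\<omega>. (S \<omega>, T \<omega>)) st)))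
    = mean (map_pmf S B) (\<lambda>s. mean (map_pmf T (cnd B S s))
        (\<lambda>t. G (map_pmf X (cnd B (\<lambda>\<omega>. (S \<omega>, T \<omega>)) (s, t)))))"
    unfolding joint_cnd by (subst mean_joint) (auto simp: fin finite_set_cnd)
  also have "\<dots> \<le> mean (map_pmf S B) (\<lambda>s. G (map_pmf X (cnd B S s)))"
  proof (rule mean_mono)
    fix s assume "s \<in> set_pmf (map_pmf S B)"
    then have s: "s \<in> S ` set_pmf B" by simp
    have "mean (map_pmf T (cnd B S s)) (\<lambda>t. G (map_pmf X (cnd B (\<lambda>\<omega>. (S \<omega>, T \<omega>)) (s, t))))
      = mean (map_pmf T (cnd B S s)) (\<lambda>t. G (map_pmf X (cnd (cnd B S s) T t)))"
      by (intro mean_cong) (auto simp: cnd_cnd s)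
    also have "\<dots> \<le> G (bind_pmf (map_pmf T (cnd B S s)) (\<lambda>t. map_pmf X (cnd (cnd B S s) T t)))"
      by (rule concave_pmfD[OF G]) (auto simp: fin s finite_set_cnd)
    also have "\<dots> = G (map_pmf X (cnd B S s))"
      by (simp add: map_bind_pmf[symmetric] bind_cnd)
    finally show "mean (map_pmf T (cnd B S s)) (\<lambda>t. G (map_pmf X (cnd B (\<lambda>\<omega>. (S \<omega>, T \<omega>)) (s, t))))
      \<le> G (map_pmf X (cnd B S s))" .
  qed (simp add: fin)
  finally show ?thesis .
qed

text \<open>\<open>H(X|S,T) \<le> H(X|S)\<close>, written with unconditional entropies as are all
  information quantities of blocks below.\<close>

lemma ent_submodular:
  assumes "finite (set_pmf B)"
  shows "ent (map_pmf (\<lambda>\<omega>. ((S \<omega>, T \<omega>), X \<omega>)) B) - ent (map_pmf (\<lambda>\<omega>. (S \<omega>, T \<omega>)) B)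
     \<le> ent (map_pmf (\<lambda>\<omega>. (S \<omega>, X \<omega>)) B) - ent (map_pmf S B)"
  using concave_pmf_cnd[OF concave_ent assms, of S T X]
  by (simp add: ent_pair[OF assms, of S X] ent_pair[OF assms, of "\<lambda>\<omega>. (S \<omega>, T \<omega>)" X])

lemma ent_pair_le:
  assumes "finite (set_pmf B)"
  shows "ent (map_pmf (\<lambda>\<omega>. (S \<omega>, X \<omega>)) B) \<le> ent (map_pmf S B) + ent (map_pmf X B)"
proof -
  have "mean (map_pmf S B) (\<lambda>s. ent (map_pmf X (cnd B S s))) \<le>
    ent (bind_pmf (map_pmf S B) (\<lambda>s. map_pmf X (cnd B S s)))"
    by (rule ent_concave) (auto simp: assms finite_set_cnd)
  then show ?thesis by (simp add: ent_pair assms map_bind_pmf[symmetric] bind_cnd)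
qed

text \<open>Gibbs' inequality against the estimate that gives half of its mass to the guess \<open>d y\<close> and
  spreads the other half uniformly.\<close>

lemma fano:
  assumes fin: "finite (set_pmf J)" and A: "finite A" "M ` set_pmf J \<subseteq> A"
  shows "ent (map_pmf (\<lambda>\<omega>. (Y \<omega>, M \<omega>)) J) - ent (map_pmf Y J)
    \<le> 1 + measure_pmf.prob J {\<omega>. M \<omega> \<noteq> d (Y \<omega>)} * log 2 (card A)"
proof -
  define K where "K = real (card A)"
  have "A \<noteq> {}" using A(2) set_pmf_not_empty[of J] by auto
  then have K: "K \<ge> 1" using A(1) by (simp add: K_def Suc_le_eq card_gt_0_iff)
  define q where "q y m = (if m = d y then 1/2 else 0) + 1 / (2 * K)" for y m
  have "ent (map_pmf (\<lambda>\<omega>. (Y \<omega>, M \<omega>)) J) - ent (map_pmf Y J)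
      = mean (map_pmf Y J) (\<lambda>y. ent (map_pmf M (cnd J Y y)))"
    by (simp add: ent_pair fin)
  also have "\<dots> \<le> mean (map_pmf Y J) (\<lambda>y. mean (cnd J Y y) (\<lambda>\<omega>. 1 + indicator {\<omega>. M \<omega> \<noteq> d (Y \<omega>)} \<omega> * log 2 K))"
  proof (rule mean_mono)
    fix y assume "y \<in> set_pmf (map_pmf Y J)"
    then have y: "y \<in> Y ` set_pmf J" by simp
    have "ent (map_pmf M (cnd J Y y)) \<le> mean (map_pmf M (cnd J Y y)) (\<lambda>m. - log 2 (q y m))"
    proof (rule gibbs)
      show "q y m > 0" for m using K by (auto simp: q_def add_pos_pos)
      have "sum (q y) (set_pmf (map_pmf M (cnd J Y y))) \<le> sum (q y) A"
        using A y K by (intro sum_mono2) (auto simp: set_cnd q_def)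
      also have "\<dots> = (if d y \<in> A then 1/2 else 0) + K * (1 / (2 * K))"
        using A(1) by (simp add: q_def sum.distrib K_def)
      also have "\<dots> \<le> 1" using K by auto
      finally show "sum (q y) (set_pmf (map_pmf M (cnd J Y y))) \<le> 1" .
    qed (simp add: fin y finite_set_cnd)
    also have "\<dots> = mean (cnd J Y y) (\<lambda>\<omega>. - log 2 (q y (M \<omega>)))" by simp
    also have "\<dots> \<le> mean (cnd J Y y) (\<lambda>\<omega>. 1 + indicator {\<omega>. M \<omega> \<noteq> d (Y \<omega>)} \<omega> * log 2 K)"
    proof (rule mean_mono)
      fix \<omega> assume "\<omega> \<in> set_pmf (cnd J Y y)"
      then have [simp]: "Y \<omega> = y" using y by (simp add: set_cnd)
      show "- log 2 (q y (M \<omega>)) \<le> 1 + indicator {\<omega>. M \<omega> \<noteq> d (Y \<omega>)} \<omega> * log 2 K"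
      proof (cases "M \<omega> = d y")
        case True
        have "log 2 (1/2) \<le> log 2 (q y (M \<omega>))"
          using True K by (subst log_le_cancel_iff) (auto simp: q_def add_pos_pos)
        then show ?thesis using True by (simp add: log_divide)
      next
        case False
        then show ?thesis using K by (simp add: q_def log_divide log_mult)
      qed
    qed (simp add: fin y finite_set_cnd)
    finally show "ent (map_pmf M (cnd J Y y)) \<le> mean (cnd J Y y) (\<lambda>\<omega>. 1 + indicator {\<omega>. M \<omega> \<noteq> d (Y \<omega>)} \<omega> * log 2 K)" .
  qed (simp add: fin)
  also have "\<dots> = mean J (\<lambda>\<omega>. 1 + indicator {\<omega>. M \<omega> \<noteq> d (Y \<omega>)} \<omega> * log 2 K)"
    by (rule mean_cnd[OF fin, symmetric])
  also have "\<dots> = 1 + measure_pmf.prob J {\<omega>. M \<omega> \<noteq> d (Y \<omega>)} * log 2 K"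
    by (subst mean_add[OF fin]) simp
  finally show ?thesis by (simp add: K_def)
qed

subsection \<open>The converse without feedback\<close>

primrec memoryless :: "('a \<Rightarrow> 'b pmf) \<Rightarrow> 'a list \<Rightarrow> 'b list pmf" where
  "memoryless K [] = return_pmf []"
| "memoryless K (x # xs) = bind_pmf (K x) (\<lambda>y. map_pmf (Cons y) (memoryless K xs))"

lemma memoryless_append:
  "memoryless K (xs @ zs) = bind_pmf (memoryless K xs) (\<lambda>a. map_pmf (\<lambda>b. a @ b) (memoryless K zs))"
proof (induction xs)
  case Nil
  have "map_pmf ((@) []) p = p" for p :: "'a list pmf"
    by (subst map_pmf_cong[of _ p _ "\<lambda>b. b"]) auto
  from this[of "memoryless K zs"] show ?case by (simp only: memoryless.simps bind_return_pmf append_Nil)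
next
  case (Cons x xs)
  have "map_pmf ((@) (y # l)) p = map_pmf (\<lambda>b. y # l @ b) p" for y l and p :: "'a list pmf"
    by (rule map_pmf_cong) auto
  with Cons show ?case
    by (simp add: bind_return_pmf map_bind_pmf bind_map_pmf map_pmf_comp bind_assoc_pmf)
qed

lemma length_memoryless: "ys \<in> set_pmf (memoryless K xs) \<Longrightarrow> length ys = length xs"
  by (induction xs arbitrary: ys) auto

lemma finite_set_memoryless:
  "(\<And>x. finite (set_pmf (K x))) \<Longrightarrow> finite (set_pmf (memoryless K xs))"
  by (induction xs) auto

lemma finite_set_memoryless' [simp]: "finite (set_pmf (memoryless (K :: _ \<Rightarrow> _ :: finite pmf) xs))"
  by (rule finite_set_memoryless) simp

lemma map_memoryless: "map_pmf (map f) (memoryless K xs) = memoryless (\<lambda>x. map_pmf f (K x)) xs"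
proof (induction xs)
  case (Cons x xs)
  then show ?case
    by (simp add: map_bind_pmf bind_map_pmf map_pmf_comp flip: Cons.IH)
qed simp

lemma memoryless_snoc: "memoryless K (xs @ [x]) = map_pmf (\<lambda>(l, y). l @ [y]) (joint (memoryless K xs) (\<lambda>_. K x))"
  by (simp add: memoryless_append joint_def map_bind_pmf map_pmf_comp bind_return_pmf map_pmf_def bind_assoc_pmf)

lemma memoryless_split:
  assumes "j < length xs"
  shows "memoryless K xs = bind_pmf (memoryless K (take j xs)) (\<lambda>l. bind_pmf (K (xs ! j)) (\<lambda>y.
    map_pmf (\<lambda>r. l @ y # r) (memoryless K (drop (Suc j) xs))))"
  by (subst id_take_nth_drop[OF assms], subst memoryless_append) (simp add: map_bind_pmf map_pmf_comp)

text \<open>Entropy depends only on the partition of the support into fibres. Regroupings of tuples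
  and lists of outputs are settled this way, without exhibiting bijections.\<close>

lemma ent_fibres:
  assumes "\<And>a b. a \<in> set_pmf J \<Longrightarrow> b \<in> set_pmf J \<Longrightarrow> g a = g b \<longleftrightarrow> f a = f b"
  shows "ent (map_pmf g J) = ent (map_pmf f J)"
proof -
  \<comment> \<open>Recodes values of \<open>f\<close> into values of \<open>g\<close> through a
    chosen preimage in the support.\<close>
  define \<phi> where "\<phi> y = g (SOME a. a \<in> set_pmf J \<and> f a = y)" for y
  have \<phi>: "\<phi> (f a) = g a" if "a \<in> set_pmf J" for a
    using someI[of "\<lambda>b. b \<in> set_pmf J \<and> f b = f a" a] that assms unfolding \<phi>_def by blast
  have "map_pmf g J = map_pmf \<phi> (map_pmf f J)"
    unfolding map_pmf_comp by (rule map_pmf_cong) (auto simp: \<phi>)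
  moreover have "inj_on \<phi> (set_pmf (map_pmf f J))"
    using assms by (auto simp: inj_on_def \<phi>)
  ultimately show ?thesis by (simp add: ent_map_inj)
qed

section \<open>Output entropies and the less-noisy order\<close>

definition outent :: "('x \<Rightarrow> 'y pmf) \<Rightarrow> 'x pmf \<Rightarrow> real" where
  "outent V p = ent (bind_pmf p V)"

definition out1 :: "('x, 'y1, 'y2) dmbc \<Rightarrow> 'x \<Rightarrow> 'y1 pmf" where
  "out1 W x = map_pmf fst (W x)"

definition out2 :: "('x, 'y1, 'y2) dmbc \<Rightarrow> 'x \<Rightarrow> 'y2 pmf" where
  "out2 W x = map_pmf snd (W x)"

text \<open>An auxiliary variable \<open>U\<close> is represented by the law \<open>\<mu>\<close> of the posterior of \<open>X\<close> given \<open>U\<close>: the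
  quantities \<open>I(U;Y)\<close> (\<open>I_U\<close>) and \<open>I(X;Y|U)\<close> (\<open>I_X\<close>) depend on nothing else.\<close>

definition I_U :: "('x \<Rightarrow> 'y pmf) \<Rightarrow> 'x pmf pmf \<Rightarrow> real" where
  "I_U V \<mu> = outent V (bind_pmf \<mu> id) - mean \<mu> (outent V)"

definition I_X :: "('x \<Rightarrow> 'y pmf) \<Rightarrow> 'x pmf pmf \<Rightarrow> real" where
  "I_X V \<mu> = mean \<mu> (outent V) - mean (bind_pmf \<mu> id) (\<lambda>x. ent (V x))"

text \<open>Its Jensen gap at \<open>\<mu>\<close> is \<open>I(U;Y2) - I(U;Y1)\<close>, so a channel
  is less-noisy exactly when this function is concave.\<close>

definition outent_gap :: "('x, 'y1, 'y2) dmbc \<Rightarrow> 'x pmf \<Rightarrow> real" where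
  "outent_gap W p = outent (out2 W) p - outent (out1 W) p"

lemma outent_concave:
  fixes V :: "'x::finite \<Rightarrow> 'y::finite pmf"
  assumes "finite (set_pmf \<nu>)"
  shows "mean \<nu> (\<lambda>s. outent V (k s)) \<le> outent V (bind_pmf \<nu> k)"
  unfolding outent_def bind_assoc_pmf by (rule ent_concave) (simp_all add: assms)

lemma I_X_nonneg:
  fixes V :: "'x::finite \<Rightarrow> 'y::finite pmf"
  assumes "finite (set_pmf \<mu>)"
  shows "0 \<le> I_X V \<mu>"
proof -
  have "mean (bind_pmf \<mu> id) (\<lambda>x. ent (V x)) = mean \<mu> (\<lambda>p. mean p (\<lambda>x. ent (V x)))"
    by (subst mean_bind) (simp_all add: assms)
  also have "\<dots> \<le> mean \<mu> (outent V)"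
    unfolding outent_def by (intro mean_mono assms ent_concave) simp_all
  finally show ?thesis by (simp add: I_X_def)
qed

text \<open>The output sees the experiment only through \<open>X\<close>, so its conditional law
  given \<open>S\<close> is the channel applied to the posterior of \<open>X\<close>; the chain rule
  does the rest. The function \<open>f\<close> selects a receiver.\<close>

lemma ent_output:
  fixes W :: "'x \<Rightarrow> 'y::finite pmf" and f :: "'y \<Rightarrow> 'z"
  assumes fin: "finite (set_pmf B)"
  shows "ent (map_pmf (\<lambda>(\<omega>, y). (S \<omega>, f y)) (joint B (\<lambda>\<omega>. W (X \<omega>)))) =
    ent (map_pmf S B) + mean (map_pmf S B)
      (\<lambda>s. outent (\<lambda>x. map_pmf f (W x)) (map_pmf X (cnd B S s)))"
proof -
  have "map_pmf (\<lambda>(\<omega>, y). (S \<omega>, f y)) (joint B (\<lambda>\<omega>. W (X \<omega>))) =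
      bind_pmf B (\<lambda>\<omega>. map_pmf (\<lambda>y. (S \<omega>, f y)) (W (X \<omega>)))"
    by (simp add: joint_def map_bind_pmf map_pmf_comp)
  also have "\<dots> = bind_pmf (map_pmf S B) (\<lambda>s. bind_pmf (cnd B S s)
      (\<lambda>\<omega>. map_pmf (\<lambda>y. (S \<omega>, f y)) (W (X \<omega>))))"
    unfolding bind_assoc_pmf[symmetric] bind_cnd ..
  also have "\<dots> = bind_pmf (map_pmf S B) (\<lambda>s. bind_pmf (cnd B S s)
      (\<lambda>\<omega>. map_pmf (\<lambda>y. (s, f y)) (W (X \<omega>))))"
    by (intro bind_pmf_cong refl) (auto simp: set_cnd)
  also have "\<dots> = joint (map_pmf S B)
      (\<lambda>s. bind_pmf (map_pmf X (cnd B S s)) (\<lambda>x. map_pmf f (W x)))"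
    by (simp add: joint_def map_bind_pmf bind_map_pmf map_pmf_comp)
  finally show ?thesis
    unfolding outent_def by (simp only:) (rule ent_joint, auto simp: fin finite_set_cnd)
qed

text \<open>The inequality \<open>I(T;Y2|S) \<ge> I(T;Y1|S)\<close> for a single channel use, in the
  form \<open>H(T|S,Y2) \<le> H(T|S,Y1)\<close>.\<close>

lemma less_noisy_step:
  fixes W :: "('x, 'y1::finite, 'y2::finite) dmbc"
  fixes X :: "'b \<Rightarrow> 'x"
  assumes ln: "concave_pmf (outent_gap W)" and fin: "finite (set_pmf B)"
  defines "J \<equiv> joint B (\<lambda>\<omega>. W (X \<omega>))"
  shows "ent (map_pmf (\<lambda>(\<omega>, y). ((S \<omega>, T \<omega>), snd y)) J) - ent (map_pmf (\<lambda>(\<omega>, y). (S \<omega>, snd y)) J)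
    \<le> ent (map_pmf (\<lambda>(\<omega>, y). ((S \<omega>, T \<omega>), fst y)) J) - ent (map_pmf (\<lambda>(\<omega>, y). (S \<omega>, fst y)) J)"
  using concave_pmf_cnd[OF ln fin, of S T X]
  unfolding J_def ent_output[OF fin, of "\<lambda>\<omega>. (S \<omega>, T \<omega>)"] ent_output[OF fin, of S]
  unfolding outent_gap_def out1_def[abs_def] out2_def[abs_def]
  by (simp add: mean_diff fin)

text \<open>The outputs at Receiver 2 are exchanged for those at Receiver 1 one at a time.\<close>

lemma less_noisy_block:
  fixes W :: "('x, 'y1::finite, 'y2::finite) dmbc"
  assumes ln: "concave_pmf (outent_gap W)" and fin: "finite (set_pmf B)"
    and len: "\<And>\<omega>. \<omega> \<in> set_pmf B \<Longrightarrow> length (xs \<omega>) = k"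
  defines "J \<equiv> joint B (\<lambda>\<omega>. memoryless W (xs \<omega>))"
  shows "ent (map_pmf (\<lambda>(\<omega>, y). ((S \<omega>, T \<omega>), map snd y)) J) - ent (map_pmf (\<lambda>(\<omega>, y). (S \<omega>, map snd y)) J)
    \<le> ent (map_pmf (\<lambda>(\<omega>, y). ((S \<omega>, T \<omega>), map fst y)) J) - ent (map_pmf (\<lambda>(\<omega>, y). (S \<omega>, map fst y)) J)"
proof -
  \<comment> \<open>Hybrid outputs: those of Receiver 1 at the first \<open>j\<close> positions,
    those of Receiver 2 from there on. \<open>D j\<close> is the conditional entropy of
    \<open>T\<close> given \<open>S\<close> and the hybrid; it grows with \<open>j\<close>.\<close>
  define Z where "Z j y = (map fst (take j y), map snd (drop j y))" for j and y :: "('y1 \<times> 'y2) list"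
  define D where "D j = ent (map_pmf (\<lambda>(\<omega>, y). ((S \<omega>, T \<omega>), Z j y)) J) - ent (map_pmf (\<lambda>(\<omega>, y). (S \<omega>, Z j y)) J)" for j
  have step: "D j \<le> D (Suc j)" if j: "j < k" for j
  proof -
    \<comment> \<open>Everything except the output at position \<open>j\<close> is moved into the
      experiment, so that this output is one channel use. It may be generated last because the
      outputs are independent given the inputs.\<close>
    define B' where "B' = joint B (\<lambda>\<omega>. joint (memoryless W (take j (xs \<omega>))) (\<lambda>_. memoryless W (drop (Suc j) (xs \<omega>))))"
    define J' where "J' = joint B' (\<lambda>b. W (xs (fst b) ! j))"
    have fin': "finite (set_pmf B')" by (simp add: B'_def fin)
    have "J = map_pmf (\<lambda>((\<omega>, l, r), y). (\<omega>, l @ y # r)) J'"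
    proof -
      have "J = bind_pmf B (\<lambda>\<omega>. map_pmf (Pair \<omega>) (bind_pmf (memoryless W (take j (xs \<omega>))) (\<lambda>l.
          bind_pmf (W (xs \<omega> ! j)) (\<lambda>y. map_pmf (\<lambda>r. l @ y # r) (memoryless W (drop (Suc j) (xs \<omega>)))))))"
        unfolding J_def joint_def by (intro bind_pmf_cong refl arg_cong[where f = "map_pmf _"] memoryless_split) (simp add: len j)
      also have "\<dots> = bind_pmf B (\<lambda>\<omega>. bind_pmf (memoryless W (take j (xs \<omega>))) (\<lambda>l.
          bind_pmf (memoryless W (drop (Suc j) (xs \<omega>))) (\<lambda>r. map_pmf (\<lambda>y. (\<omega>, l @ y # r)) (W (xs \<omega> ! j)))))"
        unfolding map_bind_pmf map_pmf_comp
        by (subst (2) map_pmf_def, subst bind_commute_pmf) (simp add: map_pmf_def)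
      also have "\<dots> = map_pmf (\<lambda>((\<omega>, l, r), y). (\<omega>, l @ y # r)) J'"
        by (simp add: J'_def B'_def joint_def map_bind_pmf bind_map_pmf map_pmf_comp bind_assoc_pmf)
      finally show ?thesis .
    qed
    note J = this
    \<comment> \<open>The known length of the left part makes the decomposition around position
      \<open>j\<close> unique, as the comparison of fibres requires.\<close>
    have len_l: "length l = j" if "((\<omega>, l, r), y) \<in> set_pmf J'" for \<omega> l r y
      using that j by (auto simp: J'_def B'_def dest!: length_memoryless len)
    \<comment> \<open>The remaining hybrid outputs join the conditioning variable; they are common
      to \<open>Z j\<close> and \<open>Z (Suc j)\<close>.\<close>
    define S' where "S' = (\<lambda>(\<omega>, l :: ('y1 \<times> 'y2) list, r :: ('y1 \<times> 'y2) list). (S \<omega>, map fst l, map snd r))"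
    define T' where "T' = (\<lambda>(\<omega>, l :: ('y1 \<times> 'y2) list, r :: ('y1 \<times> 'y2) list). T \<omega>)"
    have *: "ent (map_pmf (\<lambda>(b, y). ((S' b, T' b), snd y)) J') - ent (map_pmf (\<lambda>(b, y). (S' b, snd y)) J')
      \<le> ent (map_pmf (\<lambda>(b, y). ((S' b, T' b), fst y)) J') - ent (map_pmf (\<lambda>(b, y). (S' b, fst y)) J')"
      unfolding J'_def by (rule less_noisy_step[OF ln fin'])
    have "ent (map_pmf (\<lambda>(\<omega>, y). ((S \<omega>, T \<omega>), Z j y)) J) = ent (map_pmf (\<lambda>(b, y). ((S' b, T' b), snd y)) J')"
      "ent (map_pmf (\<lambda>(\<omega>, y). (S \<omega>, Z j y)) J) = ent (map_pmf (\<lambda>(b, y). (S' b, snd y)) J')"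
      "ent (map_pmf (\<lambda>(\<omega>, y). ((S \<omega>, T \<omega>), Z (Suc j) y)) J) = ent (map_pmf (\<lambda>(b, y). ((S' b, T' b), fst y)) J')"
      "ent (map_pmf (\<lambda>(\<omega>, y). (S \<omega>, Z (Suc j) y)) J) = ent (map_pmf (\<lambda>(b, y). (S' b, fst y)) J')"
      unfolding J map_pmf_comp
      by (rule ent_fibres; auto simp: Z_def S'_def T'_def dest!: len_l)+
    then show ?thesis using * by (simp add: D_def)
  qed
  have "D 0 \<le> D j" if "j \<le> k" for j
    using that by (induction j) (auto intro: order_trans[OF _ step])
  from this[of k] have "D 0 \<le> D k" by simp
  moreover have "length y = k" if "(\<omega>, y) \<in> set_pmf J" for \<omega> y
    using that by (auto simp: J_def len dest!: length_memoryless)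
  then have "ent (map_pmf (\<lambda>(\<omega>, y). ((S \<omega>, T \<omega>), Z k y)) J) = ent (map_pmf (\<lambda>(\<omega>, y). ((S \<omega>, T \<omega>), map fst y)) J)"
    "ent (map_pmf (\<lambda>(\<omega>, y). (S \<omega>, Z k y)) J) = ent (map_pmf (\<lambda>(\<omega>, y). (S \<omega>, map fst y)) J)"
    by (intro ent_fibres; auto simp: Z_def)+
  moreover have "ent (map_pmf (\<lambda>(\<omega>, y). ((S \<omega>, T \<omega>), Z 0 y)) J) = ent (map_pmf (\<lambda>(\<omega>, y). ((S \<omega>, T \<omega>), map snd y)) J)"
    "ent (map_pmf (\<lambda>(\<omega>, y). (S \<omega>, Z 0 y)) J) = ent (map_pmf (\<lambda>(\<omega>, y). (S \<omega>, map snd y)) J)"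
    by (intro ent_fibres; auto simp: Z_def)+
  ultimately show ?thesis by (simp add: D_def)
qed

text \<open>The auxiliary variable at time \<open>i\<close> is \<open>(M\<^sub>1, Y\<^sub>2\<^sub>,\<^sub>1, \<dots>, Y\<^sub>2\<^sub>,\<^sub>i\<^sub>-\<^sub>1)\<close>.\<close>

lemma single_letter_sum:
  fixes W :: "('x::finite, 'y1::finite, 'y2::finite) dmbc" and x :: "'m1 \<times> 'm2 \<Rightarrow> 'x list"
  assumes ln: "concave_pmf (outent_gap W)" and fin: "finite (set_pmf U)"
    and len: "\<And>m. m \<in> set_pmf U \<Longrightarrow> length (x m) = n"
  defines "J \<equiv> joint U (\<lambda>m. memoryless W (x m))"
  obtains \<mu> :: "nat \<Rightarrow> 'x pmf pmf" where "\<And>i. finite (set_pmf (\<mu> i))"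
    "ent (map_pmf (\<lambda>(m, y). map fst y) J) + ent (map_pmf fst U) - ent (map_pmf (\<lambda>(m, y). (fst m, map fst y)) J)
      \<le> (\<Sum>i<n. I_U (out1 W) (\<mu> i))"
    "ent (map_pmf (\<lambda>(m, y). (fst m, map snd y)) J) - ent (map_pmf fst U) - ent (map_pmf (\<lambda>(m, y). (m, map snd y)) J) + ent U
      = (\<Sum>i<n. I_X (out2 W) (\<mu> i))"
proof -
  define P where "P i = joint U (\<lambda>m. memoryless W (take i (x m)))" for i
  define S where "S = (\<lambda>(m :: 'm1 \<times> 'm2, y :: ('y1 \<times> 'y2) list). (fst m, map snd y))"
  define X where "X i = (\<lambda>(m, y :: ('y1 \<times> 'y2) list). x m ! i)" for i
  define \<mu> where "\<mu> i = map_pmf (\<lambda>s. map_pmf (X i) (cnd (P i) S s)) (map_pmf S (P i))" for i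
  define Q where "Q i = joint (P i) (\<lambda>b. W (X i b))" for i
  have finP [simp]: "finite (set_pmf (P i))" for i by (simp add: P_def fin)
  have fin\<mu> [simp]: "finite (set_pmf (\<mu> i))" for i by (simp add: \<mu>_def)
  have P_Suc: "P (Suc i) = map_pmf (\<lambda>((m, l), y). (m, l @ [y])) (Q i)" if "i < n" for i
  proof -
    have "P (Suc i) = bind_pmf U (\<lambda>m. map_pmf (Pair m) (memoryless W (take i (x m) @ [x m ! i])))"
      unfolding P_def joint_def using that
      by (intro bind_pmf_cong refl) (simp add: take_Suc_conv_app_nth len)
    then show ?thesis
      by (simp add: memoryless_snoc Q_def P_def X_def joint_def map_bind_pmf bind_map_pmf bind_assoc_pmf map_pmf_comp)
  qed
  have P_n: "P n = J"
    unfolding P_def J_def joint_def by (intro bind_pmf_cong refl) (simp add: len)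
  have join: "bind_pmf (\<mu> i) id = map_pmf (X i) (P i)" for i
  proof -
    have "bind_pmf (\<mu> i) id = bind_pmf (map_pmf S (P i)) (\<lambda>s. map_pmf (X i) (cnd (P i) S s))"
      unfolding \<mu>_def by (subst bind_map_pmf) simp
    also have "\<dots> = map_pmf (X i) (bind_pmf (map_pmf S (P i)) (cnd (P i) S))"
      by (simp only: map_bind_pmf)
    finally show ?thesis by (simp only: bind_cnd)
  qed
  \<comment> \<open>Entropies of the experiment stopped after \<open>i\<close> uses. The sums in the
    claim telescope over them: \<open>y1 - h1\<close> leads to \<open>I(M1;Y1)\<close>, and
    \<open>h2 - g2\<close> to \<open>I(M2;Y2|M1)\<close>.\<close>
  define h1 where "h1 i = ent (map_pmf (\<lambda>(m, y). (fst m, map fst y)) (P i))" for i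
  define h2 where "h2 i = ent (map_pmf (\<lambda>(m, y). (fst m, map snd y)) (P i))" for i
  define g2 where "g2 i = ent (map_pmf (\<lambda>(m, y). (m, map snd y)) (P i))" for i
  define y1 where "y1 i = ent (map_pmf (\<lambda>(m, y). map fst y) (P i))" for i
  have h2: "h2 (Suc i) - h2 i = mean (\<mu> i) (outent (out2 W))" if "i < n" for i
  proof -
    have "h2 (Suc i) = ent (map_pmf (\<lambda>(b, y). (S b, snd y)) (Q i))"
      unfolding h2_def P_Suc[OF that] map_pmf_comp
      by (rule ent_fibres) (auto simp: S_def)
    also have "\<dots> = h2 i + mean (\<mu> i) (outent (out2 W))"
      unfolding Q_def by (subst ent_output) (auto simp: h2_def S_def \<mu>_def out2_def[abs_def])
    finally show ?thesis by simp
  qed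
  have g2: "g2 (Suc i) - g2 i = mean (bind_pmf (\<mu> i) id) (\<lambda>x. ent (out2 W x))" if "i < n" for i
  proof -
    let ?\<nu> = "map_pmf (\<lambda>(m, y). (m, map snd y)) (P i)"
    have "g2 (Suc i) = ent (map_pmf (\<lambda>((m, l), y). ((m, map snd l), snd y)) (Q i))"
      unfolding g2_def P_Suc[OF that] map_pmf_comp
      by (rule ent_fibres) auto
    also have "map_pmf (\<lambda>((m, l), y). ((m, map snd l), snd y)) (Q i) = joint ?\<nu> (\<lambda>(m, l). out2 W (x m ! i))"
      by (simp add: Q_def joint_def map_bind_pmf bind_map_pmf map_pmf_comp out2_def X_def case_prod_unfold)
    also have "ent \<dots> = g2 i + mean ?\<nu> (\<lambda>(m, l). ent (out2 W (x m ! i)))"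
      by (subst ent_joint) (auto simp: g2_def case_prod_unfold)
    also have "mean ?\<nu> (\<lambda>(m, l). ent (out2 W (x m ! i))) = mean (bind_pmf (\<mu> i) id) (\<lambda>x. ent (out2 W x))"
      unfolding join by (simp add: X_def case_prod_unfold)
    finally show ?thesis by simp
  qed
  \<comment> \<open>Here less-noisiness enters: the entropy of the current \<open>Y1\<close>, given
    \<open>M1\<close> and the past of Receiver 1, is at least the entropy given \<open>M1\<close>
    and the past of Receiver 2. Only the latter past belongs to the auxiliary variable.\<close>
  have h1: "h1 (Suc i) - h1 i \<ge> mean (\<mu> i) (outent (out1 W))" if "i < n" for i
  proof -
    \<comment> \<open>The current output of Receiver 1 is attached to the messages and plays the
      role of \<open>T\<close>; the past outputs form the block. Without feedback the two are
      independent given the messages.\<close>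
    define B where "B = map_pmf (\<lambda>(m, y). (m, fst y)) (joint U (\<lambda>m. W (x m ! i)))"
    define J' where "J' = joint B (\<lambda>\<omega>. memoryless W (take i (x (fst \<omega>))))"
    have "J' = map_pmf (\<lambda>((m, l), y). ((m, fst y), l)) (Q i)"
      unfolding J'_def B_def Q_def P_def joint_def X_def
      by (simp add: map_bind_pmf bind_map_pmf bind_assoc_pmf map_pmf_comp)
         (simp add: map_pmf_def bind_commute_pmf[of "W _"])
    note J' = this
    have "ent (map_pmf (\<lambda>(\<omega>, y). ((fst (fst \<omega>), snd \<omega>), map snd y)) J') - ent (map_pmf (\<lambda>(\<omega>, y). (fst (fst \<omega>), map snd y)) J')
      \<le> ent (map_pmf (\<lambda>(\<omega>, y). ((fst (fst \<omega>), snd \<omega>), map fst y)) J') - ent (map_pmf (\<lambda>(\<omega>, y). (fst (fst \<omega>), map fst y)) J')"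
      unfolding J'_def using that
      by (intro less_noisy_block[OF ln, where k = i]) (auto simp: B_def fin len)
    moreover have "ent (map_pmf (\<lambda>(\<omega>, y). ((fst (fst \<omega>), snd \<omega>), map fst y)) J') = h1 (Suc i)"
      unfolding h1_def P_Suc[OF that] J' map_pmf_comp by (rule ent_fibres) auto
    moreover have "map_pmf fst (Q i) = P i" by (simp add: Q_def)
    then have "h1 i = ent (map_pmf (\<lambda>(m, y). (fst m, map fst y)) (map_pmf fst (Q i)))"
      "h2 i = ent (map_pmf (\<lambda>(m, y). (fst m, map snd y)) (map_pmf fst (Q i)))"
      by (simp_all add: h1_def h2_def)
    then have "ent (map_pmf (\<lambda>(\<omega>, y). (fst (fst \<omega>), map fst y)) J') = h1 i"
      "ent (map_pmf (\<lambda>(\<omega>, y). (fst (fst \<omega>), map snd y)) J') = h2 i"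
      by (simp_all add: J' map_pmf_comp case_prod_unfold)
    moreover have "ent (map_pmf (\<lambda>(\<omega>, y). ((fst (fst \<omega>), snd \<omega>), map snd y)) J') =
        ent (map_pmf (\<lambda>(b, y). (S b, fst y)) (Q i))"
      unfolding J' map_pmf_comp by (rule ent_fibres) (auto simp: S_def)
    moreover have "\<dots> = h2 i + mean (\<mu> i) (outent (out1 W))"
      unfolding Q_def by (subst ent_output) (auto simp: h2_def S_def \<mu>_def out1_def[abs_def])
    ultimately show ?thesis by simp
  qed
  have y1: "y1 (Suc i) \<le> y1 i + outent (out1 W) (bind_pmf (\<mu> i) id)" if "i < n" for i
  proof -
    have "y1 (Suc i) = ent (map_pmf (\<lambda>b. (map fst (snd (fst b)), fst (snd b))) (Q i))"
      unfolding y1_def P_Suc[OF that] map_pmf_comp by (rule ent_fibres) auto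
    also have "\<dots> \<le> ent (map_pmf (\<lambda>b. map fst (snd (fst b))) (Q i)) + ent (map_pmf (\<lambda>b. fst (snd b)) (Q i))"
      by (rule ent_pair_le) (simp add: Q_def)
    also have "map_pmf (\<lambda>b. map fst (snd (fst b))) (Q i) = map_pmf (\<lambda>(m, y). map fst y) (map_pmf fst (Q i))"
      by (simp add: map_pmf_comp case_prod_unfold)
    also have "\<dots> = map_pmf (\<lambda>(m, y). map fst y) (P i)" by (simp add: Q_def)
    also have "map_pmf (\<lambda>b. fst (snd b)) (Q i) = bind_pmf (bind_pmf (\<mu> i) id) (out1 W)"
      unfolding join by (simp add: Q_def joint_def map_bind_pmf bind_map_pmf map_pmf_comp out1_def)
    finally show ?thesis by (simp add: y1_def outent_def)
  qed
  have P0: "P 0 = map_pmf (\<lambda>m. (m, [])) U"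
    by (simp add: P_def joint_def map_pmf_def bind_return_pmf)
  have "h1 0 = ent (map_pmf fst U)" "h2 0 = ent (map_pmf fst U)"
    unfolding h1_def h2_def P0 map_pmf_comp by (rule ent_fibres; simp)+
  moreover have "g2 0 = ent U"
    using ent_fibres[of U "\<lambda>m. (m, [])" "\<lambda>m. m"] by (simp add: g2_def P0 map_pmf_comp)
  moreover have "y1 0 = 0" by (simp add: y1_def P0 map_pmf_comp)
  moreover have "y1 k - (h1 k - h1 0) \<le> y1 0 + (\<Sum>i<k. I_U (out1 W) (\<mu> i))" if "k \<le> n" for k
    using that
  proof (induction k)
    case (Suc k)
    then show ?case using y1[of k] h1[of k] by (simp add: I_U_def)
  qed simp
  moreover have "(h2 k - h2 0) - (g2 k - g2 0) = (\<Sum>i<k. I_X (out2 W) (\<mu> i))" if "k \<le> n" for k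
    using that
  proof (induction k)
    case (Suc k)
    then show ?case using h2[of k] g2[of k] by (simp add: I_X_def)
  qed simp
  ultimately show thesis
    by (intro that[of \<mu>]) (force simp: y1_def h1_def h2_def g2_def P_n)+
qed

text \<open>Averaging the laws \<open>\<mu> i\<close> amounts to including a uniform time index in
  the auxiliary variable. Both terms of \<open>I_X\<close> are linear in the law, hence the
  equality; in \<open>I_U\<close> the output entropy of the averaged input law can only be
  larger.\<close>

lemma time_sharing:
  fixes V1 :: "'x::finite \<Rightarrow> 'y::finite pmf" and V2 :: "'x \<Rightarrow> 'z::finite pmf"
  assumes fin: "\<And>i. finite (set_pmf (\<mu> i))" and n: "n > (0::nat)"
  obtains \<nu> where "finite (set_pmf \<nu>)" "(\<Sum>i<n. I_U V1 (\<mu> i)) \<le> n * I_U V1 \<nu>"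
    "(\<Sum>i<n. I_X V2 (\<mu> i)) = n * I_X V2 \<nu>"
proof -
  define q where "q = pmf_of_set {..<n}"
  have ne: "{..<n} \<noteq> {}" using n by auto
  have finq: "finite (set_pmf q)" by (simp add: q_def ne)
  define \<nu> where "\<nu> = bind_pmf q \<mu>"
  have mean_q: "(\<Sum>i<n. f i) = n * mean q f" for f
    using n by (simp add: q_def integral_pmf_of_set ne)
  have mean_\<nu>: "mean \<nu> f = mean q (\<lambda>i. mean (\<mu> i) f)" for f
    unfolding \<nu>_def by (rule mean_bind) (auto simp: finq fin)
  have join: "bind_pmf \<nu> id = bind_pmf q (\<lambda>i. bind_pmf (\<mu> i) id)"
    by (simp add: \<nu>_def bind_assoc_pmf)
  have "mean q (\<lambda>i. I_U V1 (\<mu> i)) \<le> I_U V1 \<nu>"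
    using outent_concave[OF finq, of V1 "\<lambda>i. bind_pmf (\<mu> i) id"]
    by (simp add: I_U_def mean_diff finq mean_\<nu> join)
  moreover have "mean q (\<lambda>i. I_X V2 (\<mu> i)) = I_X V2 \<nu>"
    unfolding I_X_def by (simp add: mean_diff finq mean_\<nu> join) (subst mean_bind, auto simp: finq)
  moreover have "finite (set_pmf \<nu>)" by (simp add: \<nu>_def finq fin)
  ultimately show thesis using n by (intro that[of \<nu>]) (simp_all add: mean_q)
qed

lemma pair_joint: "pair_pmf A B = joint A (\<lambda>_. B)"
  by (simp add: pair_pmf_def joint_def map_pmf_def)

text \<open>Fano's inequality at both receivers, combined with the single-letter sums for
  \<open>I(M1;Y1)\<close> and \<open>I(M2;Y2|M1)\<close>.\<close>

lemma block_converse: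
  fixes W :: "('x::finite, 'y1::finite, 'y2::finite) dmbc" and x :: "'m1 \<times> 'm2 \<Rightarrow> 'x list"
  assumes ln: "concave_pmf (outent_gap W)" and A: "finite A1" "A1 \<noteq> {}" "finite A2" "A2 \<noteq> {}"
    and len: "\<And>m. length (x m) = n" and n: "n > 0"
  defines "J \<equiv> joint (pair_pmf (pmf_of_set A1) (pmf_of_set A2)) (\<lambda>m. memoryless W (x m))"
  assumes e: "e = measure_pmf.prob J {((m1, m2), ys). m1 \<noteq> d1 (map fst ys) \<or> m2 \<noteq> d2 (map snd ys)}"
  obtains \<mu> where "finite (set_pmf \<mu>)" "n * I_U (out1 W) \<mu> \<ge> (1 - e) * log 2 (card A1) - 1"
    "n * I_X (out2 W) \<mu> \<ge> (1 - e) * log 2 (card A2) - 1"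
proof -
  define U where "U = pair_pmf (pmf_of_set A1) (pmf_of_set A2)"
  have finU: "finite (set_pmf U)" by (simp add: U_def A)
  have finJ: "finite (set_pmf J)" unfolding J_def U_def[symmetric] by (simp add: finU)
  have J: "J = joint U (\<lambda>m. memoryless W (x m))" by (simp add: J_def U_def)
  obtain \<mu>' :: "nat \<Rightarrow> 'x pmf pmf" where \<mu>': "\<And>i. finite (set_pmf (\<mu>' i))"
    "ent (map_pmf (\<lambda>(m, y). map fst y) J) + ent (map_pmf fst U) - ent (map_pmf (\<lambda>(m, y). (fst m, map fst y)) J)
      \<le> (\<Sum>i<n. I_U (out1 W) (\<mu>' i))"
    "ent (map_pmf (\<lambda>(m, y). (fst m, map snd y)) J) - ent (map_pmf fst U) - ent (map_pmf (\<lambda>(m, y). (m, map snd y)) J) + ent U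
      = (\<Sum>i<n. I_X (out2 W) (\<mu>' i))"
    unfolding J by (rule single_letter_sum[OF ln finU, of x n]) (auto simp: len)
  obtain \<mu> where \<mu>: "finite (set_pmf \<mu>)" "(\<Sum>i<n. I_U (out1 W) (\<mu>' i)) \<le> n * I_U (out1 W) \<mu>"
    "(\<Sum>i<n. I_X (out2 W) (\<mu>' i)) = n * I_X (out2 W) \<mu>"
    by (rule time_sharing[where \<mu> = \<mu>', OF \<mu>'(1) n])
  have card: "log 2 (card A1) \<ge> 0" "log 2 (card A2) \<ge> 0"
    using A by (simp_all add: Suc_le_eq card_gt_0_iff)
  have M1: "ent (map_pmf fst U) = log 2 (card A1)"
    by (simp add: U_def map_fst_pair_pmf ent_pmf_of_set A)
  have M: "ent U = log 2 (card A1) + log 2 (card A2)"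
    unfolding U_def pair_joint by (subst ent_joint) (simp_all add: A ent_pmf_of_set)
  define p1 where "p1 = measure_pmf.prob J {\<omega>. fst (fst \<omega>) \<noteq> d1 (map fst (snd \<omega>))}"
  define p2 where "p2 = measure_pmf.prob J {\<omega>. snd (fst \<omega>) \<noteq> d2 (map snd (snd \<omega>))}"
  have p: "p1 \<le> e" "p2 \<le> e"
    unfolding e p1_def p2_def by (intro measure_pmf.finite_measure_mono; auto)+
  have "ent (map_pmf (\<lambda>\<omega>. (map fst (snd \<omega>), fst (fst \<omega>))) J) - ent (map_pmf (\<lambda>\<omega>. map fst (snd \<omega>)) J)
      \<le> 1 + p1 * log 2 (card A1)"
    unfolding p1_def by (rule fano[OF finJ]) (auto simp: A J U_def)
  also have "ent (map_pmf (\<lambda>\<omega>. (map fst (snd \<omega>), fst (fst \<omega>))) J) = ent (map_pmf (\<lambda>(m, y). (fst m, map fst y)) J)"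
    by (rule ent_fibres) auto
  also have "p1 * log 2 (card A1) \<le> e * log 2 (card A1)"
    by (intro mult_right_mono p card)
  finally have 1: "ent (map_pmf (\<lambda>(m, y). (fst m, map fst y)) J) - ent (map_pmf (\<lambda>(m, y). map fst y) J)
    \<le> 1 + e * log 2 (card A1)" by (simp add: case_prod_unfold)
  \<comment> \<open>Receiver 2 decodes without \<open>M1\<close>. Adding \<open>M1\<close> to the
    conditioning cannot increase the entropy of \<open>M2\<close>, so its Fano bound carries
    over.\<close>
  have "ent (map_pmf (\<lambda>\<omega>. ((map snd (snd \<omega>), fst (fst \<omega>)), snd (fst \<omega>))) J)
      - ent (map_pmf (\<lambda>\<omega>. (map snd (snd \<omega>), fst (fst \<omega>))) J)
    \<le> ent (map_pmf (\<lambda>\<omega>. (map snd (snd \<omega>), snd (fst \<omega>))) J) - ent (map_pmf (\<lambda>\<omega>. map snd (snd \<omega>)) J)"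
    by (rule ent_submodular[OF finJ])
  also have "\<dots> \<le> 1 + p2 * log 2 (card A2)"
    unfolding p2_def by (rule fano[OF finJ]) (auto simp: A J U_def)
  also have "ent (map_pmf (\<lambda>\<omega>. ((map snd (snd \<omega>), fst (fst \<omega>)), snd (fst \<omega>))) J)
      = ent (map_pmf (\<lambda>(m, y). (m, map snd y)) J)"
    by (rule ent_fibres) auto
  also have "ent (map_pmf (\<lambda>\<omega>. (map snd (snd \<omega>), fst (fst \<omega>))) J) = ent (map_pmf (\<lambda>(m, y). (fst m, map snd y)) J)"
    by (rule ent_fibres) auto
  also have "p2 * log 2 (card A2) \<le> e * log 2 (card A2)"
    by (intro mult_right_mono p card)
  finally have 2: "ent (map_pmf (\<lambda>(m, y). (m, map snd y)) J) - ent (map_pmf (\<lambda>(m, y). (fst m, map snd y)) J)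
    \<le> 1 + e * log 2 (card A2)" by simp
  show thesis
    using 1 2 \<mu> \<mu>' M1 M by (intro that[of \<mu>]) (auto simp: algebra_simps)
qed

section \<open>Codes of zero feedback rate\<close>

definition nofb_input :: "('x, 'y1, 'y2) fb_code \<Rightarrow> nat \<Rightarrow> nat \<Rightarrow> nat \<Rightarrow> 'x list" where
  "nofb_input c N m1 m2 =
     map (\<lambda>t. enc c t m1 m2 (map (\<lambda>s. the_elem (fb_alph c s)) [1..<t])) [1..<Suc N]"

text \<open>The product of the alphabet sizes is at most \<open>2 powr 0\<close> and each factor is
  at least 1. Feedback is therefore a fixed list, and the inputs are the functions of the messages
  given by \<open>nofb_input\<close>.\<close>

lemma nofb_alph:
  assumes v: "valid_code 0 N R1 R2 c" and t: "t \<in> {1..N}"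
  shows "\<exists>v. fb_alph c t = {v}"
proof -
  have fin: "finite (fb_alph c s)" "fb_alph c s \<noteq> {}" if "s \<in> {1..N}" for s
  proof -
    show "finite (fb_alph c s)" using v that by (auto simp: valid_code_def)
    have "fb_enc c s (replicate s undefined) \<in> fb_alph c s"
      using v that unfolding valid_code_def by (metis length_replicate)
    then show "fb_alph c s \<noteq> {}" by auto
  qed
  have "real (\<Prod>t=1..N. card (fb_alph c t)) \<le> 1"
    using v by (simp add: valid_code_def)
  then have "(\<Prod>t=1..N. card (fb_alph c t)) \<le> 1" by linarith
  moreover have "(\<Prod>t=1..N. card (fb_alph c t)) \<ge> 1"
    using fin by (intro prod_ge_1) (auto simp: Suc_le_eq card_gt_0_iff)
  ultimately have "(\<Prod>t=1..N. card (fb_alph c t)) = 1" by linarith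
  then have "card (fb_alph c t) = 1"
    using t by (subst (asm) prod_eq_1_iff) auto
  then show ?thesis by (rule card_1_singletonE) auto
qed

lemma outputs_nofb:
  assumes v: "valid_code 0 N R1 R2 c" and "n \<le> N"
  shows "outputs W c m1 m2 n = memoryless W (nofb_input c n m1 m2)"
  using \<open>n \<le> N\<close>
proof (induction n)
  case 0
  then show ?case by (simp add: nofb_input_def)
next
  case (Suc n)
  have fb: "feedback c (map fst ys) = map (\<lambda>s. the_elem (fb_alph c s)) [1..<Suc n]"
    if "ys \<in> set_pmf (memoryless W (nofb_input c n m1 m2))" for ys
  proof -
    have len: "length ys = n" using length_memoryless[OF that] by (simp add: nofb_input_def)
    show ?thesis unfolding feedback_def length_map len
    proof (rule map_cong[OF refl])
      fix t assume "t \<in> set [1..<Suc n]"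
      then have t: "t \<in> {1..N}" "t \<le> n" using Suc.prems by auto
      obtain v where a: "fb_alph c t = {v}" using nofb_alph[OF v t(1)] by auto
      have "fb_enc c t (take t (map fst ys)) \<in> fb_alph c t"
        using v t len by (auto simp: valid_code_def)
      then show "fb_enc c t (take t (map fst ys)) = the_elem (fb_alph c t)" by (simp add: a)
    qed
  qed
  have "outputs W c m1 m2 (Suc n) = bind_pmf (memoryless W (nofb_input c n m1 m2)) (\<lambda>ys.
       map_pmf (\<lambda>y. ys @ [y]) (W (enc c (Suc n) m1 m2 (map (\<lambda>s. the_elem (fb_alph c s)) [1..<Suc n]))))"
    using Suc by (auto simp: fb intro!: bind_pmf_cong)
  also have "\<dots> = memoryless W (nofb_input c (Suc n) m1 m2)"
    by (simp add: nofb_input_def memoryless_snoc joint_def map_bind_pmf map_pmf_comp)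
  finally show ?case .
qed

lemma messages_outputs_joint:
  "messages_outputs W N R1 R2 c = joint (pair_pmf (pmf_of_set (messages N R1)) (pmf_of_set (messages N R2)))
     (\<lambda>m. outputs W c (fst m) (snd m) N)"
  unfolding messages_outputs_def joint_def by (simp add: case_prod_unfold)

lemma card_messages: "real (card (messages N R)) \<le> 2 powr (real N * R)"
  by (simp add: messages_def)

text \<open>For \<open>z \<ge> 1\<close>, rounding down to an integer loses at most half of
  \<open>z\<close>, that is, one bit for the whole block.\<close>

lemma card_messages_ge:
  assumes "R \<ge> 0"
  shows "real (card (messages N R)) \<ge> 2 powr (real N * R) / 2" "messages N R \<noteq> {}" "1 \<in> messages N R"
proof -
  have z: "2 powr (real N * R) \<ge> (1::real)" using assms by (simp add: ge_one_powr_ge_zero)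
  then have "nat \<lfloor>2 powr (real N * R)\<rfloor> \<ge> 1" by (simp add: le_nat_iff)
  then show "messages N R \<noteq> {}" "1 \<in> messages N R" by (auto simp: messages_def)
  have "real (card (messages N R)) = of_int \<lfloor>2 powr (real N * R)\<rfloor>"
    using z by (simp add: messages_def)
  then show "real (card (messages N R)) \<ge> 2 powr (real N * R) / 2"
    using z one_le_floor[of "2 powr (real N * R)"] by linarith
qed

lemma finite_messages [simp]: "finite (messages N R)"
  by (simp add: messages_def)

lemma log_card_messages:
  assumes "R \<ge> 0"
  shows "log 2 (card (messages N R)) \<ge> N * R - 1"
proof -
  have "log 2 (2 powr (real N * R) / 2) \<le> log 2 (card (messages N R))"
    using card_messages_ge[OF assms, of N] by (intro log_mono) (auto simp: card_gt_0_iff)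
  then show ?thesis by (simp add: log_divide)
qed

text \<open>The block converse divided by \<open>N\<close>, at one blocklength large enough for
  error probability and rounding to cost less than \<open>\<delta>\<close>.\<close>

lemma converse_achievable:
  fixes W :: "('x::finite, 'y1::finite, 'y2::finite) dmbc"
  assumes ln: "concave_pmf (outent_gap W)" and ach: "achievable W 0 R1 R2" and \<delta>: "\<delta> > 0"
  obtains \<mu> where "finite (set_pmf \<mu>)" "I_U (out1 W) \<mu> \<ge> R1 - \<delta>" "I_X (out2 W) \<mu> \<ge> R2 - \<delta>"
proof -
  from ach obtain c :: "nat \<Rightarrow> ('x, 'y1, 'y2) fb_code" where R: "R1 \<ge> 0" "R2 \<ge> 0"
    and v: "\<And>N. N \<ge> 1 \<Longrightarrow> valid_code 0 N R1 R2 (c N)"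
    and lim: "(\<lambda>N. error_prob W N R1 R2 (c N)) \<longlonglongrightarrow> 0"
    by (auto simp: achievable_def)
  define e where "e N = error_prob W N R1 R2 (c N)" for N
  \<comment> \<open>The bound of the block converse per channel use, with \<open>N * R - 1\<close>
    for the logarithm of the number of messages.\<close>
  have lim': "(\<lambda>N. (1 - e N) * (R - 1 / real N) - 1 / real N) \<longlonglongrightarrow> R" for R
    using lim unfolding e_def[symmetric] by (auto intro!: tendsto_eq_intros lim_1_over_n)
  have "\<forall>\<^sub>F N in sequentially. (1 - e N) * (R1 - 1 / real N) - 1 / real N > R1 - \<delta>
     \<and> (1 - e N) * (R2 - 1 / real N) - 1 / real N > R2 - \<delta> \<and> N \<ge> 1"
    by (intro eventually_conj order_tendstoD(1)[OF lim'] eventually_ge_at_top) (use \<delta> in auto)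
  then obtain N where N: "(1 - e N) * (R1 - 1 / real N) - 1 / real N > R1 - \<delta>"
    "(1 - e N) * (R2 - 1 / real N) - 1 / real N > R2 - \<delta>" "N \<ge> 1"
    by (auto simp: eventually_sequentially)
  have e_eq: "e N = measure_pmf.prob (joint (pair_pmf (pmf_of_set (messages N R1)) (pmf_of_set (messages N R2)))
     (\<lambda>m. memoryless W (nofb_input (c N) N (fst m) (snd m))))
     {((m1, m2), ys). m1 \<noteq> dec1 (c N) (map fst ys) \<or> m2 \<noteq> dec2 (c N) (map snd ys)}"
    unfolding e_def error_prob_def messages_outputs_joint by (simp add: outputs_nofb[OF v[OF N(3)]])
  have "e N \<le> 1" unfolding e_eq by simp
  obtain \<mu> where \<mu>: "finite (set_pmf \<mu>)"
    "N * I_U (out1 W) \<mu> \<ge> (1 - e N) * log 2 (card (messages N R1)) - 1"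
    "N * I_X (out2 W) \<mu> \<ge> (1 - e N) * log 2 (card (messages N R2)) - 1"
    by (rule block_converse[OF ln _ _ _ _ _ _ e_eq]) (use N R in \<open>auto simp: card_messages_ge nofb_input_def\<close>)
  have *: "N * I \<ge> N * ((1 - e N) * (R - 1 / real N) - 1 / real N)"
    if "N * I \<ge> (1 - e N) * log 2 (card (messages N R)) - 1" "R \<ge> 0" for I R :: real
  proof -
    have "N * ((1 - e N) * (R - 1 / real N) - 1 / real N) = (1 - e N) * (N * R - 1) - 1"
      using N(3) by (simp add: field_simps)
    also have "\<dots> \<le> (1 - e N) * log 2 (card (messages N R)) - 1"
      using \<open>e N \<le> 1\<close> log_card_messages[OF that(2)] by (intro diff_right_mono mult_left_mono) auto
    finally show ?thesis using that by linarith
  qed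
  have "I_U (out1 W) \<mu> \<ge> (1 - e N) * (R1 - 1 / real N) - 1 / real N"
    using *[OF \<mu>(2) R(1)] N(3) by (subst (asm) mult_le_cancel_left_pos) auto
  moreover have "I_X (out2 W) \<mu> \<ge> (1 - e N) * (R2 - 1 / real N) - 1 / real N"
    using *[OF \<mu>(3) R(2)] N(3) by (subst (asm) mult_le_cancel_left_pos) auto
  ultimately show thesis using \<mu>(1) N by (intro that[of \<mu>]) auto
qed

lemma closure_approx:
  assumes "(a, b) \<in> closure S" "\<delta> > (0::real)"
  obtains a' b' :: real where "(a', b') \<in> S" "\<bar>a' - a\<bar> < \<delta>" "\<bar>b' - b\<bar> < \<delta>"
proof -
  obtain z where z: "z \<in> S" "dist z (a, b) < \<delta>"
    using assms by (auto simp: closure_approachable)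
  moreover have "\<bar>fst z - a\<bar> \<le> dist z (a, b)" "\<bar>snd z - b\<bar> \<le> dist z (a, b)"
    using dist_fst_le[of z "(a, b)"] dist_snd_le[of z "(a, b)"] by (simp_all add: dist_real_def)
  ultimately show thesis by (intro that[of "fst z" "snd z"]) auto
qed

lemma converse_NoFB:
  fixes W :: "('x::finite, 'y1::finite, 'y2::finite) dmbc"
  assumes ln: "concave_pmf (outent_gap W)" and R: "(R1, R2) \<in> C_NoFB W" and \<delta>: "\<delta> > 0"
  obtains \<mu> where "finite (set_pmf \<mu>)" "I_U (out1 W) \<mu> \<ge> R1 - \<delta>" "I_X (out2 W) \<mu> \<ge> R2 - \<delta>"
proof -
  obtain R1' R2' where R': "achievable W 0 R1' R2'" "\<bar>R1' - R1\<bar> < \<delta> / 2" "\<bar>R2' - R2\<bar> < \<delta> / 2"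
    by (rule closure_approx[OF R[unfolded C_NoFB_def C_FB_def], of "\<delta> / 2"]) (use \<delta> in auto)
  obtain \<mu> where "finite (set_pmf \<mu>)" "I_U (out1 W) \<mu> \<ge> R1' - \<delta> / 2" "I_X (out2 W) \<mu> \<ge> R2' - \<delta> / 2"
    by (rule converse_achievable[OF ln R'(1), of "\<delta> / 2"]) (use \<delta> in auto)
  then show thesis using R' by (intro that[of \<mu>]) linarith+
qed

subsection \<open>Less-noisy channels and concavity\<close>

text \<open>Translates the measure-theoretic mutual information of the definitions into entropies.
  On countable types the product of the counting spaces is a counting space, which turns the
  integral into a sum over the support.\<close>

lemma mutual_info_ent:
  fixes X :: "'a \<Rightarrow> 'b::countable" and Y :: "'a \<Rightarrow> 'c::countable"
  assumes fin: "finite (set_pmf q)"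
  shows "mutual_info q X Y = ent (map_pmf X q) + ent (map_pmf Y q) - ent (map_pmf (\<lambda>\<omega>. (X \<omega>, Y \<omega>)) q)"
proof -
  interpret information_space "measure_pmf q" 2
    by (simp add: information_space_def measure_pmf.prob_space_axioms information_space_axioms_def)
  define pX pY pXY where "pX = map_pmf X q" and "pY = map_pmf Y q" and "pXY = map_pmf (\<lambda>\<omega>. (X \<omega>, Y \<omega>)) q"
  have dist: "distributed (measure_pmf q) (count_space UNIV) Z (\<lambda>x. ennreal (pmf (map_pmf Z q) x))" for Z :: "'a \<Rightarrow> 'd"
    unfolding distributed_def by (auto simp: map_pmf_rep_eq[symmetric] measure_pmf_eq_density[of "map_pmf Z q"])
  have pair: "count_space (UNIV :: 'b set) \<Otimes>\<^sub>M count_space (UNIV :: 'c set) = count_space UNIV"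
    by (simp add: pair_measure_countable)
  have "mutual_info q X Y = integral\<^sup>L (count_space UNIV \<Otimes>\<^sub>M count_space UNIV)
    (\<lambda>z. pmf pXY z * log 2 (pmf pXY z / (pmf pX (fst z) * pmf pY (snd z))))"
    unfolding pX_def pY_def
    by (rule mutual_information_distr)
       (auto simp: dist pair pXY_def sigma_finite_measure_count_space_countable)
  also have "\<dots> = (\<Sum>z\<in>set_pmf pXY. pmf pXY z * log 2 (pmf pXY z / (pmf pX (fst z) * pmf pY (snd z))))"
  proof -
    define f where "f z = pmf pXY z * log 2 (pmf pXY z / (pmf pX (fst z) * pmf pY (snd z)))" for z
    have sub: "{z \<in> UNIV. f z \<noteq> 0} \<subseteq> set_pmf pXY"
      by (auto simp: set_pmf_iff f_def)
    have finXY: "finite (set_pmf pXY)" using fin by (simp add: pXY_def)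
    have "integral\<^sup>L (count_space UNIV) f = (\<Sum>z | z \<in> UNIV \<and> f z \<noteq> 0. f z)"
      by (rule lebesgue_integral_count_space_finite_support[OF finite_subset[OF sub finXY]])
    also have "\<dots> = (\<Sum>z\<in>set_pmf pXY. f z)"
      using sub by (intro sum.mono_neutral_left finXY) auto
    finally show ?thesis by (simp only: pair f_def[abs_def])
  qed
  also have "\<dots> = mean pXY (\<lambda>z. log 2 (pmf pXY z) - log 2 (pmf pX (fst z)) - log 2 (pmf pY (snd z)))"
  proof -
    have pos: "pmf pXY z > 0" "pmf pX (fst z) > 0" "pmf pY (snd z) > 0" if "z \<in> set_pmf pXY" for z
      using that by (auto simp: pXY_def pX_def pY_def intro!: pmf_positive)
    have "finite (set_pmf pXY)" using fin by (simp add: pXY_def)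
    then show ?thesis
      by (subst mean_finite, simp, intro sum.cong refl) (use pos in \<open>simp add: log_divide log_mult less_imp_neq[THEN not_sym]\<close>)
  qed
  also have "\<dots> = mean pXY (\<lambda>z. log 2 (pmf pXY z)) - mean pXY (\<lambda>z. log 2 (pmf pX (fst z))) - mean pXY (\<lambda>z. log 2 (pmf pY (snd z)))"
    using fin by (simp add: mean_diff pXY_def)
  also have "\<dots> = ent pX + ent pY - ent pXY"
    by (simp add: ent_def pX_def pY_def pXY_def)
  finally show ?thesis by (simp add: pX_def pY_def pXY_def)
qed

lemma I_U_map: "I_U V (map_pmf k \<nu>) = outent V (bind_pmf \<nu> k) - mean \<nu> (\<lambda>u. outent V (k u))"
  by (simp add: I_U_def bind_map_pmf)

lemma I_U_ent:
  fixes V :: "'x::finite \<Rightarrow> 'y::finite pmf"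
  assumes "finite (set_pmf \<nu>)"
  shows "I_U V (map_pmf k \<nu>) = ent \<nu> + ent (bind_pmf \<nu> (\<lambda>u. bind_pmf (k u) V))
    - ent (joint \<nu> (\<lambda>u. bind_pmf (k u) V))"
  by (subst ent_joint) (simp_all add: assms I_U_map outent_def bind_assoc_pmf)

lemma I_U_Y_joint:
  fixes W :: "('x::finite, 'y1::finite, 'y2::finite) dmbc" and \<nu> :: "nat pmf"
  assumes fin: "finite (set_pmf \<nu>)"
  shows "I_U_Y1 (joint \<nu> k) W = I_U (out1 W) (map_pmf k \<nu>)"
    and "I_U_Y2 (joint \<nu> k) W = I_U (out2 W) (map_pmf k \<nu>)"
proof -
  let ?q = "UXY_pmf (joint \<nu> k) W"
  have fin': "finite (set_pmf ?q)" by (simp add: UXY_pmf_def fin split: prod.splits)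
  have 1: "map_pmf (\<lambda>(u, x, y1, y2). u) ?q = \<nu>"
    by (simp add: UXY_pmf_def joint_def map_bind_pmf bind_map_pmf bind_assoc_pmf map_pmf_comp case_prod_unfold bind_return_pmf')
  have 2: "map_pmf (\<lambda>(u, x, y1, y2). y1) ?q = bind_pmf \<nu> (\<lambda>u. bind_pmf (k u) (out1 W))"
     "map_pmf (\<lambda>(u, x, y1, y2). y2) ?q = bind_pmf \<nu> (\<lambda>u. bind_pmf (k u) (out2 W))"
    by (simp_all add: UXY_pmf_def joint_def map_bind_pmf bind_map_pmf bind_assoc_pmf map_pmf_comp case_prod_unfold out1_def[abs_def] out2_def[abs_def])
  have 3: "map_pmf (\<lambda>\<omega>. ((\<lambda>(u, x, y1, y2). u) \<omega>, (\<lambda>(u, x, y1, y2). y1) \<omega>)) ?q = joint \<nu> (\<lambda>u. bind_pmf (k u) (out1 W))"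
     "map_pmf (\<lambda>\<omega>. ((\<lambda>(u, x, y1, y2). u) \<omega>, (\<lambda>(u, x, y1, y2). y2) \<omega>)) ?q = joint \<nu> (\<lambda>u. bind_pmf (k u) (out2 W))"
    by (simp_all add: UXY_pmf_def joint_def map_bind_pmf bind_map_pmf bind_assoc_pmf map_pmf_comp case_prod_unfold out1_def[abs_def] out2_def[abs_def])
  show "I_U_Y1 (joint \<nu> k) W = I_U (out1 W) (map_pmf k \<nu>)" "I_U_Y2 (joint \<nu> k) W = I_U (out2 W) (map_pmf k \<nu>)"
    unfolding I_U_Y1_def I_U_Y2_def mutual_info_ent[OF fin'] 1 2 3 I_U_ent[OF fin] by simp_all
qed

lemma I_U_Y_of_pmf:
  fixes W :: "('x::finite, 'y1::finite, 'y2::finite) dmbc" and P :: "(nat \<times> 'x) pmf"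
  assumes "finite (set_pmf P)"
  obtains \<mu> where "finite (set_pmf \<mu>)" "I_U_Y1 P W = I_U (out1 W) \<mu>" "I_U_Y2 P W = I_U (out2 W) \<mu>"
proof -
  have "P = joint (map_pmf fst P) (\<lambda>u. map_pmf snd (cnd P fst u))"
    using joint_cnd[of fst snd P] by simp
  then show thesis
    using I_U_Y_joint[of "map_pmf fst P" "\<lambda>u. map_pmf snd (cnd P fst u)" W] assms
    by (intro that[of "map_pmf (\<lambda>u. map_pmf snd (cnd P fst u)) (map_pmf fst P)"]) auto
qed

text \<open>The posterior itself serves as the value of \<open>U\<close>; numbering the finitely
  many posteriors gives an auxiliary variable with values in \<open>nat\<close>.\<close>

lemma pmf_of_I_U_Y:
  fixes W :: "('x::finite, 'y1::finite, 'y2::finite) dmbc"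
  assumes fin: "finite (set_pmf \<mu>)"
  obtains P :: "(nat \<times> 'x) pmf" where "finite (set_pmf P)" "I_U_Y1 P W = I_U (out1 W) \<mu>" "I_U_Y2 P W = I_U (out2 W) \<mu>"
proof -
  let ?\<nu> = "map_pmf (to_nat_on (set_pmf \<mu>)) \<mu>" and ?k = "from_nat_into (set_pmf \<mu>)"
  have "map_pmf ?k ?\<nu> = \<mu>"
    unfolding map_pmf_comp by (rule map_pmf_idI) (simp add: from_nat_into_to_nat_on countable_finite fin)
  then show thesis
    using I_U_Y_joint[of ?\<nu> ?k W] fin by (intro that[of "joint ?\<nu> ?k"]) auto
qed

text \<open>Every finitely supported law of posteriors comes from some \<open>U\<close>, so the
  condition on auxiliary variables turns into concavity.\<close>

lemma strictly_less_noisyD: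
  fixes W :: "('x::finite, 'y1::finite, 'y2::finite) dmbc"
  assumes "strictly_less_noisy W"
  shows "concave_pmf (outent_gap W)"
    and "finite (set_pmf \<mu>) \<Longrightarrow> I_U (out1 W) \<mu> > 0 \<Longrightarrow> I_U (out2 W) \<mu> > I_U (out1 W) \<mu>"
proof -
  show "concave_pmf (outent_gap W)"
    unfolding concave_pmf_def
  proof (intro allI impI)
    fix \<mu> :: "'x pmf pmf" assume fin: "finite (set_pmf \<mu>)"
    obtain P :: "(nat \<times> 'x) pmf" where P: "finite (set_pmf P)" "I_U_Y1 P W = I_U (out1 W) \<mu>" "I_U_Y2 P W = I_U (out2 W) \<mu>"
      by (rule pmf_of_I_U_Y[OF fin])
    have "I_U_Y2 P W \<ge> I_U_Y1 P W"
      using assms P(1) by (simp add: strictly_less_noisy_def less_noisy_def)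
    then show "mean \<mu> (outent_gap W) \<le> outent_gap W (bind_pmf \<mu> id)"
      by (simp add: P I_U_def outent_gap_def[abs_def] mean_diff fin)
  qed
  assume fin: "finite (set_pmf \<mu>)" and pos: "I_U (out1 W) \<mu> > 0"
  obtain P :: "(nat \<times> 'x) pmf" where P: "finite (set_pmf P)" "I_U_Y1 P W = I_U (out1 W) \<mu>" "I_U_Y2 P W = I_U (out2 W) \<mu>"
    by (rule pmf_of_I_U_Y[OF fin])
  then show "I_U (out2 W) \<mu> > I_U (out1 W) \<mu>"
    using assms pos by (auto simp: strictly_less_noisy_def)
qed

subsection \<open>A uniform gap\<close>

definition plog :: "real \<Rightarrow> real" where "plog t = - (t * log 2 t)"

lemma ent_plog: "finite A \<Longrightarrow> set_pmf p \<subseteq> A \<Longrightarrow> ent p = (\<Sum>x\<in>A. plog (pmf p x))"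
  unfolding ent_def
  by (subst integral_measure_pmf_real[of A]) (auto simp: plog_def mult.commute set_pmf_iff)

text \<open>The delicate point is 0, where \<open>t log t\<close> tends to 0 in accord with
  \<open>plog 0 = 0\<close>.\<close>

lemma continuous_plog: "continuous_on {0..} plog"
  unfolding continuous_on_def
proof
  fix t :: real assume "t \<in> {0..}"
  show "(plog \<longlongrightarrow> plog t) (at t within {0..})"
  proof (cases "t = 0")
    case True
    have "((\<lambda>t::real. - (t * log 2 t)) \<longlongrightarrow> 0) (at_right 0)"
      unfolding log_def by real_asymp
    then show ?thesis by (simp add: True plog_def[abs_def] at_within_Ici_at_right)
  next
    case False
    then have "isCont plog t" using \<open>t \<in> {0..}\<close>
      unfolding plog_def[abs_def] by (auto intro!: continuous_intros)
    then show ?thesis using continuous_at_imp_continuous_at_within[of t plog "{0..}"] by (simp add: continuous_within)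
  qed
qed

lemma pmf_bind_finite: "pmf (bind_pmf p V) y = (\<Sum>x\<in>UNIV. pmf p (x::'x::finite) * pmf (V x) y)"
  unfolding pmf_bind by (subst integral_measure_pmf_real[of UNIV]) (auto simp: mult.commute)

text \<open>\<open>I(U;Y) = H(U) + H(Y) - H(U,Y)\<close> as a function of the joint mass function \<open>g\<close> of \<open>(U,X)\<close>, where
  \<open>U\<close> takes its values in \<open>B\<close>.\<close>

definition I_fun :: "('x::finite \<Rightarrow> 'y::finite pmf) \<Rightarrow> 'b set \<Rightarrow> ('b \<times> 'x \<Rightarrow> real) \<Rightarrow> real" where
  "I_fun V B g = (\<Sum>b\<in>B. plog (\<Sum>x\<in>UNIV. g (b, x)))
     + (\<Sum>y\<in>UNIV. plog (\<Sum>b\<in>B. \<Sum>x\<in>UNIV. g (b, x) * pmf (V x) y))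
     - (\<Sum>(b, y)\<in>B \<times> UNIV. plog (\<Sum>x\<in>UNIV. g (b, x) * pmf (V x) y))"

lemma I_fun_joint:
  fixes V :: "'x::finite \<Rightarrow> 'y::finite pmf"
  assumes B: "finite B" "set_pmf \<beta> \<subseteq> B"
  shows "I_fun V B (pmf (joint \<beta> k)) = I_U V (map_pmf k \<beta>)"
proof -
  have fin: "finite (set_pmf \<beta>)" using B finite_subset by blast
  have 1: "(\<Sum>x\<in>UNIV. pmf (joint \<beta> k) (b, x)) = pmf \<beta> b" for b
    by (simp add: sum_distrib_left[symmetric] sum_pmf_eq_1)
  have 2: "(\<Sum>x\<in>UNIV. pmf (joint \<beta> k) (b, x) * pmf (V x) y) = pmf \<beta> b * pmf (bind_pmf (k b) V) y" for b y
    by (simp add: pmf_bind_finite sum_distrib_left mult.assoc)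
  have 3: "(\<Sum>b\<in>B. pmf \<beta> b * pmf (bind_pmf (k b) V) y) = pmf (bind_pmf \<beta> (\<lambda>b. bind_pmf (k b) V)) y" for y
    unfolding pmf_bind[of \<beta>] by (subst integral_measure_pmf_real[of B]) (use B in \<open>auto simp: mult.commute\<close>)
  have "ent \<beta> = (\<Sum>b\<in>B. plog (pmf \<beta> b))"
    using B by (rule ent_plog)
  moreover have "ent (bind_pmf \<beta> (\<lambda>b. bind_pmf (k b) V)) = (\<Sum>y\<in>UNIV. plog (pmf (bind_pmf \<beta> (\<lambda>b. bind_pmf (k b) V)) y))"
    by (rule ent_plog) auto
  moreover have "ent (joint \<beta> (\<lambda>b. bind_pmf (k b) V)) =
     (\<Sum>z\<in>B \<times> UNIV. plog (pmf (joint \<beta> (\<lambda>b. bind_pmf (k b) V)) z))"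
    using B by (intro ent_plog) auto
  moreover have "\<dots> = (\<Sum>(b, y)\<in>B \<times> UNIV. plog (pmf \<beta> b * pmf (bind_pmf (k b) V) y))"
    by (intro sum.cong) auto
  ultimately show ?thesis
    unfolding I_fun_def 1 2 3 I_U_ent[OF fin] by simp
qed

text \<open>Expressing the information by joint entropies pays off here: no conditional law, which
  would be discontinuous at values of zero mass, occurs in \<open>I_fun\<close>.\<close>

lemma continuous_I_fun:
  fixes V :: "'x::finite \<Rightarrow> 'y::finite pmf"
  shows "continuous_on {g. \<forall>i. 0 \<le> g i} (I_fun V B)"
proof -
  have co: "continuous_on S (\<lambda>g. g i)" for S :: "('b \<times> 'x \<Rightarrow> real) set" and i
    by (rule continuous_on_subset[OF continuous_on_product_coordinates]) auto
  show ?thesis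
    unfolding I_fun_def case_prod_unfold
    by (intro continuous_intros continuous_on_compose2[OF continuous_plog] co)
       (auto intro!: sum_nonneg mult_nonneg_nonneg)
qed

text \<open>Lets a minimizer found by compactness be read as an auxiliary variable again.\<close>

lemma pmf_of_fun:
  fixes g :: "'b \<times> 'x::finite \<Rightarrow> real"
  assumes B: "finite B" and g: "\<And>i. 0 \<le> g i" "\<And>b x. b \<notin> B \<Longrightarrow> g (b, x) = 0"
    "(\<Sum>i\<in>B \<times> UNIV. g i) = 1"
  obtains \<beta> and k :: "'b \<Rightarrow> 'x pmf" where "set_pmf \<beta> \<subseteq> B" "pmf (joint \<beta> k) = g"
proof -
  have "(\<integral>\<^sup>+i. ennreal (g i) \<partial>count_space UNIV) = (\<Sum>i\<in>B \<times> UNIV. ennreal (g i))"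
    using B g by (intro nn_integral_count_space') auto
  also have "\<dots> = 1" using g by (subst sum_ennreal) auto
  finally have 1: "(\<integral>\<^sup>+i. ennreal (g i) \<partial>count_space UNIV) = 1" .
  define P where "P = embed_pmf g"
  have P: "pmf P = g" unfolding P_def by (rule ext, rule pmf_embed_pmf) (use g 1 in auto)
  have "P = joint (map_pmf fst P) (\<lambda>b. map_pmf snd (cnd P fst b))"
    using joint_cnd[of fst snd P] by simp
  moreover have "set_pmf (map_pmf fst P) \<subseteq> B"
    using g(2) by (fastforce simp: set_pmf_iff P)
  ultimately show thesis using P by (intro that[of "map_pmf fst P" "\<lambda>b. map_pmf snd (cnd P fst b)"]) simp_all
qed

text \<open>On a fixed finite alphabet the joint laws with \<open>I(U;Y1) \<ge> r\<close> form a
  compact set, on which the continuous gap is positive by strictness; \<open>\<kappa>\<close> is its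
  minimum.\<close>

lemma finite_alphabet_gap:
  fixes W :: "('x::finite, 'y1::finite, 'y2::finite) dmbc" and B :: "'b set"
  assumes sln: "strictly_less_noisy W" and B: "finite B" and r: "r > 0"
  obtains \<kappa> where "\<kappa> > 0" "\<And>\<beta> k. set_pmf \<beta> \<subseteq> B \<Longrightarrow> I_U (out1 W) (map_pmf k \<beta>) \<ge> r \<Longrightarrow>
    I_U (out2 W) (map_pmf k \<beta>) \<ge> I_U (out1 W) (map_pmf k \<beta>) + \<kappa>"
proof -
  \<comment> \<open>Coordinates outside \<open>B\<close> are pinned to 0 because the index type may
    be infinite; the product is then compact in the product topology and still contains all laws in
    question.\<close>
  define K where "K = PiE UNIV (\<lambda>i :: 'b \<times> 'x. if fst i \<in> B then {0..1::real} else {0})"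
  define T where "T g = (\<Sum>i\<in>B \<times> UNIV. g i)" for g :: "'b \<times> 'x \<Rightarrow> real"
  define C where "C = K \<inter> (\<lambda>g. (T g, I_fun (out1 W) B g)) -` ({1} \<times> {r..})"
  have Kpos: "K \<subseteq> {g. \<forall>i. 0 \<le> g i}"
  proof
    fix g assume "g \<in> K"
    then have "g i \<in> (if fst i \<in> B then {0..1} else {0})" for i
      using PiE_mem[OF \<open>g \<in> K\<close>[unfolded K_def], of i] by simp
    then have "0 \<le> g i" for i
      by (metis atLeastAtMost_iff order_refl singletonD)
    then show "g \<in> {g. \<forall>i. 0 \<le> g i}" by simp
  qed
  have "compactin (product_topology (\<lambda>i. euclidean) UNIV) K"
    unfolding K_def compactin_PiE by auto
  then have K: "compact K" by (simp add: euclidean_product_topology)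
  have contI: "continuous_on K (I_fun V B)" for V :: "'x \<Rightarrow> 'z::finite pmf"
    by (rule continuous_on_subset[OF continuous_I_fun Kpos])
  have contT: "continuous_on K T"
    unfolding T_def by (intro continuous_intros continuous_on_subset[OF continuous_on_product_coordinates]) auto
  have "closedin (top_of_set K) C"
    unfolding C_def
    by (intro continuous_closedin_preimage continuous_on_Pair contT contI closed_Times) auto
  then have C: "compact C" by (rule closedin_compact[OF K])
  have in_C: "pmf (joint \<beta> k) \<in> C" if "set_pmf \<beta> \<subseteq> B" "I_U (out1 W) (map_pmf k \<beta>) \<ge> r" for \<beta> k
  proof -
    have "pmf (joint \<beta> k) \<in> K"
      using that(1) by (auto simp: K_def set_pmf_iff pmf_le_1 mult_le_one)
    moreover have "T (pmf (joint \<beta> k)) = 1"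
      unfolding T_def using that(1) B by (intro sum_pmf_eq_1) auto
    ultimately show ?thesis using that by (simp add: C_def I_fun_joint B)
  qed
  show thesis
  proof (cases "C = {}")
    case True
    then show ?thesis using in_C by (intro that[of 1]) auto
  next
    case False
    have "continuous_on C (\<lambda>g. I_fun (out2 W) B g - I_fun (out1 W) B g)"
      by (intro continuous_intros continuous_on_subset[OF contI]) (auto simp: C_def)
    then obtain g where g: "g \<in> C" and min: "\<And>h. h \<in> C \<Longrightarrow>
       I_fun (out2 W) B g - I_fun (out1 W) B g \<le> I_fun (out2 W) B h - I_fun (out1 W) B h"
      using continuous_attains_inf[OF C False] by blast
    have gK: "g \<in> K" using g by (simp add: C_def)
    have g0: "g (b, x) = 0" if "b \<notin> B" for b x
      using that PiE_mem[OF gK[unfolded K_def], of "(b, x)"] by simp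
    obtain \<beta> k where \<beta>: "set_pmf \<beta> \<subseteq> B" and gj: "pmf (joint \<beta> k) = g"
      by (rule pmf_of_fun[OF B, of g]) (use gK Kpos g g0 in \<open>auto simp: C_def T_def\<close>)
    have "I_U (out1 W) (map_pmf k \<beta>) \<ge> r"
      using g by (simp add: C_def gj[symmetric] I_fun_joint B \<beta>)
    then have "I_U (out2 W) (map_pmf k \<beta>) > I_U (out1 W) (map_pmf k \<beta>)"
      using r finite_subset[OF \<beta> B] by (intro strictly_less_noisyD[OF sln]) auto
    then have pos: "I_fun (out2 W) B g - I_fun (out1 W) B g > 0"
      by (simp add: gj[symmetric] I_fun_joint B \<beta>)
    show ?thesis
    proof (rule that[OF pos])
      fix \<beta>' and k' :: "'b \<Rightarrow> 'x pmf"
      assume "set_pmf \<beta>' \<subseteq> B" "I_U (out1 W) (map_pmf k' \<beta>') \<ge> r"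
      from min[OF in_C[OF this]] this(1) show "I_U (out2 W) (map_pmf k' \<beta>') \<ge> I_U (out1 W) (map_pmf k' \<beta>')
        + (I_fun (out2 W) B g - I_fun (out1 W) B g)"
        by (simp add: I_fun_joint B)
    qed
  qed
qed

text \<open>Merging the values of \<open>U\<close> that induce nearly the same law of \<open>Y\<^sub>1\<close> leaves finitely many values. It costs
  little of \<open>I(U;Y\<^sub>1)\<close> and, by concavity, does not increase the gap.\<close>

lemma uniform_gap:
  fixes W :: "('x::finite, 'y1::finite, 'y2::finite) dmbc"
  assumes sln: "strictly_less_noisy W" and r: "r > 0"
  obtains \<kappa> where "\<kappa> > 0" "\<And>\<mu>. finite (set_pmf \<mu>) \<Longrightarrow> I_U (out1 W) \<mu> \<ge> r \<Longrightarrow>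
    I_U (out2 W) \<mu> \<ge> I_U (out1 W) \<mu> + \<kappa>"
proof -
  let ?V = "out1 W" and ?c = "real CARD('y1)"
  have "uniformly_continuous_on {0..1} plog"
    by (rule compact_uniformly_continuous[OF continuous_on_subset[OF continuous_plog]]) auto
  moreover have "r / (2 * ?c) > 0" using r by simp
  \<comment> \<open>Changing each probability of \<open>Y1\<close> by less than
    \<open>\<eta>\<close> moves each entropy term by less than \<open>r / (2 * ?c)\<close>, hence
    the entropy of \<open>Y1\<close> by less than \<open>r / 2\<close>.\<close>
  ultimately obtain \<eta> where \<eta>: "\<eta> > 0" "\<And>s t. s \<in> {0..1} \<Longrightarrow> t \<in> {0..1} \<Longrightarrow> \<bar>s - t\<bar> < \<eta> \<Longrightarrow> \<bar>plog s - plog t\<bar> < r / (2 * ?c)"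
    unfolding uniformly_continuous_on_def dist_real_def by (metis abs_minus_commute)
  obtain N :: nat where N: "N > 0" "1 / N < \<eta>"
    using reals_Archimedean[OF \<eta>(1)] by (metis inverse_eq_divide zero_less_Suc)
  \<comment> \<open>Posteriors are binned by their law of \<open>Y1\<close>, each probability
    rounded down to a multiple of \<open>1 / N\<close>. Posteriors in one bin need not be close
    themselves.\<close>
  define bin where "bin p = (\<lambda>y. nat \<lfloor>N * pmf (bind_pmf p ?V) y\<rfloor>)" for p
  define B where "B = {b :: 'y1 \<Rightarrow> nat. \<forall>y. b y \<le> N}"
  have "B = PiE UNIV (\<lambda>_. {..N})" by (auto simp: B_def)
  then have B: "finite B" by (simp add: finite_PiE)
  have bin_B: "bin p \<in> B" for p
  proof -
    have "N * pmf (bind_pmf p ?V) y \<le> N" for y by (simp add: mult_left_le pmf_le_1)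
    then have "nat \<lfloor>N * pmf (bind_pmf p ?V) y\<rfloor> \<le> N" for y
      by (metis floor_mono floor_of_nat nat_int nat_mono)
    then show ?thesis by (simp add: B_def bin_def)
  qed
  have bin_bounds: "bin p y / N \<le> pmf (bind_pmf p ?V) y" "pmf (bind_pmf p ?V) y \<le> bin p y / N + 1 / N" for p y
  proof -
    have "real (bin p y) = of_int \<lfloor>N * pmf (bind_pmf p ?V) y\<rfloor>" by (simp add: bin_def)
    then have "real (bin p y) \<le> N * pmf (bind_pmf p ?V) y" "N * pmf (bind_pmf p ?V) y \<le> real (bin p y) + 1"
      by linarith+
    then show "bin p y / N \<le> pmf (bind_pmf p ?V) y" "pmf (bind_pmf p ?V) y \<le> bin p y / N + 1 / N"
      using N by (auto simp: field_simps)
  qed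
  from r have "r / 2 > 0" by simp
  from finite_alphabet_gap[OF sln B this] obtain \<kappa> where \<kappa>: "\<kappa> > 0"
    "\<And>\<beta> k. set_pmf \<beta> \<subseteq> B \<Longrightarrow> I_U ?V (map_pmf k \<beta>) \<ge> r / 2 \<Longrightarrow> I_U (out2 W) (map_pmf k \<beta>) \<ge> I_U ?V (map_pmf k \<beta>) + \<kappa>"
    by blast
  show thesis
  proof (rule that[OF \<kappa>(1)])
    fix \<mu> :: "'x pmf pmf" assume fin: "finite (set_pmf \<mu>)" and I: "I_U ?V \<mu> \<ge> r"
    define \<beta> where "\<beta> = map_pmf bin \<mu>"
    \<comment> \<open>The posterior given the bin is the average of the posteriors in it.\<close>
    define k where "k b = bind_pmf (cnd \<mu> bin b) id" for b
    have join: "bind_pmf \<beta> k = bind_pmf \<mu> id"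
      unfolding \<beta>_def k_def bind_assoc_pmf[symmetric] bind_cnd ..
    have fin\<beta>: "finite (set_pmf \<beta>)" by (simp add: \<beta>_def fin)
    have close: "outent ?V (k b) \<le> mean (cnd \<mu> bin b) (outent ?V) + r / 2" if "b \<in> set_pmf \<beta>" for b
    proof -
      have b: "b \<in> bin ` set_pmf \<mu>" using that by (simp add: \<beta>_def)
      have finb: "finite (set_pmf (cnd \<mu> bin b))" by (rule finite_set_cnd[OF fin b])
      have kb: "pmf (bind_pmf (k b) ?V) y = mean (cnd \<mu> bin b) (\<lambda>p. pmf (bind_pmf p ?V) y)" for y
        by (simp add: k_def bind_assoc_pmf pmf_bind[of "cnd \<mu> bin b"])
      have lower: "b y / N \<le> pmf (bind_pmf (k b) ?V) y" for y
      proof -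
        have "mean (cnd \<mu> bin b) (\<lambda>p. b y / N) \<le> mean (cnd \<mu> bin b) (\<lambda>p. pmf (bind_pmf p ?V) y)"
          using bin_bounds(1)[of _ y] by (intro mean_mono finb) (auto simp: set_cnd[OF b])
        then show ?thesis by (simp add: kb)
      qed
      have upper: "pmf (bind_pmf (k b) ?V) y \<le> b y / N + 1 / N" for y
      proof -
        have "mean (cnd \<mu> bin b) (\<lambda>p. pmf (bind_pmf p ?V) y) \<le> mean (cnd \<mu> bin b) (\<lambda>p. b y / N + 1 / N)"
          using bin_bounds(2)[of _ y] by (intro mean_mono finb) (auto simp: set_cnd[OF b])
        then show ?thesis by (simp add: kb)
      qed
      have "outent ?V (k b) = mean (cnd \<mu> bin b) (\<lambda>_. outent ?V (k b))" by simp
      also have "\<dots> \<le> mean (cnd \<mu> bin b) (\<lambda>p. outent ?V p + r / 2)"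
      proof (rule mean_mono[OF finb])
        fix p assume "p \<in> set_pmf (cnd \<mu> bin b)"
        then have p: "bin p = b" by (simp add: set_cnd[OF b])
        have "outent ?V (k b) = (\<Sum>y\<in>UNIV. plog (pmf (bind_pmf (k b) ?V) y))"
          unfolding outent_def by (rule ent_plog) auto
        also have "\<dots> \<le> (\<Sum>y\<in>UNIV. plog (pmf (bind_pmf p ?V) y) + r / (2 * ?c))"
        proof (rule sum_mono)
          fix y
          have "\<bar>pmf (bind_pmf (k b) ?V) y - pmf (bind_pmf p ?V) y\<bar> \<le> 1 / N"
            using lower[of y] upper[of y] bin_bounds[of p y] p by (auto simp: abs_le_iff)
          then have "\<bar>plog (pmf (bind_pmf (k b) ?V) y) - plog (pmf (bind_pmf p ?V) y)\<bar> < r / (2 * ?c)"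
            using N(2) by (intro \<eta>(2)) (auto simp: pmf_le_1)
          then show "plog (pmf (bind_pmf (k b) ?V) y) \<le> plog (pmf (bind_pmf p ?V) y) + r / (2 * ?c)" by linarith
        qed
        also have "\<dots> = (\<Sum>y\<in>UNIV. plog (pmf (bind_pmf p ?V) y)) + r / 2"
          by (simp add: sum.distrib)
        also have "(\<Sum>y\<in>UNIV. plog (pmf (bind_pmf p ?V) y)) = outent ?V p"
          unfolding outent_def by (rule ent_plog[symmetric]) auto
        finally show "outent ?V (k b) \<le> outent ?V p + r / 2" .
      qed
      also have "\<dots> = mean (cnd \<mu> bin b) (outent ?V) + r / 2"
        by (subst mean_add[OF finb]) simp
      finally show ?thesis .
    qed
    have "mean \<beta> (\<lambda>b. outent ?V (k b)) \<le> mean \<beta> (\<lambda>b. mean (cnd \<mu> bin b) (outent ?V) + r / 2)"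
      by (rule mean_mono[OF fin\<beta> close])
    also have "\<dots> = mean \<mu> (outent ?V) + r / 2"
      by (subst mean_add[OF fin\<beta>]) (simp add: \<beta>_def mean_cnd[OF fin, of "outent ?V" bin] del: integral_map_pmf)
    finally have "I_U ?V (map_pmf k \<beta>) \<ge> r / 2"
      using I by (simp add: I_U_map join) (simp add: I_U_def)
    then have gap: "I_U (out2 W) (map_pmf k \<beta>) \<ge> I_U ?V (map_pmf k \<beta>) + \<kappa>"
      using bin_B by (intro \<kappa>(2)) (auto simp: \<beta>_def)
    \<comment> \<open>For a fixed law of \<open>X\<close> the slack is \<open>outent_gap\<close> at
      that law minus its mean over \<open>U\<close>. Merging raises the mean by concavity, so the
      original slack is at least the merged one.\<close>
    have "mean \<mu> (outent_gap W) = mean \<beta> (\<lambda>b. mean (cnd \<mu> bin b) (outent_gap W))"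
      unfolding \<beta>_def by (rule mean_cnd[OF fin])
    also have "\<dots> \<le> mean \<beta> (\<lambda>b. outent_gap W (k b))"
    proof (rule mean_mono[OF fin\<beta>])
      fix b assume "b \<in> set_pmf \<beta>"
      then have "finite (set_pmf (cnd \<mu> bin b))" by (intro finite_set_cnd[OF fin]) (simp add: \<beta>_def)
      then show "mean (cnd \<mu> bin b) (outent_gap W) \<le> outent_gap W (k b)"
        using concave_pmfD[OF strictly_less_noisyD(1)[OF sln], of "cnd \<mu> bin b" id] by (simp add: k_def)
    qed
    finally show "I_U (out2 W) \<mu> \<ge> I_U (out1 W) \<mu> + \<kappa>"
      using gap by (simp add: I_U_map join outent_gap_def[abs_def] mean_diff fin fin\<beta>) (simp add: I_U_def)
  qed
qed

subsection \<open>Random superposition codes\<close>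

abbreviation prob :: "'a pmf \<Rightarrow> 'a set \<Rightarrow> real" where
  "prob p A \<equiv> measure_pmf.prob p A"

lemma prob_bind: "prob (bind_pmf p k) A = mean p (\<lambda>x. prob (k x) A)"
proof -
  have int: "integrable (measure_pmf p) (\<lambda>x. prob (k x) A)"
    by (rule measure_pmf.integrable_const_bound[where B = 1]) auto
  have "ennreal (prob (bind_pmf p k) A) = (\<integral>\<^sup>+x. ennreal (prob (k x) A) \<partial>measure_pmf p)"
    using emeasure_bind_pmf[of p k A] by (simp add: measure_pmf.emeasure_eq_measure)
  also have "\<dots> = ennreal (mean p (\<lambda>x. prob (k x) A))"
    by (rule nn_integral_eq_integral[OF int]) auto
  finally show ?thesis by (subst (asm) ennreal_inj) (auto intro: integral_nonneg)
qed

lemma prob_bind_le: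
  assumes "\<And>x. x \<in> set_pmf p \<Longrightarrow> prob (k x) A \<le> c"
  shows "prob (bind_pmf p k) A \<le> c"
  unfolding prob_bind
  by (rule measure_pmf.integral_le_const)
     (auto intro: measure_pmf.integrable_const_bound[where B = 1] simp: AE_measure_pmf_iff assms)

lemma prob_cong: "(\<And>x. x \<in> set_pmf p \<Longrightarrow> x \<in> A \<longleftrightarrow> x \<in> B) \<Longrightarrow> prob p A = prob p B"
  by (rule measure_pmf.finite_measure_eq_AE) (auto simp: AE_measure_pmf_iff)

lemma prob_mono: "(\<And>x. x \<in> set_pmf p \<Longrightarrow> x \<in> A \<Longrightarrow> x \<in> B) \<Longrightarrow> prob p A \<le> prob p B"
  by (rule measure_pmf.finite_measure_mono_AE) (auto simp: AE_measure_pmf_iff)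

lemma prob_Un_le: "prob p (A \<union> B) \<le> prob p A + prob p B"
  by (rule measure_Un_le) auto

lemma prob_UN_le:
  fixes c :: real
  assumes "finite I" "\<And>i. i \<in> I \<Longrightarrow> prob p (A i) \<le> c"
  shows "prob p (\<Union>i\<in>I. A i) \<le> card I * c"
proof -
  have "prob p (\<Union>i\<in>I. A i) \<le> (\<Sum>i\<in>I. prob p (A i))"
    by (rule measure_pmf.finite_measure_subadditive_finite) (auto simp: assms)
  also have "\<dots> \<le> card I * c" using sum_mono[of I "\<lambda>i. prob p (A i)" "\<lambda>_. c"] assms by simp
  finally show ?thesis .
qed

lemma exists_le_mean:
  assumes fin: "finite (set_pmf p)"
  shows "\<exists>x\<in>set_pmf p. f x \<le> mean p f"
proof (rule ccontr)
  assume "\<not> ?thesis"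
  then have *: "\<And>x. x \<in> set_pmf p \<Longrightarrow> mean p f < f x" by auto
  have "(\<Sum>x\<in>set_pmf p. pmf p x * mean p f) < (\<Sum>x\<in>set_pmf p. pmf p x * f x)"
    using * by (intro sum_strict_mono fin set_pmf_not_empty mult_strict_left_mono) (auto intro: pmf_positive)
  then show False by (simp add: sum_distrib_right[symmetric] sum_pmf_eq_1 fin mean_finite[symmetric])
qed

lemma joint_map: "map_pmf (\<lambda>(c, z). (g c, z)) (joint P (\<lambda>c. K (g c))) = joint (map_pmf g P) K"
  by (simp add: joint_def map_bind_pmf bind_map_pmf map_pmf_comp)

text \<open>Reduces an event about a random codebook to the few codewords \<open>g c\<close> on
  which it depends.\<close>

lemma prob_joint_map:
  "prob (joint P (\<lambda>c. K (g c))) {(c, z). R (g c) z} = prob (joint (map_pmf g P) K) {(c, z). R c z}"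
  unfolding joint_map[symmetric] measure_map_pmf by (rule arg_cong[where f = "prob _"]) auto

text \<open>The output is produced by the second codeword, hence independent of the first. Fixing
  \<open>z\<close> leaves only the randomness of \<open>P\<close>.\<close>

lemma prob_joint_pair_le:
  assumes "\<And>z. prob P {c. R c z} \<le> \<epsilon>"
  shows "prob (joint (pair_pmf P P') (\<lambda>c. K (snd c))) {(c, z). R (fst c) z} \<le> \<epsilon>"
proof -
  have "map_pmf (\<lambda>(c, z). (fst c, z)) (joint (pair_pmf P P') (\<lambda>c. K (snd c)))
      = bind_pmf (bind_pmf P' K) (\<lambda>z. map_pmf (\<lambda>c. (c, z)) P)"
  proof -
    have "map_pmf (\<lambda>(c, z). (fst c, z)) (joint (pair_pmf P P') (\<lambda>c. K (snd c)))
      = bind_pmf P (\<lambda>c. bind_pmf (bind_pmf P' K) (\<lambda>z. return_pmf (c, z)))"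
      by (simp add: joint_def pair_pmf_def map_bind_pmf bind_assoc_pmf map_pmf_comp bind_return_pmf)
         (simp add: map_pmf_def)
    then show ?thesis by (subst (asm) bind_commute_pmf) (simp add: map_pmf_def)
  qed
  moreover have "prob (bind_pmf (bind_pmf P' K) (\<lambda>z. map_pmf (\<lambda>c. (c, z)) P)) {(c, z). R c z} \<le> \<epsilon>"
    by (rule prob_bind_le) (simp add: assms vimage_def)
  ultimately have "prob (map_pmf (\<lambda>(c, z). (fst c, z)) (joint (pair_pmf P P') (\<lambda>c. K (snd c)))) {(c, z). R c z} \<le> \<epsilon>"
    by simp
  then show ?thesis by (simp add: vimage_def case_prod_unfold)
qed

lemma Pi_pmf_pair:
  assumes "finite A" "i \<in> A" "j \<in> A" "i \<noteq> j"
  shows "map_pmf (\<lambda>f. (f i, f j)) (Pi_pmf A d p) = pair_pmf (p i) (p j)"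
proof -
  have A: "A = insert i (A - {i})" using assms by auto
  have "map_pmf (\<lambda>f. (f i, f j)) (Pi_pmf A d p) =
      map_pmf (\<lambda>(y, f). (y, f j)) (pair_pmf (p i) (Pi_pmf (A - {i}) d p))"
    using assms by (subst A, subst Pi_pmf_insert) (auto simp: map_pmf_comp case_prod_unfold intro!: map_pmf_cong)
  also have "\<dots> = pair_pmf (p i) (map_pmf (\<lambda>f. f j) (Pi_pmf (A - {i}) d p))"
    using map_pair[of "\<lambda>y. y" "\<lambda>f. f j" "p i" "Pi_pmf (A - {i}) d p"] by simp
  finally show ?thesis using assms by (simp add: Pi_pmf_component)
qed

lemma finite_set_Pi_pmf:
  "finite A \<Longrightarrow> (\<And>x. finite (set_pmf (p x))) \<Longrightarrow> finite (set_pmf (Pi_pmf A d p))"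
  by (subst set_Pi_pmf) (auto intro!: finite_PiE_dflt)

text \<open>Random coding: each \<open>(a, f)\<close> gets a cloud center drawn from
  \<open>PU\<close>, and each \<open>b\<close> a satellite drawn from \<open>k u\<close>. Receiver 1
  is given \<open>f\<close> and searches over \<open>a\<close> alone, whence the bare
  \<open>card A\<close> in its term; Receiver 2 searches over all triples,
  \<open>\<epsilon>2\<close> accounting for wrong centers and \<open>\<epsilon>3\<close> for wrong
  satellites of the right center. The bound is shown for each message separately and so holds under
  any law \<open>Q\<close>, which matters because \<open>f\<close> will consist of channel outputs.
  The factor \<open>card B - 1\<close> vanishes if there is only one satellite.\<close>

lemma superposition_one_shot:
  fixes PU :: "'u pmf" and k :: "'u \<Rightarrow> 'x pmf" and V :: "'x \<Rightarrow> ('z1 \<times> 'z2) pmf"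
    and A :: "'a set" and F :: "'f set"  and B :: "'b set"
    and \<epsilon>1 \<epsilon>2 \<epsilon>3 :: real
  assumes fin: "finite A" "finite F" "finite B" and finU: "finite (set_pmf PU)" and fink: "\<And>u. finite (set_pmf (k u))"
    and T1: "\<And>z. prob PU {u. T1 u z} \<le> \<epsilon>1"
    and T2: "\<And>z. prob (joint PU k) {(u, x). T2 u x z} \<le> \<epsilon>2"
    and T3: "\<And>u z. u \<in> set_pmf PU \<Longrightarrow> prob (k u) {x. T2 u x z} \<le> \<epsilon>3"
    and Q: "set_pmf Q \<subseteq> A \<times> F \<times> B" and \<epsilon>: "\<epsilon>1 \<ge> 0" "\<epsilon>2 \<ge> 0"
  obtains x :: "'a \<Rightarrow> 'f \<Rightarrow> 'b \<Rightarrow> 'x" and d1 :: "'f \<Rightarrow> 'z1 \<Rightarrow> 'a" and d2 :: "'z2 \<Rightarrow> 'a \<times> 'f \<times> 'b"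
  where "\<And>a f b. a \<in> A \<Longrightarrow> f \<in> F \<Longrightarrow> b \<in> B \<Longrightarrow> \<exists>u\<in>set_pmf PU. x a f b \<in> set_pmf (k u)"
    "prob (joint Q (\<lambda>(a, f, b). V (x a f b))) {((a, f, b), (z1, z2)). d1 f z1 \<noteq> a \<or> d2 z2 \<noteq> (a, f, b)}
     \<le> prob (joint (joint PU k) (\<lambda>c. V (snd c))) {((u, x), (z1, z2)). \<not> T1 u z1 \<or> \<not> T2 u x z2}
       + card A * \<epsilon>1 + card A * card F * card B * \<epsilon>2 + (real (card B) - 1) * \<epsilon>3"
proof -
  \<comment> \<open>One cloud: a center and its satellites, independent given the center.\<close>
  define P0 where "P0 = joint PU (\<lambda>u. Pi_pmf B undefined (\<lambda>_. k u))"
  define CB where "CB = Pi_pmf (A \<times> F) undefined (\<lambda>_. P0)"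
  have finP0: "finite (set_pmf P0)"
    using fin finU fink by (auto simp: P0_def intro!: finite_set_Pi_pmf)
  have finCB: "finite (set_pmf CB)"
    using fin finP0 by (auto simp: CB_def intro!: finite_set_Pi_pmf)
  \<comment> \<open>A true codeword fails its test or a false one passes. Outside this event both
    searches have exactly one solution.\<close>
  define Err where "Err C = (\<lambda>(a, f, b) (z1, z2). \<not> T1 (fst (C (a, f))) z1 \<or> \<not> T2 (fst (C (a, f))) (snd (C (a, f)) b) z2
     \<or> (\<exists>a'\<in>A - {a}. T1 (fst (C (a', f))) z1)
     \<or> (\<exists>((a', f'), b')\<in>(A \<times> F - {(a, f)}) \<times> B. T2 (fst (C (a', f'))) (snd (C (a', f')) b') z2)
     \<or> (\<exists>b'\<in>B - {b}. T2 (fst (C (a, f))) (snd (C (a, f)) b') z2))" for C :: "'a \<times> 'f \<Rightarrow> 'u \<times> ('b \<Rightarrow> 'x)"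
  define \<beta> where "\<beta> = prob (joint (joint PU k) (\<lambda>c. V (snd c))) {((u, x), (z1, z2)). \<not> T1 u z1 \<or> \<not> T2 u x z2}
       + card A * \<epsilon>1 + card A * card F * card B * \<epsilon>2 + (real (card B) - 1) * \<epsilon>3"
  have P0_b: "map_pmf (\<lambda>c. (fst c, snd c b)) P0 = joint PU k" if "b \<in> B" for b
    by (simp add: P0_def joint_def map_bind_pmf map_pmf_comp)
       (simp add: map_pmf_comp[symmetric, of "Pair _" "\<lambda>g. g b"] Pi_pmf_component fin that)
  have per_message: "prob (joint CB (\<lambda>C. V (snd (C (a, f)) b))) {(C, z). Err C (a, f, b) z} \<le> \<beta>"
    if m: "a \<in> A" "f \<in> F" "b \<in> B" for a f b
  proof -
    let ?J = "joint CB (\<lambda>C. V (snd (C (a, f)) b))"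
    have comp: "map_pmf (\<lambda>C. C (a, f)) CB = P0"
      using fin m by (simp add: CB_def Pi_pmf_component)
    have pair: "map_pmf (\<lambda>C. (C (a', f'), C (a, f))) CB = pair_pmf P0 P0"
      if "a' \<in> A" "f' \<in> F" "(a', f') \<noteq> (a, f)" for a' f'
      unfolding CB_def using fin m that by (subst Pi_pmf_pair) auto
    define E0 where "E0 = {(C :: 'a \<times> 'f \<Rightarrow> 'u \<times> ('b \<Rightarrow> 'x), (z1, z2)). \<not> T1 (fst (C (a, f))) z1 \<or> \<not> T2 (fst (C (a, f))) (snd (C (a, f)) b) z2}"
    define E1 where "E1 a' = {(C :: 'a \<times> 'f \<Rightarrow> 'u \<times> ('b \<Rightarrow> 'x), (z1, z2 :: 'z2)). T1 (fst (C (a', f))) z1}" for a'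
    define E2 where "E2 = (\<lambda>((a', f'), b'). {(C :: 'a \<times> 'f \<Rightarrow> 'u \<times> ('b \<Rightarrow> 'x), (z1 :: 'z1, z2)). T2 (fst (C (a', f'))) (snd (C (a', f')) b') z2})"
    define E3 where "E3 b' = {(C :: 'a \<times> 'f \<Rightarrow> 'u \<times> ('b \<Rightarrow> 'x), (z1 :: 'z1, z2)). T2 (fst (C (a, f))) (snd (C (a, f)) b') z2}" for b'
    have 0: "prob ?J E0 = prob (joint (joint PU k) (\<lambda>c. V (snd c))) {((u, x), (z1, z2)). \<not> T1 u z1 \<or> \<not> T2 u x z2}"
    proof -
      have "map_pmf (\<lambda>C. (fst (C (a, f)), snd (C (a, f)) b)) CB = joint PU k"
        unfolding P0_b[OF m(3), symmetric] comp[symmetric] map_pmf_comp ..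
      then show ?thesis
        using prob_joint_map[of CB "\<lambda>c. V (snd c)" "\<lambda>C. (fst (C (a, f)), snd (C (a, f)) b)"
          "\<lambda>c z. \<not> T1 (fst c) (fst z) \<or> \<not> T2 (fst c) (snd c) (snd z)"]
        by (simp add: E0_def case_prod_unfold)
    qed
    have 1: "prob ?J (E1 a') \<le> \<epsilon>1" if "a' \<in> A - {a}" for a'
    proof -
      have "prob P0 {c. T1 (fst c) z} \<le> \<epsilon>1" for z
        using T1[of z] measure_map_pmf[of fst P0 "{u. T1 u z}"] by (simp add: P0_def vimage_def)
      then have "prob (joint (pair_pmf P0 P0) (\<lambda>c. V (snd (snd c) b))) {(c, z). T1 (fst (fst c)) (fst z)} \<le> \<epsilon>1"
        by (intro prob_joint_pair_le[where R = "\<lambda>c z. T1 (fst c) (fst z)" and K = "\<lambda>c. V (snd c b)"])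
      then show ?thesis
        using prob_joint_map[of CB "\<lambda>c. V (snd (snd c) b)" "\<lambda>C. (C (a', f), C (a, f))"
          "\<lambda>c z. T1 (fst (fst c)) (fst z)"] that m
        by (simp add: E1_def case_prod_unfold pair)
    qed
    have 2: "prob ?J (E2 i) \<le> \<epsilon>2" if i: "i \<in> (A \<times> F - {(a, f)}) \<times> B" for i
    proof -
      obtain a' f' b' where i': "i = ((a', f'), b')" by (cases i) auto
      have b': "b' \<in> B" using i i' by auto
      have "prob P0 {c. T2 (fst c) (snd c b') z} \<le> \<epsilon>2" for z
        using T2[of z] unfolding P0_b[OF b', symmetric] by (simp add: vimage_def case_prod_unfold)
      then have "prob (joint (pair_pmf P0 P0) (\<lambda>c. V (snd (snd c) b))) {(c, z). T2 (fst (fst c)) (snd (fst c) b') (snd z)} \<le> \<epsilon>2"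
        by (intro prob_joint_pair_le[where R = "\<lambda>c z. T2 (fst c) (snd c b') (snd z)" and K = "\<lambda>c. V (snd c b)"])
      then show ?thesis
        using prob_joint_map[of CB "\<lambda>c. V (snd (snd c) b)" "\<lambda>C. (C (a', f'), C (a, f))"
          "\<lambda>c z. T2 (fst (fst c)) (snd (fst c) b') (snd z)"] i i' m
        by (auto simp add: E2_def case_prod_unfold pair)
    qed
    have 3: "prob ?J (E3 b') \<le> \<epsilon>3" if b': "b' \<in> B - {b}" for b'
    proof -
      have "prob (joint P0 (\<lambda>c. V (snd c b))) {(c, z). T2 (fst c) (snd c b') (snd z)} \<le> \<epsilon>3"
      proof -
        have "joint P0 (\<lambda>c. V (snd c b)) = bind_pmf PU (\<lambda>u. map_pmf (\<lambda>(g, z). ((u, g), z))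
            (joint (Pi_pmf B undefined (\<lambda>_. k u)) (\<lambda>g. V (g b))))"
          by (simp add: P0_def joint_def map_bind_pmf bind_map_pmf bind_assoc_pmf map_pmf_comp)
        moreover have "prob (map_pmf (\<lambda>(g, z). ((u, g), z)) (joint (Pi_pmf B undefined (\<lambda>_. k u)) (\<lambda>g. V (g b))))
          {(c, z). T2 (fst c) (snd c b') (snd z)} \<le> \<epsilon>3" if u: "u \<in> set_pmf PU" for u
        proof -
          have "map_pmf (\<lambda>g. (g b', g b)) (Pi_pmf B undefined (\<lambda>_. k u)) = pair_pmf (k u) (k u)"
            using fin b' m by (subst Pi_pmf_pair) auto
          moreover have "prob (joint (pair_pmf (k u) (k u)) (\<lambda>c. V (snd c))) {(c, z). T2 u (fst c) (snd z)} \<le> \<epsilon>3"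
            by (rule prob_joint_pair_le[where R = "\<lambda>x z. T2 u x (snd z)"]) (rule T3[OF u])
          ultimately show ?thesis
            using prob_joint_map[of "Pi_pmf B undefined (\<lambda>_. k u)" "\<lambda>c. V (snd c)" "\<lambda>g. (g b', g b)"
              "\<lambda>c z. T2 u (fst c) (snd z)"]
            by (simp add: vimage_def case_prod_unfold)
        qed
        ultimately show ?thesis by (simp add: prob_bind_le)
      qed
      then show ?thesis
        using prob_joint_map[of CB "\<lambda>c. V (snd c b)" "\<lambda>C. C (a, f)" "\<lambda>c z. T2 (fst c) (snd c b') (snd z)"]
        by (simp add: E3_def case_prod_unfold comp)
    qed
    have "{(C, z). Err C (a, f, b) z} = E0 \<union> ((\<Union>a'\<in>A - {a}. E1 a') \<union> ((\<Union>i\<in>(A \<times> F - {(a, f)}) \<times> B. E2 i) \<union> (\<Union>b'\<in>B - {b}. E3 b')))"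
      unfolding Err_def E0_def E1_def E2_def E3_def by auto
    then have "prob ?J {(C, z). Err C (a, f, b) z} \<le> prob ?J E0 + (prob ?J (\<Union>a'\<in>A - {a}. E1 a')
        + (prob ?J (\<Union>i\<in>(A \<times> F - {(a, f)}) \<times> B. E2 i) + prob ?J (\<Union>b'\<in>B - {b}. E3 b')))"
      by (simp only:) (intro order_trans[OF prob_Un_le] add_left_mono order_refl)
    also have "\<dots> \<le> prob ?J E0 + (card (A - {a}) * \<epsilon>1 + (card ((A \<times> F - {(a, f)}) \<times> B) * \<epsilon>2 + card (B - {b}) * \<epsilon>3))"
      using fin 1 2 3 by (intro add_left_mono add_mono prob_UN_le) auto
    also have "\<dots> \<le> \<beta>"
    proof -
      have "card (A - {a}) * \<epsilon>1 \<le> card A * \<epsilon>1"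
        using fin \<epsilon> by (intro mult_right_mono) (auto intro: card_mono)
      moreover have "card (A \<times> F - {(a, f)}) * card B \<le> card A * card F * card B"
        by (metis card_Diff1_le card_cartesian_product mult_le_mono1)
      then have "real (card ((A \<times> F - {(a, f)}) \<times> B)) \<le> card A * card F * card B"
        by (subst card_cartesian_product) (simp only: of_nat_le_iff flip: of_nat_mult)
      then have "card ((A \<times> F - {(a, f)}) \<times> B) * \<epsilon>2 \<le> card A * card F * card B * \<epsilon>2"
        using \<epsilon> by (intro mult_right_mono)
      moreover have "card B \<ge> 1" using fin m by (auto simp: Suc_le_eq card_gt_0_iff)
      then have "card (B - {b}) * \<epsilon>3 = (real (card B) - 1) * \<epsilon>3"
        using m by (simp add: card_Diff_singleton of_nat_diff)
      ultimately show ?thesis unfolding \<beta>_def 0 by linarith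
    qed
    finally show ?thesis .
  qed
  define X where "X C = (\<lambda>(a, f, b). snd (C (a, f)) b)" for C :: "'a \<times> 'f \<Rightarrow> 'u \<times> ('b \<Rightarrow> 'x)"
  have "prob (bind_pmf CB (\<lambda>C. map_pmf (Pair C) (joint Q (\<lambda>m. V (X C m))))) {(C, m, z). Err C m z} \<le> \<beta>"
  proof -
    have "bind_pmf CB (\<lambda>C. map_pmf (Pair C) (joint Q (\<lambda>m. V (X C m))))
       = bind_pmf Q (\<lambda>m. map_pmf (\<lambda>(C, z). (C, m, z)) (joint CB (\<lambda>C. V (X C m))))"
      unfolding joint_def map_bind_pmf map_pmf_comp by (subst bind_commute_pmf) simp
    moreover have "prob (map_pmf (\<lambda>(C, z). (C, m, z)) (joint CB (\<lambda>C. V (X C m)))) {(C, m, z). Err C m z} \<le> \<beta>"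
      if "m \<in> set_pmf Q" for m
    proof -
      obtain a f b where m: "m = (a, f, b)" by (cases m) auto
      then show ?thesis using per_message[of a f b] that Q
        by (auto simp: X_def vimage_def case_prod_unfold)
    qed
    ultimately show ?thesis by (simp add: prob_bind_le)
  qed
  then have "mean CB (\<lambda>C. prob (joint Q (\<lambda>m. V (X C m))) {(m, z). Err C m z}) \<le> \<beta>"
    by (simp add: prob_bind vimage_def case_prod_unfold)
  \<comment> \<open>Some codebook is at least as good as the average.\<close>
  then obtain C where C: "C \<in> set_pmf CB" and err: "prob (joint Q (\<lambda>m. V (X C m))) {(m, z). Err C m z} \<le> \<beta>"
    using exists_le_mean[OF finCB] by (meson order_trans)
  define d1 where "d1 f z = (SOME a. a \<in> A \<and> T1 (fst (C (a, f))) z)" for f z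
  define d2 where "d2 z = (SOME m. m \<in> A \<times> F \<times> B \<and> (\<lambda>(a, f, b). T2 (fst (C (a, f))) (snd (C (a, f)) b) z) m)" for z
  have dec: "d1 f z1 = a" "d2 z2 = (a, f, b)" if "\<not> Err C (a, f, b) (z1, z2)" and m: "(a, f, b) \<in> A \<times> F \<times> B" for a f b z1 z2
  proof -
    show "d1 f z1 = a"
      unfolding d1_def by (rule some_equality) (use that in \<open>auto simp: Err_def\<close>)
    show "d2 z2 = (a, f, b)"
      unfolding d2_def by (rule some_equality) (use that in \<open>auto simp: Err_def\<close>)
  qed
  show thesis
  proof (rule that)
    fix a f b assume m: "a \<in> A" "f \<in> F" "b \<in> B"
    have "C \<in> PiE_dflt (A \<times> F) undefined (\<lambda>_. set_pmf P0)"
      using C fin by (simp add: CB_def set_Pi_pmf comp_def)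
    then have "C (a, f) \<in> set_pmf P0" using m by (auto simp: PiE_dflt_def)
    then have "fst (C (a, f)) \<in> set_pmf PU"
      "snd (C (a, f)) \<in> PiE_dflt B undefined (\<lambda>_. set_pmf (k (fst (C (a, f)))))"
      using fin by (auto simp: P0_def set_Pi_pmf comp_def)
    then show "\<exists>u\<in>set_pmf PU. X C (a, f, b) \<in> set_pmf (k u)"
      using m by (auto simp: PiE_dflt_def X_def)
  next
    have "prob (joint Q (\<lambda>m. V (X C m))) {((a, f, b), (z1, z2)). d1 f z1 \<noteq> a \<or> d2 z2 \<noteq> (a, f, b)}
      \<le> prob (joint Q (\<lambda>m. V (X C m))) {(m, z). Err C m z}"
      by (rule prob_mono) (use Q dec in \<open>fastforce\<close>)
    also note err
    finally show "prob (joint Q (\<lambda>(a, f, b). V (X C (a, f, b)))) {((a, f, b), (z1, z2)). d1 f z1 \<noteq> a \<or> d2 z2 \<noteq> (a, f, b)}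
     \<le> prob (joint (joint PU k) (\<lambda>c. V (snd c))) {((u, x), (z1, z2)). \<not> T1 u z1 \<or> \<not> T2 u x z2}
       + card A * \<epsilon>1 + card A * card F * card B * \<epsilon>2 + (real (card B) - 1) * \<epsilon>3"
      by (simp add: \<beta>_def case_prod_unfold)
  qed
qed

subsection \<open>Information densities\<close>

text \<open>A memoryless channel with trivial inputs, so that the facts about
  \<open>memoryless\<close> apply.\<close>

definition iid :: "nat \<Rightarrow> 'a pmf \<Rightarrow> 'a list pmf" where
  "iid n p = memoryless (\<lambda>_. p) (replicate n ())"

lemma iid_0 [simp]: "iid 0 p = return_pmf []"
  by (simp add: iid_def)

lemma iid_Suc: "iid (Suc n) p = bind_pmf p (\<lambda>y. map_pmf (Cons y) (iid n p))"
  by (simp add: iid_def)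

lemma memoryless_const: "memoryless (\<lambda>_. q) xs = iid (length xs) q"
  by (induction xs) (simp_all add: iid_Suc)

lemma memoryless_map_list: "memoryless K (map g xs) = memoryless (\<lambda>x. K (g x)) xs"
  by (induction xs) simp_all

lemma bind_memoryless: "bind_pmf (memoryless K xs) (memoryless L) = memoryless (\<lambda>x. bind_pmf (K x) L) xs"
proof (induction xs)
  case (Cons x xs)
  have "bind_pmf (memoryless K (x # xs)) (memoryless L) = bind_pmf (K x) (\<lambda>y. bind_pmf (memoryless K xs) (\<lambda>l.
      bind_pmf (L y) (\<lambda>z. map_pmf (Cons z) (memoryless L l))))"
    by (simp add: bind_assoc_pmf bind_map_pmf)
  also have "\<dots> = bind_pmf (K x) (\<lambda>y. bind_pmf (L y) (\<lambda>z. bind_pmf (memoryless K xs) (\<lambda>l. map_pmf (Cons z) (memoryless L l))))"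
    by (subst bind_commute_pmf) simp
  also have "\<dots> = memoryless (\<lambda>x. bind_pmf (K x) L) (x # xs)"
    by (simp add: bind_assoc_pmf flip: Cons.IH map_bind_pmf)
  finally show ?case .
qed (simp add: bind_return_pmf)

lemma joint_memoryless:
  "joint (memoryless K xs) (memoryless V) = map_pmf (\<lambda>l. (map fst l, map snd l)) (memoryless (\<lambda>x. joint (K x) V) xs)"
proof (induction xs)
  case (Cons x xs)
  have "joint (memoryless K (x # xs)) (memoryless V) = bind_pmf (K x) (\<lambda>y. bind_pmf (memoryless K xs) (\<lambda>l.
      bind_pmf (V y) (\<lambda>z. map_pmf (\<lambda>zs. (y # l, z # zs)) (memoryless V l))))"
    by (simp add: joint_def bind_assoc_pmf bind_map_pmf map_bind_pmf map_pmf_comp)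
  also have "\<dots> = bind_pmf (K x) (\<lambda>y. bind_pmf (V y) (\<lambda>z. bind_pmf (memoryless K xs) (\<lambda>l.
      map_pmf (\<lambda>zs. (y # l, z # zs)) (memoryless V l))))"
    by (subst bind_commute_pmf) simp
  also have "\<dots> = bind_pmf (K x) (\<lambda>y. bind_pmf (V y) (\<lambda>z. map_pmf (\<lambda>(l, zs). (y # l, z # zs)) (joint (memoryless K xs) (memoryless V))))"
    by (simp add: joint_def map_bind_pmf map_pmf_comp)
  also have "\<dots> = map_pmf (\<lambda>l. (map fst l, map snd l)) (memoryless (\<lambda>x. joint (K x) V) (x # xs))"
    unfolding Cons.IH by (simp add: joint_def bind_assoc_pmf bind_map_pmf map_bind_pmf map_pmf_comp)
  finally show ?case .
qed (simp add: joint_def bind_return_pmf)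

lemma joint_iid: "joint (iid n \<nu>) (memoryless k) = map_pmf (\<lambda>l. (map fst l, map snd l)) (iid n (joint \<nu> k))"
  unfolding iid_def by (rule joint_memoryless)

lemma set_iid: "l \<in> set_pmf (iid n p) \<Longrightarrow> length l = n \<and> set l \<subseteq> set_pmf p"
  by (induction n arbitrary: l) (fastforce simp: iid_Suc)+

lemma finite_set_iid: "finite (set_pmf p) \<Longrightarrow> finite (set_pmf (iid n p))"
  unfolding iid_def by (rule finite_set_memoryless)

lemma pmf_memoryless_Cons: "pmf (memoryless K (x # xs)) (y # ys) = pmf (K x) y * pmf (memoryless K xs) ys"
proof -
  have "memoryless K (x # xs) = map_pmf (\<lambda>(y, l). y # l) (joint (K x) (\<lambda>_. memoryless K xs))"
    by (simp add: joint_def map_bind_pmf map_pmf_comp)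
  moreover have "inj (\<lambda>(y, l). y # l)" by (auto simp: inj_def)
  ultimately show ?thesis
    using pmf_map_inj'[of "\<lambda>(y, l). y # l" "joint (K x) (\<lambda>_. memoryless K xs)" "(y, ys)"] by simp
qed

lemma iid_moments:
  assumes fin: "finite (set_pmf p)" and 0: "mean p g = 0"
  shows "mean (iid n p) (\<lambda>l. sum_list (map g l)) = 0"
    and "mean (iid n p) (\<lambda>l. (sum_list (map g l))\<^sup>2) = n * mean p (\<lambda>x. (g x)\<^sup>2)"
proof (induction n)
  case (Suc n)
  have finn: "finite (set_pmf (iid n p))" by (rule finite_set_iid[OF fin])
  have step: "mean (iid (Suc n) p) h = mean p (\<lambda>y. mean (iid n p) (\<lambda>l. h (y # l)))" for h
    unfolding iid_Suc using fin finn by (subst mean_bind) auto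
  show 1: "mean (iid (Suc n) p) (\<lambda>l. sum_list (map g l)) = 0"
    by (simp add: step mean_add finn Suc 0)
  have "mean (iid n p) (\<lambda>l. (g y + sum_list (map g l))\<^sup>2) = (g y)\<^sup>2 + n * mean p (\<lambda>x. (g x)\<^sup>2)" for y
  proof -
    have "mean (iid n p) (\<lambda>l. (g y + sum_list (map g l))\<^sup>2) =
      mean (iid n p) (\<lambda>l. (g y)\<^sup>2 + 2 * g y * sum_list (map g l) + (sum_list (map g l))\<^sup>2)"
      by (simp add: power2_sum algebra_simps)
    also have "\<dots> = (g y)\<^sup>2 + 2 * g y * mean (iid n p) (\<lambda>l. sum_list (map g l)) + mean (iid n p) (\<lambda>l. (sum_list (map g l))\<^sup>2)"
      by (simp add: mean_add finn)
    finally show ?thesis by (simp add: Suc)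
  qed
  then show "mean (iid (Suc n) p) (\<lambda>l. (sum_list (map g l))\<^sup>2) = Suc n * mean p (\<lambda>x. (g x)\<^sup>2)"
    by (simp add: step mean_add fin algebra_simps)
qed simp_all

lemma chebyshev_iid:
  fixes f :: "'a \<Rightarrow> real"
  assumes fin: "finite (set_pmf p)" and n: "n > 0" and \<delta>: "\<delta> > 0"
  defines "I \<equiv> mean p f"
  shows "prob (iid n p) {l. sum_list (map f l) \<le> n * (I - \<delta>)} \<le> mean p (\<lambda>x. (f x - I)\<^sup>2) / (n * \<delta>\<^sup>2)"
proof -
  define g where "g x = f x - I" for x
  have finn: "finite (set_pmf (iid n p))" by (rule finite_set_iid[OF fin])
  have g0: "mean p g = 0" unfolding g_def by (subst mean_diff[OF fin]) (simp add: I_def)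
  have sum_g: "sum_list (map g l) = sum_list (map f l) - length l * I" for l
    by (induction l) (simp_all add: g_def algebra_simps)
  have "prob (iid n p) {l. sum_list (map f l) \<le> n * (I - \<delta>)} = mean (iid n p) (indicator {l. sum_list (map f l) \<le> n * (I - \<delta>)})"
    by simp
  also have "\<dots> \<le> mean (iid n p) (\<lambda>l. (sum_list (map g l))\<^sup>2 / (n * \<delta>)\<^sup>2)"
  proof (rule mean_mono[OF finn])
    fix l assume l: "l \<in> set_pmf (iid n p)"
    show "indicator {l. sum_list (map f l) \<le> n * (I - \<delta>)} l \<le> (sum_list (map g l))\<^sup>2 / (n * \<delta>)\<^sup>2"
    proof (cases "sum_list (map f l) \<le> n * (I - \<delta>)")
      case True
      then have "n * \<delta> \<le> - sum_list (map g l)"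
        using set_iid[OF l] by (simp add: sum_g algebra_simps)
      then have "(n * \<delta>)\<^sup>2 \<le> (- sum_list (map g l))\<^sup>2"
        using \<delta> by (intro power_mono) auto
      then show ?thesis using True n \<delta> by simp
    qed simp
  qed
  also have "\<dots> = n * mean p (\<lambda>x. (g x)\<^sup>2) / (n * \<delta>)\<^sup>2"
    by (simp add: iid_moments(2)[OF fin g0])
  also have "\<dots> = mean p (\<lambda>x. (f x - I)\<^sup>2) / (n * \<delta>\<^sup>2)"
    using n by (simp add: g_def power2_eq_square)
  finally show ?thesis .
qed

text \<open>Markov's inequality: for a fixed \<open>z\<close> of positive probability, the
  likelihood ratio of \<open>k s\<close> to the mixture has mean 1 over \<open>s\<close>. This
  bounds the chance that an independent codeword passes a test.\<close>

lemma prob_false_test: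
  assumes fin: "finite (set_pmf \<nu>)" and c: "c > 0"
  shows "prob \<nu> {s. pmf (k s) z > c * pmf (bind_pmf \<nu> k) z} \<le> 1 / c"
proof (cases "pmf (bind_pmf \<nu> k) z = 0")
  case True
  then have "z \<notin> set_pmf (bind_pmf \<nu> k)" unfolding set_pmf_iff by simp
  then have "\<And>s. s \<in> set_pmf \<nu> \<Longrightarrow> z \<notin> set_pmf (k s)" by auto
  then have "prob \<nu> {s. pmf (k s) z > c * pmf (bind_pmf \<nu> k) z} = prob \<nu> {}"
    by (intro prob_cong) (auto simp: set_pmf_iff True)
  then show ?thesis using c by simp
next
  case False
  let ?q = "pmf (bind_pmf \<nu> k) z"
  have q: "?q > 0" using False by (simp add: less_le)
  have "prob \<nu> {s. pmf (k s) z > c * ?q} = mean \<nu> (indicator {s. pmf (k s) z > c * ?q})" by simp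
  also have "\<dots> \<le> mean \<nu> (\<lambda>s. pmf (k s) z / (c * ?q))"
    using c q by (intro mean_mono fin) (auto simp: indicator_def)
  also have "\<dots> = 1 / c"
    using q c by (simp add: pmf_bind[symmetric])
  finally show ?thesis .
qed

text \<open>The log-likelihood ratio of a block is a sum of independent information densities with
  mean \<open>I\<close>, so a shortfall of \<open>n * \<delta>\<close> is rare by Chebyshev. The
  inclusion of supports keeps denominators positive.\<close>

lemma prob_true_test:
  fixes k k' :: "'s \<Rightarrow> 'y::finite pmf"
  assumes fin: "finite (set_pmf \<nu>)" and n: "n > 0" and \<delta>: "\<delta> > 0"
    and ac: "\<And>s. s \<in> set_pmf \<nu> \<Longrightarrow> set_pmf (k s) \<subseteq> set_pmf (k' s)"
  defines "i \<equiv> \<lambda>(s, y). log 2 (pmf (k s) y) - log 2 (pmf (k' s) y)"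
  defines "I \<equiv> mean (joint \<nu> k) i"
  shows "prob (joint (iid n \<nu>) (memoryless k)) {(s, y). \<not> pmf (memoryless k s) y > 2 powr (n * (I - \<delta>)) * pmf (memoryless k' s) y}
    \<le> mean (joint \<nu> k) (\<lambda>z. (i z - I)\<^sup>2) / (n * \<delta>\<^sup>2)"
proof -
  have ratio: "pmf (memoryless k' (map fst l)) (map snd l) > 0 \<and>
    pmf (memoryless k (map fst l)) (map snd l) = 2 powr (sum_list (map i l)) * pmf (memoryless k' (map fst l)) (map snd l)"
    if "set l \<subseteq> set_pmf (joint \<nu> k)" for l
    using that
  proof (induction l)
    case (Cons z l)
    obtain s y where z: "z = (s, y)" by (cases z)
    have y: "pmf (k s) y > 0" "pmf (k' s) y > 0"
      using Cons.prems ac by (auto simp: z intro!: pmf_positive)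
    then have "pmf (k s) y = pmf (k' s) y * 2 powr (i (s, y))"
      by (simp add: i_def powr_diff)
    then show ?case using Cons y by (simp add: z pmf_memoryless_Cons powr_add mult.assoc mult.left_commute del: memoryless.simps)
  qed simp
  have "prob (joint (iid n \<nu>) (memoryless k)) {(s, y). \<not> pmf (memoryless k s) y > 2 powr (n * (I - \<delta>)) * pmf (memoryless k' s) y}
    = prob (iid n (joint \<nu> k)) {l. \<not> pmf (memoryless k (map fst l)) (map snd l) > 2 powr (n * (I - \<delta>)) * pmf (memoryless k' (map fst l)) (map snd l)}"
    by (simp add: joint_iid vimage_def)
  also have "\<dots> \<le> prob (iid n (joint \<nu> k)) {l. sum_list (map i l) \<le> n * (I - \<delta>)}"
    by (rule prob_mono) (use ratio set_iid in \<open>fastforce simp: not_less\<close>)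
  also have "\<dots> \<le> mean (joint \<nu> k) (\<lambda>z. (i z - I)\<^sup>2) / (n * \<delta>\<^sup>2)"
    unfolding I_def by (rule chebyshev_iid[OF _ n \<delta>]) (simp add: fin)
  finally show ?thesis .
qed

lemma mean_log_joint:
  assumes "finite (set_pmf \<nu>)" "\<And>s. s \<in> set_pmf \<nu> \<Longrightarrow> finite (set_pmf (k s))"
  shows "mean (joint \<nu> k) (\<lambda>(s, y). log 2 (pmf (k s) y)) = - mean \<nu> (\<lambda>s. ent (k s))"
    and "mean (joint \<nu> k) (\<lambda>(s, y). log 2 (pmf (bind_pmf \<nu> k) y)) = - ent (bind_pmf \<nu> k)"
proof -
  show "mean (joint \<nu> k) (\<lambda>(s, y). log 2 (pmf (k s) y)) = - mean \<nu> (\<lambda>s. ent (k s))"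
    by (simp add: mean_joint assms ent_def)
  have "mean (joint \<nu> k) (\<lambda>(s, y). log 2 (pmf (bind_pmf \<nu> k) y)) = mean (map_pmf snd (joint \<nu> k)) (\<lambda>y. log 2 (pmf (bind_pmf \<nu> k) y))"
    unfolding integral_map_pmf by (simp add: case_prod_unfold)
  then show "mean (joint \<nu> k) (\<lambda>(s, y). log 2 (pmf (bind_pmf \<nu> k) y)) = - ent (bind_pmf \<nu> k)"
    by (simp add: ent_def)
qed

lemma prob_map_eq:
  "map_pmf g p = q \<Longrightarrow> (\<And>x. x \<in> A \<longleftrightarrow> g x \<in> B) \<Longrightarrow> prob p A = prob q B"
  unfolding measure_map_pmf[symmetric] by (auto intro!: arg_cong[where f = "prob _"])

lemma joint_map_snd: "joint P (\<lambda>c. map_pmf h (K c)) = map_pmf (\<lambda>(c, z). (c, h z)) (joint P K)"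
  by (simp add: joint_def map_bind_pmf map_pmf_comp)

text \<open>The letters of a cloud center are posteriors: \<open>\<mu>\<close> itself is the law of
  \<open>U\<close>, and \<open>memoryless id\<close> draws the satellites. The constant
  \<open>v\<close>, a sum of three variances over \<open>\<delta>\<^sup>2\<close>, is independent of
  the blocklength, the message sets and their law.\<close>

lemma superposition_coding:
  fixes W :: "('x::finite, 'y1::finite, 'y2::finite) dmbc"
  assumes fin: "finite (set_pmf \<mu>)" and \<delta>: "\<delta> > 0"
  obtains v :: real where "\<And>n (A :: 'a set) (F :: 'f set) (B :: 'b set) Q. n > 0 \<Longrightarrow> finite A \<Longrightarrow> finite F \<Longrightarrow> finite B \<Longrightarrow>
    set_pmf Q \<subseteq> A \<times> F \<times> B \<Longrightarrow>
    \<exists>x d1 d2. (\<forall>a\<in>A. \<forall>f\<in>F. \<forall>b\<in>B. length (x a f b) = n) \<and>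
      prob (joint Q (\<lambda>(a, f, b). memoryless W (x a f b))) {((a, f, b), y). d1 f (map fst y) \<noteq> a \<or> d2 (map snd y) \<noteq> (a, f, b)}
      \<le> v / n + card A * 2 powr - (n * (I_U (out1 W) \<mu> - \<delta>))
        + card A * card F * card B * 2 powr - (n * (I_U (out2 W) \<mu> + I_X (out2 W) \<mu> - \<delta>))
        + (real (card B) - 1) * 2 powr - (n * (I_X (out2 W) \<mu> - \<delta>))"
proof -
  define k1 where "k1 p = bind_pmf p (out1 W)" for p
  define k2 where "k2 p = bind_pmf p (out2 W)" for p
  define q1 where "q1 = bind_pmf \<mu> k1"
  define q2 where "q2 = bind_pmf \<mu> k2"
  define \<nu> where "\<nu> = joint \<mu> id"
  have fin\<nu>: "finite (set_pmf \<nu>)" by (simp add: \<nu>_def fin)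
  have snd\<nu>: "map_pmf snd \<nu> = bind_pmf \<mu> id" by (simp add: \<nu>_def)
  define i1 where "i1 = (\<lambda>(p, y). log 2 (pmf (k1 p) y) - log 2 (pmf q1 y))"
  define i2 where "i2 = (\<lambda>(s :: 'x pmf \<times> 'x, y). log 2 (pmf (out2 W (snd s)) y) - log 2 (pmf q2 y))"
  define i3 where "i3 = (\<lambda>(s :: 'x pmf \<times> 'x, y). log 2 (pmf (out2 W (snd s)) y) - log 2 (pmf (k2 (fst s)) y))"
  let ?J2 = "joint \<nu> (\<lambda>s. out2 W (snd s))"
  have q2: "bind_pmf \<nu> (\<lambda>s. out2 W (snd s)) = q2"
    by (simp add: q2_def k2_def[abs_def] \<nu>_def joint_def bind_assoc_pmf bind_map_pmf)
  have I1: "mean (joint \<mu> k1) i1 = I_U (out1 W) \<mu>"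
    unfolding i1_def case_prod_unfold q1_def
    using mean_log_joint[of \<mu> k1]
    by (simp add: mean_diff fin case_prod_unfold I_U_def outent_def[abs_def] k1_def[abs_def] bind_assoc_pmf)
  have mi: "mean ?J2 (\<lambda>(s, y). log 2 (pmf (out2 W (snd s)) y)) = - mean (bind_pmf \<mu> id) (\<lambda>x. ent (out2 W x))"
    using mean_log_joint(1)[of \<nu> "\<lambda>s. out2 W (snd s)"] by (simp add: fin\<nu> snd\<nu>[symmetric])
  have I2: "mean ?J2 i2 = I_U (out2 W) \<mu> + I_X (out2 W) \<mu>"
    unfolding i2_def case_prod_unfold
    using mi mean_log_joint(2)[of \<nu> "\<lambda>s. out2 W (snd s)"]
    by (simp add: q2 mean_diff fin\<nu> case_prod_unfold I_U_def I_X_def outent_def[abs_def])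
       (simp add: q2_def k2_def[abs_def] bind_assoc_pmf)
  have "mean ?J2 (\<lambda>(s, y). log 2 (pmf (k2 (fst s)) y)) = - mean \<mu> (outent (out2 W))"
  proof -
    have "mean ?J2 (\<lambda>(s, y). log 2 (pmf (k2 (fst s)) y)) = mean \<nu> (\<lambda>s. mean (out2 W (snd s)) (\<lambda>y. log 2 (pmf (k2 (fst s)) y)))"
      by (simp add: mean_joint fin\<nu>)
    also have "\<dots> = mean \<mu> (\<lambda>p. mean p (\<lambda>x. mean (out2 W x) (\<lambda>y. log 2 (pmf (k2 p) y))))"
      by (simp add: \<nu>_def mean_joint fin)
    also have "\<dots> = mean \<mu> (\<lambda>p. mean (k2 p) (\<lambda>y. log 2 (pmf (k2 p) y)))"
      by (simp add: k2_def mean_bind)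
    finally show ?thesis by (simp add: outent_def[abs_def] ent_def k2_def)
  qed
  then have I3: "mean ?J2 i3 = I_X (out2 W) \<mu>"
    unfolding i3_def case_prod_unfold using mi
    by (simp add: mean_diff fin\<nu> case_prod_unfold I_X_def)
  define v where "v = (mean (joint \<mu> k1) (\<lambda>z. (i1 z - I_U (out1 W) \<mu>)\<^sup>2)
    + mean ?J2 (\<lambda>z. (i2 z - (I_U (out2 W) \<mu> + I_X (out2 W) \<mu>))\<^sup>2)
    + mean ?J2 (\<lambda>z. (i3 z - I_X (out2 W) \<mu>)\<^sup>2)) / \<delta>\<^sup>2"
  show thesis
  proof (rule that[of v])
    fix n and A :: "'a set" and F :: "'f set" and B :: "'b set" and Q
    assume n: "n > (0::nat)" and finA: "finite A" "finite F" "finite B" and Q: "set_pmf Q \<subseteq> A \<times> F \<times> B"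
    \<comment> \<open>Thresholds lie \<open>n * \<delta>\<close> below the mean densities of a
      block, whose values per letter are \<open>I(U;Y1)\<close>,
      \<open>I(X;Y2) = I(U;Y2) + I(X;Y2|U)\<close> and \<open>I(X;Y2|U)\<close>.\<close>
    define c1 where "c1 = 2 powr (n * (I_U (out1 W) \<mu> - \<delta>))"
    define c2 where "c2 = 2 powr (n * (I_U (out2 W) \<mu> + I_X (out2 W) \<mu> - \<delta>))"
    define c3 where "c3 = 2 powr (n * (I_X (out2 W) \<mu> - \<delta>))"
    have c: "c1 > 0" "c2 > 0" "c3 > 0" by (simp_all add: c1_def c2_def c3_def)
    define PU where "PU = iid n \<mu>"
    define V where "V x = map_pmf (\<lambda>y. (map fst y, map snd y)) (memoryless W x)" for x
    define T1 where "T1 u z \<longleftrightarrow> pmf (memoryless k1 u) z > c1 * pmf (memoryless (\<lambda>_. q1) u) z" for u z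
    \<comment> \<open>Receiver 2 demands both tests: \<open>T2a\<close> rejects triples with a wrong
      center, \<open>T2b\<close> wrong satellites of the right center.\<close>
    define T2a where "T2a x z \<longleftrightarrow> pmf (memoryless (out2 W) x) z > c2 * pmf (memoryless (\<lambda>_. q2) x) z" for x z
    define T2b where "T2b u x z \<longleftrightarrow> pmf (memoryless (out2 W) x) z > c3 * pmf (memoryless k2 u) z" for u x z
    have finPU: "finite (set_pmf PU)" by (simp add: PU_def finite_set_iid fin)
    have lenPU: "length u = n" if "u \<in> set_pmf PU" for u using that set_iid by (auto simp: PU_def)
    have fink: "finite (set_pmf (memoryless id (u :: 'x pmf list)))" for u by (rule finite_set_memoryless) simp
    have "prob PU {u. T1 u z} \<le> 1 / c1" for z
    proof -
      have "prob PU {u. T1 u z} = prob PU {u. pmf (memoryless k1 u) z > c1 * pmf (bind_pmf PU (memoryless k1)) z}"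
      proof (rule prob_cong)
        have "bind_pmf PU (memoryless k1) = iid n q1" by (simp add: PU_def iid_def bind_memoryless q1_def)
        then show "u \<in> {u. T1 u z} \<longleftrightarrow> u \<in> {u. pmf (memoryless k1 u) z > c1 * pmf (bind_pmf PU (memoryless k1)) z}"
          if "u \<in> set_pmf PU" for u
          using that by (simp add: T1_def memoryless_const lenPU)
      qed
      then show ?thesis using prob_false_test[OF finPU c(1)] by simp
    qed
    moreover have "prob (joint PU (memoryless id)) {(u, x). T2a x z \<and> T2b u x z} \<le> 1 / c2" for z
    proof -
      have "bind_pmf (joint PU (memoryless id)) (\<lambda>s. memoryless (out2 W) (snd s)) = iid n q2"
        by (simp add: joint_def bind_assoc_pmf bind_map_pmf bind_memoryless PU_def[unfolded iid_def])
           (simp add: bind_assoc_pmf[symmetric] bind_memoryless iid_def q2_def k2_def[abs_def])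
      moreover have "length x = n" if "(u, x) \<in> set_pmf (joint PU (memoryless id))" for u x
        using that lenPU by (auto dest: length_memoryless)
      ultimately have "prob (joint PU (memoryless id)) {(u, x). T2a x z \<and> T2b u x z} \<le> prob (joint PU (memoryless id))
         {s. pmf (memoryless (out2 W) (snd s)) z > c2 * pmf (bind_pmf (joint PU (memoryless id)) (\<lambda>s. memoryless (out2 W) (snd s))) z}"
        by (intro prob_mono) (auto simp: T2a_def memoryless_const)
      then show ?thesis using prob_false_test[of "joint PU (memoryless id)" c2 "\<lambda>s. memoryless (out2 W) (snd s)" z] finPU fink c
        by force
    qed
    moreover have "prob (memoryless id u) {x. T2a x z \<and> T2b u x z} \<le> 1 / c3" for u z
    proof -
      have "prob (memoryless id u) {x. T2a x z \<and> T2b u x z} \<le> prob (memoryless id u)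
         {x. pmf (memoryless (out2 W) x) z > c3 * pmf (bind_pmf (memoryless id u) (memoryless (out2 W))) z}"
        by (intro prob_mono) (auto simp: T2b_def bind_memoryless k2_def[abs_def])
      then show ?thesis using prob_false_test[OF fink c(3), of u "memoryless (out2 W)" z] by simp
    qed
    ultimately obtain x d1 d2 where x: "\<And>a f b. a \<in> A \<Longrightarrow> f \<in> F \<Longrightarrow> b \<in> B \<Longrightarrow> \<exists>u\<in>set_pmf PU. x a f b \<in> set_pmf (memoryless id u)"
      and err: "prob (joint Q (\<lambda>(a, f, b). V (x a f b))) {((a, f, b), (z1, z2)). d1 f z1 \<noteq> a \<or> d2 z2 \<noteq> (a, f, b)}
     \<le> prob (joint (joint PU (memoryless id)) (\<lambda>c. V (snd c))) {((u, x), (z1, z2)). \<not> T1 u z1 \<or> \<not> (T2a x z2 \<and> T2b u x z2)}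
       + card A * (1 / c1) + card A * card F * card B * (1 / c2) + (real (card B) - 1) * (1 / c3)"
      by (rule superposition_one_shot[where V = V and ?T1.0 = T1 and ?T2.0 = "\<lambda>u x z. T2a x z \<and> T2b u x z",
          OF finA finPU fink _ _ _ Q]) (use c in auto)
    let ?J = "joint (joint PU (memoryless id)) (\<lambda>c. V (snd c))"
    have "prob ?J {((u, x), (z1, z2)). \<not> T1 u z1 \<or> \<not> (T2a x z2 \<and> T2b u x z2)}
      \<le> prob ?J ({((u, x), (z1, z2)). \<not> T1 u z1} \<union> ({((u, x), (z1, z2)). \<not> T2a x z2} \<union> {((u, x), (z1, z2)). \<not> T2b u x z2}))"
      by (rule prob_mono) auto
    also have "\<dots> \<le> prob ?J {((u, x), (z1, z2)). \<not> T1 u z1} +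
      (prob ?J {((u, x), (z1, z2)). \<not> T2a x z2} + prob ?J {((u, x), (z1, z2)). \<not> T2b u x z2})"
      by (intro order_trans[OF prob_Un_le] add_left_mono order_refl)
    also have "\<dots> \<le> v / n"
    proof -
      have "map_pmf (\<lambda>((u, x), (z1, z2)). (u, z1)) ?J = joint PU (memoryless k1)"
      proof -
        have "map_pmf (\<lambda>((u, x), (z1, z2)). (u, z1)) ?J =
          bind_pmf PU (\<lambda>u. map_pmf (Pair u) (bind_pmf (memoryless id u) (\<lambda>x. map_pmf (map fst) (memoryless W x))))"
          by (simp add: joint_def V_def map_bind_pmf bind_map_pmf bind_assoc_pmf map_pmf_comp)
        also have "\<dots> = joint PU (memoryless k1)"
          by (simp add: joint_def map_memoryless bind_memoryless k1_def[abs_def] out1_def[abs_def])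
        finally show ?thesis .
      qed
      then have "prob ?J {((u, x), (z1, z2)). \<not> T1 u z1} = prob (joint PU (memoryless k1)) {(u, z). \<not> T1 u z}"
        by (rule prob_map_eq) auto
      also have "\<dots> \<le> mean (joint \<mu> k1) (\<lambda>z. (i1 z - I_U (out1 W) \<mu>)\<^sup>2) / (n * \<delta>\<^sup>2)"
        using prob_true_test[OF fin n \<delta>, of k1 "\<lambda>_. q1", folded i1_def, unfolded I1, folded c1_def]
        by (simp add: T1_def PU_def) (auto simp: q1_def)
      finally have 1: "prob ?J {((u, x), (z1, z2)). \<not> T1 u z1} \<le> \<dots>" .
      have J2: "map_pmf (\<lambda>((u, x), (z1, z2)). ((u, x), z2)) ?J =
          map_pmf (\<lambda>(s, z). ((map fst s, map snd s), z)) (joint (iid n \<nu>) (memoryless (\<lambda>s. out2 W (snd s))))"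
      proof -
        have "map_pmf (\<lambda>((u, x), (z1, z2)). ((u, x), z2)) ?J = joint (joint PU (memoryless id)) (\<lambda>c. memoryless (out2 W) (snd c))"
          by (simp add: V_def joint_map_snd map_pmf_comp case_prod_unfold map_memoryless[symmetric] out2_def[abs_def])
        also have "\<dots> = joint (map_pmf (\<lambda>s. (map fst s, map snd s)) (iid n \<nu>)) (\<lambda>c. memoryless (out2 W) (snd c))"
          by (simp add: PU_def \<nu>_def joint_iid)
        also have "\<dots> =
            map_pmf (\<lambda>(s, z). ((map fst s, map snd s), z)) (joint (iid n \<nu>) (memoryless (\<lambda>s. out2 W (snd s))))"
          by (simp add: joint_map[symmetric] memoryless_map_list)
        finally show ?thesis .
      qed
      have "prob ?J {((u, x), (z1, z2)). \<not> T2a x z2} = prob (map_pmf (\<lambda>(s, z). ((map fst s, map snd s), z))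
         (joint (iid n \<nu>) (memoryless (\<lambda>s. out2 W (snd s))))) {((u, x), z). \<not> T2a x z}"
        by (rule prob_map_eq[OF J2]) auto
      also have "\<dots> = prob (joint (iid n \<nu>) (memoryless (\<lambda>s. out2 W (snd s)))) {(s, z). \<not> T2a (map snd s) z}"
        by (simp add: vimage_def case_prod_unfold)
      also have "\<dots> \<le> mean ?J2 (\<lambda>z. (i2 z - (I_U (out2 W) \<mu> + I_X (out2 W) \<mu>))\<^sup>2) / (n * \<delta>\<^sup>2)"
        using prob_true_test[OF fin\<nu> n \<delta>, of "\<lambda>s. out2 W (snd s)" "\<lambda>_. q2", folded i2_def, unfolded I2, folded c2_def]
        by (simp add: T2a_def memoryless_map_list) (auto simp: q2[symmetric])
      finally have 2: "prob ?J {((u, x), (z1, z2)). \<not> T2a x z2} \<le> \<dots>" .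
      have ac: "set_pmf (out2 W (snd s)) \<subseteq> set_pmf (k2 (fst s))" if "s \<in> set_pmf \<nu>" for s
        using that by (auto simp: \<nu>_def k2_def)
      have "prob ?J {((u, x), (z1, z2)). \<not> T2b u x z2} = prob (map_pmf (\<lambda>(s, z). ((map fst s, map snd s), z))
         (joint (iid n \<nu>) (memoryless (\<lambda>s. out2 W (snd s))))) {((u, x), z). \<not> T2b u x z}"
        by (rule prob_map_eq[OF J2]) auto
      also have "\<dots> = prob (joint (iid n \<nu>) (memoryless (\<lambda>s. out2 W (snd s)))) {(s, z). \<not> T2b (map fst s) (map snd s) z}"
        by (simp add: vimage_def case_prod_unfold)
      also have "\<dots> \<le> mean ?J2 (\<lambda>z. (i3 z - I_X (out2 W) \<mu>)\<^sup>2) / (n * \<delta>\<^sup>2)"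
        using prob_true_test[OF fin\<nu> n \<delta>, of "\<lambda>s. out2 W (snd s)" "\<lambda>s. k2 (fst s)", OF ac, folded i3_def, unfolded I3, folded c3_def]
        by (simp add: T2b_def memoryless_map_list)
      finally have 3: "prob ?J {((u, x), (z1, z2)). \<not> T2b u x z2} \<le> \<dots>" .
      show ?thesis
        using 1 2 3 by (simp add: v_def add_divide_distrib mult.commute)
    qed
    finally have fail: "prob ?J {((u, x), (z1, z2)). \<not> T1 u z1 \<or> \<not> (T2a x z2 \<and> T2b u x z2)} \<le> v / n" .
    have len: "length (x a f b) = n" if "a \<in> A" "f \<in> F" "b \<in> B" for a f b
      using x[OF that] lenPU by (auto dest: length_memoryless)
    have "(\<lambda>(a, f, b). V (x a f b)) = (\<lambda>m. map_pmf (\<lambda>y. (map fst y, map snd y)) ((\<lambda>(a, f, b). memoryless W (x a f b)) m))"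
      by (auto simp: V_def)
    then have "map_pmf (\<lambda>(m, y). (m, map fst y, map snd y)) (joint Q (\<lambda>(a, f, b). memoryless W (x a f b))) = joint Q (\<lambda>(a, f, b). V (x a f b))"
      by (simp only: joint_map_snd)
    then have "prob (joint Q (\<lambda>(a, f, b). memoryless W (x a f b))) {((a, f, b), y). d1 f (map fst y) \<noteq> a \<or> d2 (map snd y) \<noteq> (a, f, b)}
      = prob (joint Q (\<lambda>(a, f, b). V (x a f b))) {((a, f, b), (z1, z2)). d1 f z1 \<noteq> a \<or> d2 z2 \<noteq> (a, f, b)}"
      by (rule prob_map_eq) auto
    with err fail len
    show "\<exists>x d1 d2. (\<forall>a\<in>A. \<forall>f\<in>F. \<forall>b\<in>B. length (x a f b) = n) \<and>
      prob (joint Q (\<lambda>(a, f, b). memoryless W (x a f b))) {((a, f, b), y). d1 f (map fst y) \<noteq> a \<or> d2 (map snd y) \<noteq> (a, f, b)}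
      \<le> v / n + card A * 2 powr - (n * (I_U (out1 W) \<mu> - \<delta>))
        + card A * card F * card B * 2 powr - (n * (I_U (out2 W) \<mu> + I_X (out2 W) \<mu> - \<delta>))
        + (real (card B) - 1) * 2 powr - (n * (I_X (out2 W) \<mu> - \<delta>))"
      by (intro exI[of _ x] exI[of _ d1] exI[of _ d2]) (simp add: c1_def c2_def c3_def powr_minus_divide)
  qed
qed

subsection \<open>Two-phase codes\<close>

lemma valid_code_trivial:
  assumes "R1 \<ge> 0" "R2 \<ge> 0" "R_FB \<ge> 0"
  shows "valid_code R_FB N R1 R2
    \<lparr>fb_alph = \<lambda>_. {0}, fb_enc = \<lambda>_ _. 0, enc = \<lambda>_ _ _ _. undefined, dec1 = \<lambda>_. 1, dec2 = \<lambda>_. 1\<rparr>"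
  using assms by (auto simp: valid_code_def card_messages_ge(3)[simplified] ge_one_powr_ge_zero)

text \<open>For each \<open>N\<close> a code nearly attaining the infimum of the error probabilities
  is taken, so that one sequence serves all \<open>\<epsilon>\<close>. The trivial code ensures that
  the infimum is over a nonempty set at every blocklength.\<close>

lemma achievableI:
  assumes R: "R1 \<ge> 0" "R2 \<ge> 0" "R_FB \<ge> 0"
    and ev: "\<And>\<epsilon>. \<epsilon> > 0 \<Longrightarrow> \<forall>\<^sub>F N in sequentially.
      \<exists>c. valid_code R_FB N R1 R2 c \<and> error_prob W N R1 R2 c \<le> \<epsilon>"
  shows "achievable W R_FB R1 R2"
proof -
  define X where "X N = error_prob W N R1 R2 ` {c. valid_code R_FB N R1 R2 c}" for N
  have ne: "X N \<noteq> {}" for N using valid_code_trivial[OF R] by (auto simp: X_def)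
  have bdd: "bdd_below (X N)" for N
    unfolding X_def error_prob_def by (intro bdd_belowI2[of _ 0]) simp
  have "\<exists>c. valid_code R_FB N R1 R2 c \<and> error_prob W N R1 R2 c < Inf (X N) + 1 / Suc N" for N
    using cInf_lessD[OF ne, of N "Inf (X N) + 1 / Suc N"] by (auto simp: X_def)
  then obtain c where c: "\<And>N. valid_code R_FB N R1 R2 (c N)"
    "\<And>N. error_prob W N R1 R2 (c N) < Inf (X N) + 1 / Suc N" by metis
  have "(\<lambda>N. error_prob W N R1 R2 (c N)) \<longlonglongrightarrow> 0"
  proof (rule order_tendstoI)
    fix a :: real assume "a < 0"
    then show "\<forall>\<^sub>F N in sequentially. a < error_prob W N R1 R2 (c N)"
      by (intro always_eventually allI) (auto simp: error_prob_def intro: less_le_trans)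
  next
    fix a :: real assume a: "0 < a"
    have "\<forall>\<^sub>F N in sequentially. 1 / real (Suc N) < a / 2"
      using order_tendstoD(2)[OF LIMSEQ_inverse_real_of_nat, of "a / 2"] a by (simp add: inverse_eq_divide)
    moreover have "\<forall>\<^sub>F N in sequentially. Inf (X N) \<le> a / 2"
    proof (rule eventually_mono[OF ev[of "a / 2"]])
      fix N assume "\<exists>c. valid_code R_FB N R1 R2 c \<and> error_prob W N R1 R2 c \<le> a / 2"
      then obtain c where "error_prob W N R1 R2 c \<in> X N" "error_prob W N R1 R2 c \<le> a / 2"
        by (auto simp: X_def)
      then show "Inf (X N) \<le> a / 2" by (rule cInf_lower2[OF _ _ bdd])
    qed (use a in simp)
    ultimately show "\<forall>\<^sub>F N in sequentially. error_prob W N R1 R2 (c N) < a"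
    proof eventually_elim
      case (elim N)
      then show ?case using c(2)[of N] by linarith
    qed
  qed
  then show ?thesis using R c(1) by (auto simp: achievable_def)
qed

section \<open>Selecting message subsets of prescribed size\<close>

lemma subselect:
  fixes f :: "'a \<Rightarrow> real" and c :: real
  assumes "finite S" "K \<le> card S" "sum f S \<le> card S * c"
  shows "\<exists>S'\<subseteq>S. card S' = K \<and> sum f S' \<le> K * c"
  using assms
proof (induction "card S - K" arbitrary: S)
  case 0
  then show ?case by (intro exI[of _ S]) auto
next
  case (Suc d)
  show ?case
  proof (cases "\<exists>x\<in>S. f x \<ge> c")
    \<comment> \<open>Dropping an element at or above \<open>c\<close> keeps the average of the rest
      at most \<open>c\<close>; if there is none, every subset will do.\<close>
    case True
    then obtain x where x: "x \<in> S" "f x \<ge> c" by auto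
    have card: "card (S - {x}) = card S - 1" using x Suc.prems by simp
    have "card S \<ge> 1" using x(1) Suc.prems(1) by (auto simp: Suc_le_eq card_gt_0_iff)
    then have "sum f (S - {x}) \<le> card (S - {x}) * c"
      using x Suc.prems by (simp add: sum_diff1 card of_nat_diff algebra_simps)
    moreover have "d = card (S - {x}) - K" "K \<le> card (S - {x})" using Suc.hyps(2) card by auto
    ultimately obtain S' where "S' \<subseteq> S - {x}" "card S' = K" "sum f S' \<le> K * c"
      using Suc.hyps(1)[of "S - {x}"] Suc.prems by auto
    then show ?thesis by blast
  next
    case False
    obtain S' where S': "S' \<subseteq> S" "card S' = K" using obtain_subset_with_card_n[OF Suc.prems(2)] by auto
    then have "sum f S' \<le> (\<Sum>_\<in>S'. c)" using False by (intro sum_mono) (auto simp: not_le less_imp_le)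
    then show ?thesis using S' by auto
  qed
qed

text \<open>Rates prescribe the numbers of messages exactly, whereas a two-phase code may offer
  more. Since the messages must stay independent, the two sets are thinned out one after the other,
  neither time raising the bound on the average error.\<close>

lemma subselect_product:
  fixes e :: "'a \<Rightarrow> 'b \<Rightarrow> real" and c :: real
  assumes fin: "finite S1" "finite S2" and K: "K1 \<le> card S1" "K2 \<le> card S2"
    and le: "(\<Sum>a\<in>S1. \<Sum>b\<in>S2. e a b) \<le> card S1 * (card S2 * c)"
  obtains S1' S2' where "S1' \<subseteq> S1" "card S1' = K1" "S2' \<subseteq> S2" "card S2' = K2"
    "(\<Sum>a\<in>S1'. \<Sum>b\<in>S2'. e a b) \<le> K1 * (K2 * c)"
proof -
  obtain S1' where 1: "S1' \<subseteq> S1" "card S1' = K1" "(\<Sum>a\<in>S1'. \<Sum>b\<in>S2. e a b) \<le> K1 * (card S2 * c)"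
    using subselect[OF fin(1) K(1) le] by auto
  have "(\<Sum>b\<in>S2. \<Sum>a\<in>S1'. e a b) \<le> card S2 * (K1 * c)"
    using 1(3) by (subst sum.swap) (simp add: mult.left_commute)
  then obtain S2' where 2: "S2' \<subseteq> S2" "card S2' = K2" "(\<Sum>b\<in>S2'. \<Sum>a\<in>S1'. e a b) \<le> K2 * (K1 * c)"
    using subselect[OF fin(2) K(2)] by auto
  show thesis
    using 1 2 by (intro that[of S1' S2']) (auto simp: sum.swap[of _ S1'] mult.left_commute)
qed

lemma pmf_of_set_Times:
  assumes "finite A" "A \<noteq> {}" "finite B" "B \<noteq> {}"
  shows "pmf_of_set (A \<times> B) = pair_pmf (pmf_of_set A) (pmf_of_set B)"
proof (rule pmf_eqI)
  fix z show "pmf (pmf_of_set (A \<times> B)) z = pmf (pair_pmf (pmf_of_set A) (pmf_of_set B)) z"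
    using assms by (cases z) (simp add: pmf_pair card_cartesian_product indicator_def)
qed

lemma prob_uniform_pair:
  assumes A: "finite A" "A \<noteq> {}" and B: "finite B" "B \<noteq> {}"
  shows "prob (joint (pair_pmf (pmf_of_set A) (pmf_of_set B)) K) E =
    (\<Sum>a\<in>A. \<Sum>b\<in>B. prob (K (a, b)) {y. ((a, b), y) \<in> E}) / (card A * card B)"
  unfolding joint_def prob_bind pmf_of_set_Times[OF A B, symmetric] using A B
  by (subst integral_pmf_of_set)
     (simp_all add: vimage_def card_cartesian_product sum.cartesian_product case_prod_unfold)

text \<open>Two phases: a code for the enhanced channel, during which Receiver 1 feeds back its raw outputs, and
  a superposition code whose cloud centers carry these outputs along with a message for Receiver 1.\<close>

lemma two_phase_code:
  fixes W :: "('x::finite, 'y1::finite, 'y2::finite) dmbc"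
    and xE :: "nat \<Rightarrow> nat \<Rightarrow> 'x list" and x :: "nat \<Rightarrow> 'y1 list \<Rightarrow> nat \<Rightarrow> 'x list"
  assumes R: "R1 \<ge> 0" "R2 \<ge> 0"
    and A: "finite A1" "A1 \<noteq> {}" "finite A2" "A2 \<noteq> {}" and L: "L1 > 0" "L2 > 0"
    and lenE: "\<And>a1 a2. length (xE a1 a2) = n1"
    and phase1: "prob (joint (pair_pmf (pmf_of_set A1) (pmf_of_set A2)) (\<lambda>a. memoryless W (xE (fst a) (snd a))))
      {((a1, a2), y). a1 \<noteq> g1 (map fst y) \<or> a2 \<noteq> g2 y} \<le> \<epsilon>"
    and phase2: "\<And>Q. set_pmf Q \<subseteq> {..<L1} \<times> {f. length f = n1} \<times> {..<L2} \<Longrightarrow>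
      \<exists>x d1 d2. (\<forall>a\<in>{..<L1}. \<forall>f\<in>{f :: 'y1 list. length f = n1}. \<forall>b\<in>{..<L2}. length (x a f b) = n2) \<and>
        prob (joint Q (\<lambda>(a, f, b). memoryless W (x a f b))) {((a, f, b), y). d1 f (map fst y) \<noteq> a \<or> d2 (map snd y) \<noteq> (a, f, b)} \<le> \<beta>"
    and K: "card (messages (n1 + n2) R1) \<le> card A1 * L1" "card (messages (n1 + n2) R2) \<le> card A2 * L2"
    and fb: "real CARD('y1) ^ n1 \<le> 2 powr (real (n1 + n2) * R_FB)"
  shows "\<exists>c. valid_code R_FB (n1 + n2) R1 R2 c \<and> error_prob W (n1 + n2) R1 R2 c \<le> \<epsilon> + \<beta>"
proof -
  \<comment> \<open>Each message is split into a first-phase part and a second-phase part.\<close>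
  define S1 where "S1 = A1 \<times> {..<L1}"
  define S2 where "S2 = A2 \<times> {..<L2}"
  have S: "finite S1" "S1 \<noteq> {}" "finite S2" "S2 \<noteq> {}"
    using A L by (auto simp: S1_def S2_def)
  have cardS: "card S1 = card A1 * L1" "card S2 = card A2 * L2"
    by (simp_all add: S1_def S2_def card_cartesian_product)
  define U where "U = pair_pmf (pmf_of_set S1) (pmf_of_set S2)"
  define P1 where "P1 = joint U (\<lambda>s. memoryless W (xE (fst (fst s)) (fst (snd s))))"
  \<comment> \<open>What the second phase transmits: the two second-phase parts and, between them,
    the outputs fed back by Receiver 1. Its law is the \<open>Q\<close> for which the superposition
    code is chosen.\<close>
  define h where "h = (\<lambda>(s :: (nat \<times> nat) \<times> (nat \<times> nat), y :: ('y1 \<times> 'y2) list). (snd (fst s), map fst y, snd (snd s)))"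
  have "set_pmf (map_pmf h P1) \<subseteq> {..<L1} \<times> {f. length f = n1} \<times> {..<L2}"
    using S lenE by (auto simp: h_def P1_def U_def S1_def S2_def dest!: length_memoryless)
  from phase2[OF this] obtain x d1 d2 where
    len': "\<forall>a\<in>{..<L1}. \<forall>f\<in>{f. length f = n1}. \<forall>b\<in>{..<L2}. length (x a f b) = n2" and
    err2: "prob (joint (map_pmf h P1) (\<lambda>(a, f, b). memoryless W (x a f b)))
       {((a, f, b), y). d1 f (map fst y) \<noteq> a \<or> d2 (map snd y) \<noteq> (a, f, b)} \<le> \<beta>"
    by blast
  have len: "length (x a f b) = n2" if "a < L1" "length f = n1" "b < L2" for a f b
    using len' that by simp
  define K2 where "K2 = (\<lambda>(a, f, b). memoryless W (x a f b))"
  define wrong1 where "wrong1 = (\<lambda>(s1 :: nat \<times> nat, s2 :: nat \<times> nat) (y :: ('y1 \<times> 'y2) list). fst s1 \<noteq> g1 (map fst y) \<or> fst s2 \<noteq> g2 y)"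
  define wrong2 where "wrong2 = (\<lambda>(s1 :: nat \<times> nat, s2 :: nat \<times> nat) (y :: ('y1 \<times> 'y2) list) (z :: ('y1 \<times> 'y2) list).
     d1 (map fst y) (map fst z) \<noteq> snd s1 \<or> d2 (map snd z) \<noteq> (snd s1, map fst y, snd s2))"
  define J where "J s = joint (memoryless W (xE (fst (fst s)) (fst (snd s)))) (\<lambda>y. K2 (h (s, y)))" for s
  define e where "e s1 s2 = prob (J (s1, s2)) {(y, z). wrong1 (s1, s2) y \<or> wrong2 (s1, s2) y z}" for s1 s2
  have total: "prob (joint P1 (\<lambda>c. K2 (h c))) {((s, y), z). wrong1 s y \<or> wrong2 s y z} \<le> \<epsilon> + \<beta>"
  proof -
    have "prob (joint P1 (\<lambda>c. K2 (h c))) {((s, y), z). wrong1 s y \<or> wrong2 s y z}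
      \<le> prob (joint P1 (\<lambda>c. K2 (h c))) ({((s, y), z). wrong1 s y} \<union> {((s, y), z). wrong2 s y z})"
      by (rule prob_mono) auto
    also have "\<dots> \<le> prob (joint P1 (\<lambda>c. K2 (h c))) {((s, y), z). wrong1 s y}
      + prob (joint P1 (\<lambda>c. K2 (h c))) {((s, y), z). wrong2 s y z}"
      by (rule prob_Un_le)
    also have "prob (joint P1 (\<lambda>c. K2 (h c))) {((s, y), z). wrong1 s y} = prob P1 {(s, y). wrong1 s y}"
      by (rule prob_map_eq[where g = fst]) auto
    also have "\<dots> = prob (joint (pair_pmf (pmf_of_set A1) (pmf_of_set A2)) (\<lambda>a. memoryless W (xE (fst a) (snd a))))
      {((a1, a2), y). a1 \<noteq> g1 (map fst y) \<or> a2 \<noteq> g2 y}"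
    proof -
      have "map_pmf (\<lambda>s. (fst (fst s), fst (snd s))) U = pair_pmf (map_pmf fst (pmf_of_set S1)) (map_pmf fst (pmf_of_set S2))"
        using map_pair[of fst fst "pmf_of_set S1" "pmf_of_set S2"] by (simp add: U_def case_prod_unfold)
      also have "\<dots> = pair_pmf (pmf_of_set A1) (pmf_of_set A2)"
        using A L by (simp add: S1_def S2_def pmf_of_set_Times lessThan_empty_iff map_fst_pair_pmf)
      finally show ?thesis
        unfolding P1_def using prob_joint_map[of U "\<lambda>a. memoryless W (xE (fst a) (snd a))" "\<lambda>s. (fst (fst s), fst (snd s))"
          "\<lambda>a y. fst a \<noteq> g1 (map fst y) \<or> snd a \<noteq> g2 y"]
        by (simp add: wrong1_def case_prod_unfold)
    qed
    also note phase1
    also have "prob (joint P1 (\<lambda>c. K2 (h c))) {((s, y), z). wrong2 s y z} = prob (joint (map_pmf h P1) K2)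
       {((a, f, b), y). d1 f (map fst y) \<noteq> a \<or> d2 (map snd y) \<noteq> (a, f, b)}"
      by (rule prob_map_eq[OF joint_map]) (auto simp: h_def wrong2_def)
    also note err2[folded K2_def]
    finally show ?thesis by simp
  qed
  have "map_pmf (\<lambda>((s, y), z). (s, (y, z))) (joint P1 (\<lambda>c. K2 (h c))) = joint U J"
    by (simp add: P1_def J_def[abs_def] joint_def map_bind_pmf bind_map_pmf bind_assoc_pmf map_pmf_comp)
  then have "prob (joint P1 (\<lambda>c. K2 (h c))) {((s, y), z). wrong1 s y \<or> wrong2 s y z}
    = prob (joint U J) {(s, (y, z)). wrong1 s y \<or> wrong2 s y z}"
    by (rule prob_map_eq) auto
  also have "\<dots> = (\<Sum>s1\<in>S1. \<Sum>s2\<in>S2. e s1 s2) / (card S1 * card S2)"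
    unfolding U_def by (subst prob_uniform_pair[OF S]) (simp add: e_def case_prod_unfold)
  finally have "(\<Sum>s1\<in>S1. \<Sum>s2\<in>S2. e s1 s2) / (card S1 * card S2) \<le> \<epsilon> + \<beta>" using total by simp
  moreover have cpos: "real (card S1 * card S2) > 0" using S by (simp add: card_gt_0_iff)
  ultimately have avg: "(\<Sum>s1\<in>S1. \<Sum>s2\<in>S2. e s1 s2) \<le> card S1 * (card S2 * (\<epsilon> + \<beta>))"
    by (subst (asm) pos_divide_le_eq) (simp_all add: mult_ac)
  define N where "N = n1 + n2"
  define M1 where "M1 = messages N R1"
  define M2 where "M2 = messages N R2"
  have M: "finite M1" "M1 \<noteq> {}" "1 \<in> M1" "finite M2" "M2 \<noteq> {}" "1 \<in> M2"
    using R by (simp_all add: M1_def M2_def card_messages_ge(2) card_messages_ge(3)[simplified])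
  obtain S1' S2' where S': "S1' \<subseteq> S1" "card S1' = card M1" "S2' \<subseteq> S2" "card S2' = card M2"
    and avg': "(\<Sum>a\<in>S1'. \<Sum>b\<in>S2'. e a b) \<le> card M1 * (card M2 * (\<epsilon> + \<beta>))"
    by (rule subselect_product[OF S(1,3) _ _ avg, of "card M1" "card M2"])
       (use K cardS in \<open>auto simp: M1_def M2_def N_def\<close>)
  obtain \<sigma>1 where \<sigma>1: "bij_betw \<sigma>1 M1 S1'"
    using finite_same_card_bij[of M1 S1'] S' S M finite_subset by metis
  obtain \<sigma>2 where \<sigma>2: "bij_betw \<sigma>2 M2 S2'"
    using finite_same_card_bij[of M2 S2'] S' S M finite_subset by metis
  obtain \<iota> :: "'y1 \<Rightarrow> nat" where \<iota>: "bij_betw \<iota> UNIV {0..<CARD('y1)}"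
    using ex_bij_betw_finite_nat[of "UNIV :: 'y1 set"] by auto
  have inv_\<iota>: "inv \<iota> (\<iota> y) = y" for y using \<iota> by (simp add: bij_betw_def)
  \<comment> \<open>In the first phase symbol \<open>t\<close> names the latest output of Receiver
    1; later alphabets are singletons and cost nothing. Times start at 1 and list positions at 0,
    whence \<open>t - 1\<close>. Receiver 2 decodes the second phase first and zips the recovered
    \<open>f\<close> with its own first outputs to run \<open>g2\<close>. The default 1 keeps a
    failed decoder inside the message set.\<close>
  define c where "c = \<lparr>fb_alph = \<lambda>t. if t \<le> n1 then {0..<CARD('y1)} else {0},
    fb_enc = \<lambda>t ys. if t \<le> n1 then \<iota> (last ys) else 0,
    enc = \<lambda>t m1 m2 vs. if t \<le> n1 then xE (fst (\<sigma>1 m1)) (fst (\<sigma>2 m2)) ! (t - 1)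
       else x (snd (\<sigma>1 m1)) (map (inv \<iota>) (take n1 vs)) (snd (\<sigma>2 m2)) ! (t - 1 - n1),
    dec1 = \<lambda>ys. (let m = inv_into M1 \<sigma>1 (g1 (take n1 ys), d1 (take n1 ys) (drop n1 ys)) in if m \<in> M1 then m else 1),
    dec2 = \<lambda>ys. (let (a, f, b) = d2 (drop n1 ys); m = inv_into M2 \<sigma>2 (g2 (zip f (take n1 ys)), b) in if m \<in> M2 then m else 1)\<rparr>"
  have valid: "valid_code R_FB N R1 R2 c"
  proof -
    have "(\<Prod>t=1..N. card (fb_alph c t)) = (\<Prod>t=1..n1. CARD('y1))"
      by (rule prod.mono_neutral_cong_right) (auto simp: c_def N_def)
    then have "(\<Prod>t=1..N. card (fb_alph c t)) = CARD('y1) ^ n1" by simp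
    then show ?thesis
      using fb \<iota> M by (auto simp: valid_code_def c_def N_def[symmetric] M1_def[symmetric] M2_def[symmetric]
        Let_def bij_betw_def case_prod_unfold)
  qed
  have out: "outputs W c m1 m2 N = map_pmf (\<lambda>(y, z). y @ z) (J (\<sigma>1 m1, \<sigma>2 m2))" if m: "m1 \<in> M1" "m2 \<in> M2" for m1 m2
  proof -
    obtain a1 l1 where s1: "\<sigma>1 m1 = (a1, l1)" by (cases "\<sigma>1 m1")
    obtain a2 l2 where s2: "\<sigma>2 m2 = (a2, l2)" by (cases "\<sigma>2 m2")
    have "\<sigma>1 m1 \<in> S1" "\<sigma>2 m2 \<in> S2"
      using \<sigma>1 \<sigma>2 m S' by (auto simp: bij_betw_def)
    then have l: "l1 < L1" "l2 < L2" by (auto simp: s1 s2 S1_def S2_def)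
    have o1: "outputs W c m1 m2 t = memoryless W (take t (xE a1 a2))" if "t \<le> n1" for t
      using that
    proof (induction t)
      case (Suc t)
      then show ?case
        by (simp add: c_def s1 s2 take_Suc_conv_app_nth lenE memoryless_snoc joint_def map_bind_pmf map_pmf_comp)
    qed simp
    \<comment> \<open>The encoder recovers the first-phase outputs exactly, whatever feedback
      follows.\<close>
    have fbk: "map (inv \<iota>) (take n1 (feedback c (map fst (y @ z)))) = map fst y"
      if "length y = n1" for y :: "('y1 \<times> 'y2) list" and z
    proof (rule nth_equalityI)
      fix i assume "i < length (map (inv \<iota>) (take n1 (feedback c (map fst (y @ z)))))"
      then have i: "i < n1" by simp
      have "feedback c (map fst (y @ z)) ! i = \<iota> (last (take (Suc i) (map fst (y @ z))))"
        using i that by (simp add: feedback_def c_def del: upt_Suc)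
      also have "last (take (Suc i) (map fst (y @ z))) = map fst y ! i"
        using i that by (simp add: take_Suc_conv_app_nth nth_append)
      finally show "map (inv \<iota>) (take n1 (feedback c (map fst (y @ z)))) ! i = map fst y ! i"
        using i that by (simp add: inv_\<iota> feedback_def del: upt_Suc)
    qed (use that in \<open>simp add: feedback_def\<close>)
    have o2: "outputs W c m1 m2 (n1 + t) = map_pmf (\<lambda>(y, z). y @ z)
        (joint (memoryless W (xE a1 a2)) (\<lambda>y. memoryless W (take t (x l1 (map fst y) l2))))" if "t \<le> n2" for t
      using that
    proof (induction t)
      case 0
      then show ?case using o1[of n1] by (simp add: lenE joint_def map_bind_pmf map_pmf_comp bind_return_pmf')
    next
      case (Suc t)
      have leny: "length y = n1" if "y \<in> set_pmf (memoryless W (xE a1 a2))" for y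
        using length_memoryless[OF that] by (simp add: lenE)
      have "outputs W c m1 m2 (n1 + Suc t) = bind_pmf (memoryless W (xE a1 a2)) (\<lambda>y. bind_pmf (memoryless W (take t (x l1 (map fst y) l2)))
         (\<lambda>z. map_pmf (\<lambda>v. (y @ z) @ [v]) (W (enc c (Suc (n1 + t)) m1 m2 (feedback c (map fst (y @ z)))))))"
        using Suc by (simp add: joint_def bind_map_pmf bind_assoc_pmf map_bind_pmf)
      also have "\<dots> = bind_pmf (memoryless W (xE a1 a2)) (\<lambda>y. bind_pmf (memoryless W (take t (x l1 (map fst y) l2)))
         (\<lambda>z. map_pmf (\<lambda>v. (y @ z) @ [v]) (W (x l1 (map fst y) l2 ! t))))"
      proof (intro bind_pmf_cong refl)
        fix y z assume "y \<in> set_pmf (memoryless W (xE a1 a2))"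
        then have "enc c (Suc (n1 + t)) m1 m2 (feedback c (map fst (y @ z))) = x l1 (map fst y) l2 ! t"
          using fbk[OF leny, of y z] by (simp add: c_def s1 s2 del: map_append)
        then show "map_pmf (\<lambda>v. (y @ z) @ [v]) (W (enc c (Suc (n1 + t)) m1 m2 (feedback c (map fst (y @ z)))))
          = map_pmf (\<lambda>v. (y @ z) @ [v]) (W (x l1 (map fst y) l2 ! t))" by simp
      qed
      also have "\<dots> = map_pmf (\<lambda>(y, z). y @ z)
        (joint (memoryless W (xE a1 a2)) (\<lambda>y. memoryless W (take t (x l1 (map fst y) l2) @ [x l1 (map fst y) l2 ! t])))"
        by (simp add: memoryless_snoc joint_def map_bind_pmf bind_map_pmf bind_assoc_pmf map_pmf_comp)
      also have "\<dots> = map_pmf (\<lambda>(y, z). y @ z)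
        (joint (memoryless W (xE a1 a2)) (\<lambda>y. memoryless W (take (Suc t) (x l1 (map fst y) l2))))"
        using Suc.prems l unfolding joint_def
        by (intro arg_cong[where f = "map_pmf _"] bind_pmf_cong refl) (simp add: take_Suc_conv_app_nth len leny)
      finally show ?case .
    qed
    have "outputs W c m1 m2 N = map_pmf (\<lambda>(y, z). y @ z)
      (joint (memoryless W (xE a1 a2)) (\<lambda>y. memoryless W (take n2 (x l1 (map fst y) l2))))"
      using o2[of n2] by (simp add: N_def)
    also have "joint (memoryless W (xE a1 a2)) (\<lambda>y. memoryless W (take n2 (x l1 (map fst y) l2))) = J (\<sigma>1 m1, \<sigma>2 m2)"
      unfolding J_def joint_def K2_def h_def s1 s2 fst_conv snd_conv prod.case
      using l by (intro bind_pmf_cong refl) (auto simp: len lenE dest!: length_memoryless)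
    finally show ?thesis .
  qed
  have err: "prob (outputs W c m1 m2 N) {y. m1 \<noteq> dec1 c (map fst y) \<or> m2 \<noteq> dec2 c (map snd y)} \<le> e (\<sigma>1 m1) (\<sigma>2 m2)"
    if m: "m1 \<in> M1" "m2 \<in> M2" for m1 m2
  proof -
    have ok: "m1 = dec1 c (map fst (y @ z)) \<and> m2 = dec2 c (map snd (y @ z))"
      if "length y = n1" "\<not> wrong1 (\<sigma>1 m1, \<sigma>2 m2) y" "\<not> wrong2 (\<sigma>1 m1, \<sigma>2 m2) y z" for y z
    proof -
      have "inv_into M1 \<sigma>1 (\<sigma>1 m1) = m1" "inv_into M2 \<sigma>2 (\<sigma>2 m2) = m2"
        using \<sigma>1 \<sigma>2 m by (auto simp: bij_betw_def)
      moreover have "(g1 (map fst y), d1 (map fst y) (map fst z)) = \<sigma>1 m1" "(g2 y, snd (\<sigma>2 m2)) = \<sigma>2 m2"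
        "d2 (map snd z) = (snd (\<sigma>1 m1), map fst y, snd (\<sigma>2 m2))"
        using that by (auto simp: wrong1_def wrong2_def prod_eq_iff)
      ultimately show ?thesis
        using that m by (simp add: c_def Let_def zip_map_fst_snd)
    qed
    have leny: "length y = n1" if "(y, z) \<in> set_pmf (J s)" for y z s
      using that by (auto simp: J_def lenE dest!: length_memoryless)
    show ?thesis
      unfolding out[OF m] e_def measure_map_pmf
    proof (rule prob_mono)
      fix v assume v: "v \<in> set_pmf (J (\<sigma>1 m1, \<sigma>2 m2))"
        "v \<in> (\<lambda>(y, z). y @ z) -` {y. m1 \<noteq> dec1 c (map fst y) \<or> m2 \<noteq> dec2 c (map snd y)}"
      obtain y z where yz: "v = (y, z)" by (cases v)
      have "m1 \<noteq> dec1 c (map fst (y @ z)) \<or> m2 \<noteq> dec2 c (map snd (y @ z))"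
        using v(2) unfolding yz by simp
      with ok[OF leny] v(1) show "v \<in> {(y, z). wrong1 (\<sigma>1 m1, \<sigma>2 m2) y \<or> wrong2 (\<sigma>1 m1, \<sigma>2 m2) y z}"
        unfolding yz by blast
    qed
  qed
  have "error_prob W N R1 R2 c = (\<Sum>m1\<in>M1. \<Sum>m2\<in>M2. prob (outputs W c m1 m2 N)
      {y. m1 \<noteq> dec1 c (map fst y) \<or> m2 \<noteq> dec2 c (map snd y)}) / (card M1 * card M2)"
    unfolding error_prob_def messages_outputs_joint M1_def[symmetric] M2_def[symmetric]
    by (subst prob_uniform_pair[OF M(1,2,4,5)]) simp
  also have "\<dots> \<le> (\<Sum>m1\<in>M1. \<Sum>m2\<in>M2. e (\<sigma>1 m1) (\<sigma>2 m2)) / (card M1 * card M2)"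
    by (intro divide_right_mono sum_mono err) auto
  also have "(\<Sum>m1\<in>M1. \<Sum>m2\<in>M2. e (\<sigma>1 m1) (\<sigma>2 m2)) = (\<Sum>a\<in>S1'. \<Sum>b\<in>S2'. e a b)"
    by (simp only: sum.reindex_bij_betw[OF \<sigma>2] sum.reindex_bij_betw[OF \<sigma>1, of "\<lambda>a. \<Sum>b\<in>S2'. e a b"])
  also have "\<dots> / (card M1 * card M2) \<le> card M1 * (card M2 * (\<epsilon> + \<beta>)) / (card M1 * card M2)"
    by (intro divide_right_mono avg') auto
  also have "\<dots> = \<epsilon> + \<beta>" using M by (simp add: card_gt_0_iff)
  finally show ?thesis using valid by (auto simp: N_def)
qed

section \<open>Rates of two-phase codes\<close>

lemma two_powr_mono: "a \<le> b \<Longrightarrow> (2::real) powr a \<le> 2 powr b"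
  by (rule powr_mono) auto

text \<open>The factor 2 makes up for the rounding in \<open>messages n1 p\<close>, which may halve
  its size.\<close>

lemma card_messages_product:
  assumes "p \<ge> 0" "real N * R \<le> real n1 * p + real n2 * c"
  shows "card (messages N R) \<le> card (messages n1 p) * (2 * nat \<lceil>2 powr (real n2 * c)\<rceil>)"
proof -
  have "real (card (messages N R)) \<le> 2 powr (real n1 * p + real n2 * c)"
    using card_messages[of N R] two_powr_mono[OF assms(2)] by linarith
  also have "\<dots> = 2 powr (real n1 * p) / 2 * (2 * 2 powr (real n2 * c))"
    by (simp add: powr_add)
  also have "\<dots> \<le> card (messages n1 p) * (2 * real (nat \<lceil>2 powr (real n2 * c)\<rceil>))"
    by (intro mult_mono card_messages_ge assms) (auto intro: order_trans[OF le_of_int_ceiling])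
  finally have "real (card (messages N R)) \<le> real (card (messages n1 p) * (2 * nat \<lceil>2 powr (real n2 * c)\<rceil>))"
    by simp
  then show ?thesis by (simp only: of_nat_le_iff)
qed

lemma two_nat_ceiling_le:
  assumes "c \<ge> 0"
  shows "real (2 * nat \<lceil>2 powr (real n * c)\<rceil>) \<le> 4 * 2 powr (real n * c)"
proof -
  have "2 powr (real n * c) \<ge> (1::real)" using assms by (simp add: ge_one_powr_ge_zero)
  moreover have "real (nat \<lceil>2 powr (real n * c)\<rceil>) \<le> 2 powr (real n * c) + 1"
    using of_int_ceiling_le_add_one[of "2 powr (real n * c)"] by simp
  ultimately show ?thesis unfolding of_nat_mult of_nat_numeral by linarith
qed

lemma power_eq_powr: "real k ^ n = 2 powr (real n * log 2 (real k))" if "k > 0"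
proof -
  have "2 powr (real n * log 2 (real k)) = (2 powr log 2 (real k)) powr real n"
    by (simp add: powr_powr mult.commute)
  then show ?thesis using that by (simp add: powr_realpow)
qed

text \<open>Here \<open>c1\<close> and \<open>c2\<close> are the second-phase rates of the two
  messages. The fed-back outputs, spread over the second phase, add
  \<open>\<gamma> / (1 - \<gamma>) * log 2 CARD('y1)\<close> at Receiver 2 only.
  \<open>\<tau>\<close> bounds the fraction of first-phase times from below, since rounding may keep
  it under \<open>\<gamma>\<close>. In \<open>2 * \<delta>\<close> one \<open>\<delta>\<close> is
  lost in the tests and the other gives exponential decay. The case \<open>c2 = 0\<close> is
  separate because \<open>I(X;Y2|U)\<close> may be 0.\<close>

lemma achievable_two_phase:
  fixes W :: "('x::finite, 'y1::finite, 'y2::finite) dmbc"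
  assumes fin: "finite (set_pmf \<mu>)" and \<delta>: "\<delta> > 0" and \<gamma>: "0 \<le> \<gamma>" "\<gamma> < 1"
    and nonneg: "p1 \<ge> 0" "p2 \<ge> 0" "c1 \<ge> 0" "c2 \<ge> 0" "R1 \<ge> 0" "R2 \<ge> 0" "R_FB \<ge> 0"
    and phase1: "\<And>\<epsilon>. \<epsilon> > 0 \<Longrightarrow> \<forall>\<^sub>F N in sequentially. \<exists>xE g1 g2. (\<forall>a1 a2. length (xE a1 a2) = nat \<lfloor>\<gamma> * real N\<rfloor>) \<and>
      prob (joint (pair_pmf (pmf_of_set (messages (nat \<lfloor>\<gamma> * real N\<rfloor>) p1)) (pmf_of_set (messages (nat \<lfloor>\<gamma> * real N\<rfloor>) p2)))
        (\<lambda>a. memoryless W (xE (fst a) (snd a)))) {((a1, a2), y). a1 \<noteq> g1 (map fst y) \<or> a2 \<noteq> g2 y} \<le> \<epsilon>"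
    and \<tau>: "\<forall>\<^sub>F N in sequentially. \<tau> * real N \<le> real (nat \<lfloor>\<gamma> * real N\<rfloor>)"
    and R: "R1 \<le> \<tau> * p1 + (1 - \<gamma>) * c1" "R2 \<le> \<tau> * p2 + (1 - \<gamma>) * c2"
    and c: "c1 + 2 * \<delta> \<le> I_U (out1 W) \<mu>"
      "c1 + \<gamma> / (1 - \<gamma>) * log 2 CARD('y1) + c2 + 2 * \<delta> \<le> I_U (out2 W) \<mu> + I_X (out2 W) \<mu>"
      "c2 = 0 \<or> c2 + 2 * \<delta> \<le> I_X (out2 W) \<mu>"
    and fb: "\<gamma> * log 2 CARD('y1) \<le> R_FB"
  shows "achievable W R_FB R1 R2"
proof (rule achievableI)
  fix \<epsilon> :: real assume \<epsilon>: "\<epsilon> > 0"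
  define I1 where "I1 = I_U (out1 W) \<mu>"
  define I2 where "I2 = I_U (out2 W) \<mu> + I_X (out2 W) \<mu>"
  define I3 where "I3 = I_X (out2 W) \<mu>"
  define lC where "lC = log 2 (real CARD('y1))"
  have lC: "lC \<ge> 0" unfolding lC_def by (simp add: Suc_le_eq)
  obtain v :: real where v: "\<And>n (A :: nat set) (F :: 'y1 list set) (B :: nat set) Q. n > 0 \<Longrightarrow> finite A \<Longrightarrow> finite F \<Longrightarrow> finite B \<Longrightarrow>
    set_pmf Q \<subseteq> A \<times> F \<times> B \<Longrightarrow>
    \<exists>x d1 d2. (\<forall>a\<in>A. \<forall>f\<in>F. \<forall>b\<in>B. length (x a f b) = n) \<and>
      prob (joint Q (\<lambda>(a, f, b). memoryless W (x a f b))) {((a, f, b), y). d1 f (map fst y) \<noteq> a \<or> d2 (map snd y) \<noteq> (a, f, b)}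
      \<le> v / n + card A * 2 powr - (n * (I1 - \<delta>)) + card A * card F * card B * 2 powr - (n * (I2 - \<delta>))
        + (real (card B) - 1) * 2 powr - (n * (I3 - \<delta>))"
    unfolding I1_def I2_def I3_def by (rule superposition_coding[OF fin \<delta>]) blast
  define E where "E N = 2 powr (- ((1 - \<gamma>) * \<delta> * real N))" for N
  \<comment> \<open>\<open>24 = 4 + 16 + 4\<close>: rounding makes each of \<open>L1\<close> and
    \<open>L2\<close> up to 4 times its nominal size, and both enter the middle term.\<close>
  define \<beta> where "\<beta> N = \<bar>v\<bar> / ((1 - \<gamma>) * real N) + 24 * E N" for N
  have "1 - \<gamma> > 0" using \<gamma> by simp
  then have "\<beta> \<longlonglongrightarrow> 0"
    unfolding \<beta>_def E_def using \<delta> by real_asymp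
  then have ev\<beta>: "\<forall>\<^sub>F N in sequentially. \<beta> N < \<epsilon> / 2"
    using \<epsilon> by (intro order_tendstoD) auto
  have "\<epsilon> / 2 > 0" using \<epsilon> by simp
  from phase1[OF this] \<tau> ev\<beta> eventually_gt_at_top[of 0]
  show "\<forall>\<^sub>F N in sequentially. \<exists>c. valid_code R_FB N R1 R2 c \<and> error_prob W N R1 R2 c \<le> \<epsilon>"
  proof eventually_elim
    case (elim N)
    define n1 where "n1 = nat \<lfloor>\<gamma> * real N\<rfloor>"
    have n1_le: "real n1 \<le> \<gamma> * real N" using \<gamma> by (simp add: n1_def)
    also have "\<dots> \<le> real N" using \<gamma> by (simp add: mult_left_le_one_le)
    finally have "n1 \<le> N" by simp
    define n2 where "n2 = N - n1"
    have N: "N = n1 + n2" using \<open>n1 \<le> N\<close> by (simp add: n2_def)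
    have n2_ge: "real n2 \<ge> (1 - \<gamma>) * real N" using n1_le N by (simp add: algebra_simps)
    have Npos: "(1 - \<gamma>) * real N > 0" using \<gamma> elim by simp
    then have n2: "n2 > 0" using n2_ge by (metis less_le_trans of_nat_0_less_iff)
    obtain xE g1 g2 where lenE: "\<And>a1 a2. length (xE a1 a2) = n1" and
      err1: "prob (joint (pair_pmf (pmf_of_set (messages n1 p1)) (pmf_of_set (messages n1 p2)))
        (\<lambda>a. memoryless W (xE (fst a) (snd a)))) {((a1, a2), y). a1 \<noteq> g1 (map fst y) \<or> a2 \<noteq> g2 y} \<le> \<epsilon> / 2"
      using elim(1) unfolding n1_def by blast
    define L1 where "L1 = 2 * nat \<lceil>2 powr (real n2 * c1)\<rceil>"
    \<comment> \<open>At rate 0 there is a single satellite, not the 2 that the formula would give,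
      so no wrong satellite exists.\<close>
    define L2 where "L2 = (if c2 = 0 then 1 else 2 * nat \<lceil>2 powr (real n2 * c2)\<rceil>)"
    have Lpos: "L1 > 0" "L2 > 0" by (auto simp: L1_def L2_def)
    have L1: "real L1 \<le> 4 * 2 powr (real n2 * c1)"
      unfolding L1_def by (rule two_nat_ceiling_le[OF nonneg(3)])
    have L2: "real L2 \<le> 4 * 2 powr (real n2 * c2)"
      using two_nat_ceiling_le[OF nonneg(4), of n2] by (simp add: L2_def)
    have rate: "real N * R \<le> real n1 * p + real n2 * c" if "R \<le> \<tau> * p + (1 - \<gamma>) * c" "p \<ge> 0" "c \<ge> 0" for R p c
    proof -
      have "real N * R \<le> real N * (\<tau> * p + (1 - \<gamma>) * c)" using that by (intro mult_left_mono) auto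
      also have "\<dots> = (\<tau> * real N) * p + ((1 - \<gamma>) * real N) * c" by (simp add: algebra_simps)
      also have "\<dots> \<le> real n1 * p + real n2 * c"
        using elim(2) n2_ge that by (intro add_mono mult_right_mono) (auto simp: n1_def)
      finally show ?thesis .
    qed
    have K1: "card (messages N R1) \<le> card (messages n1 p1) * L1"
      unfolding L1_def by (rule card_messages_product[OF nonneg(1) rate[OF R(1) nonneg(1,3)]])
    have K2: "card (messages N R2) \<le> card (messages n1 p2) * L2"
    proof (cases "c2 = 0")
      case True
      then have "2 powr (real N * R2) \<le> 2 powr (real n1 * p2)"
        using rate[OF R(2) nonneg(2,4)] by (intro two_powr_mono) simp
      then show ?thesis using True by (simp add: messages_def L2_def nat_mono floor_mono)
    next
      case False
      then show ?thesis using card_messages_product[OF nonneg(2) rate[OF R(2) nonneg(2,4)]] by (simp add: L2_def)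
    qed
    define F where "F = {f :: 'y1 list. length f = n1}"
    have F: "finite F" "real (card F) = 2 powr (real n1 * lC)"
      using finite_lists_length_eq[of "UNIV :: 'y1 set" n1] card_lists_length_eq[of "UNIV :: 'y1 set" n1]
      by (simp_all add: F_def power_eq_powr lC_def)
    have fbn: "real CARD('y1) ^ n1 \<le> 2 powr (real (n1 + n2) * R_FB)"
    proof -
      have "real n1 * lC \<le> \<gamma> * real N * lC" using n1_le lC by (intro mult_right_mono)
      also have "\<dots> \<le> real N * R_FB" using mult_left_mono[OF fb, of "real N"] by (simp add: lC_def algebra_simps)
      finally show ?thesis using N by (simp add: power_eq_powr lC_def two_powr_mono)
    qed
    have E: "2 powr (- (real n2 * \<delta>)) \<le> E N"
      unfolding E_def using mult_right_mono[OF n2_ge less_imp_le[OF \<delta>]] by (intro two_powr_mono) (simp add: algebra_simps)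
    have bound: "v / n2 + L1 * 2 powr - (n2 * (I1 - \<delta>)) + L1 * card F * L2 * 2 powr - (n2 * (I2 - \<delta>))
        + (real L2 - 1) * 2 powr - (n2 * (I3 - \<delta>)) \<le> \<beta> N"
    proof -
      have "v / n2 \<le> \<bar>v\<bar> / n2" by (intro divide_right_mono) auto
      also have "\<dots> \<le> \<bar>v\<bar> / ((1 - \<gamma>) * real N)" using n2_ge Npos by (intro divide_left_mono) auto
      finally have 0: "v / n2 \<le> \<bar>v\<bar> / ((1 - \<gamma>) * real N)" .
      have "real L1 * 2 powr - (n2 * (I1 - \<delta>)) \<le> 4 * 2 powr (real n2 * c1) * 2 powr - (n2 * (I1 - \<delta>))"
        by (intro mult_right_mono L1) auto
      also have "\<dots> = 4 * 2 powr (real n2 * (c1 - I1 + \<delta>))"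
        by (simp add: powr_add[symmetric] algebra_simps)
      also have "\<dots> \<le> 4 * 2 powr (- (real n2 * \<delta>))"
        using c(1) mult_left_mono[of "c1 - I1 + \<delta>" "- \<delta>" "real n2"] by (simp add: I1_def)
      finally have 1: "real L1 * 2 powr - (n2 * (I1 - \<delta>)) \<le> 4 * E N" using E by linarith
      have n1n2: "real n1 * lC \<le> real n2 * (\<gamma> / (1 - \<gamma>) * lC)"
      proof -
        have "real n1 \<le> \<gamma> / (1 - \<gamma>) * ((1 - \<gamma>) * real N)" using n1_le \<gamma> by simp
        also have "\<dots> \<le> \<gamma> / (1 - \<gamma>) * real n2" using \<gamma> n2_ge by (intro mult_left_mono) auto
        finally show ?thesis using lC mult_right_mono by (fastforce simp: mult_ac)
      qed
      have "real L1 * card F * L2 * 2 powr - (n2 * (I2 - \<delta>)) \<le>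
        (4 * 2 powr (real n2 * c1)) * 2 powr (real n2 * (\<gamma> / (1 - \<gamma>) * lC)) * (4 * 2 powr (real n2 * c2)) * 2 powr - (n2 * (I2 - \<delta>))"
        using F(2) two_powr_mono[OF n1n2] by (intro mult_mono L1 L2) auto
      also have "\<dots> = 16 * 2 powr (real n2 * (c1 + \<gamma> / (1 - \<gamma>) * lC + c2 - I2 + \<delta>))"
        by (simp add: powr_add[symmetric] algebra_simps)
      also have "\<dots> \<le> 16 * 2 powr (- (real n2 * \<delta>))"
        using c(2) mult_left_mono[of "c1 + \<gamma> / (1 - \<gamma>) * lC + c2 - I2 + \<delta>" "- \<delta>" "real n2"]
        by (simp add: I2_def lC_def)
      finally have 2: "real L1 * card F * L2 * 2 powr - (n2 * (I2 - \<delta>)) \<le> 16 * E N" using E by linarith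
      have 3: "(real L2 - 1) * 2 powr - (n2 * (I3 - \<delta>)) \<le> 4 * E N"
      proof (cases "c2 = 0")
        case True
        then show ?thesis by (simp add: L2_def E_def)
      next
        case False
        have "(real L2 - 1) * 2 powr - (n2 * (I3 - \<delta>)) \<le> 4 * 2 powr (real n2 * c2) * 2 powr - (n2 * (I3 - \<delta>))"
          using L2 by (intro mult_right_mono) auto
        also have "\<dots> = 4 * 2 powr (real n2 * (c2 - I3 + \<delta>))"
          by (simp add: powr_add[symmetric] algebra_simps)
        also have "\<dots> \<le> 4 * 2 powr (- (real n2 * \<delta>))"
          using c(3) False mult_left_mono[of "c2 - I3 + \<delta>" "- \<delta>" "real n2"] by (simp add: I3_def)
        finally show ?thesis using E by linarith
      qed
      show ?thesis using 0 1 2 3 unfolding \<beta>_def of_nat_mult by linarith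
    qed
    have "\<exists>c. valid_code R_FB (n1 + n2) R1 R2 c \<and> error_prob W (n1 + n2) R1 R2 c \<le> \<epsilon> / 2 + \<beta> N"
    proof (rule two_phase_code[OF nonneg(5,6) _ _ _ _ Lpos lenE err1 _ _ _ fbn])
      fix Q assume Q: "set_pmf Q \<subseteq> {..<L1} \<times> {f :: 'y1 list. length f = n1} \<times> {..<L2}"
      from v[OF n2 _ F(1) _ Q[folded F_def]] bound
      show "\<exists>x d1 d2. (\<forall>a\<in>{..<L1}. \<forall>f\<in>{f :: 'y1 list. length f = n1}. \<forall>b\<in>{..<L2}. length (x a f b) = n2) \<and>
        prob (joint Q (\<lambda>(a, f, b). memoryless W (x a f b))) {((a, f, b), y). d1 f (map fst y) \<noteq> a \<or> d2 (map snd y) \<noteq> (a, f, b)} \<le> \<beta> N"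
        unfolding F_def[symmetric] by (simp only: card_lessThan finite_lessThan simp_thms) (meson order_trans)
    qed (use K1 K2 N nonneg in \<open>auto simp: card_messages_ge(2)\<close>)
    then show ?case using elim(3) N by (auto intro: order_trans)
  qed
qed (use nonneg in auto)

text \<open>The enhanced channel is the original one with outputs relabelled, so its code runs on
  \<open>W\<close> with the same inputs, and only \<open>g2\<close> reads both outputs. Zero
  feedback rate makes the inputs a function \<open>xE\<close> of the messages.\<close>

lemma enhanced_phase:
  fixes W :: "('x::finite, 'y1::finite, 'y2::finite) dmbc"
  assumes ach: "achievable (enhanced W) 0 p1 p2" and \<gamma>: "\<gamma> > 0" and \<epsilon>: "\<epsilon> > 0"
  shows "\<forall>\<^sub>F N in sequentially. \<exists>xE g1 g2. (\<forall>a1 a2. length (xE a1 a2) = nat \<lfloor>\<gamma> * real N\<rfloor>) \<and>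
      prob (joint (pair_pmf (pmf_of_set (messages (nat \<lfloor>\<gamma> * real N\<rfloor>) p1)) (pmf_of_set (messages (nat \<lfloor>\<gamma> * real N\<rfloor>) p2)))
        (\<lambda>a. memoryless W (xE (fst a) (snd a)))) {((a1, a2), y). a1 \<noteq> g1 (map fst y) \<or> a2 \<noteq> g2 y} \<le> \<epsilon>"
proof -
  obtain c :: "nat \<Rightarrow> ('x, 'y1, 'y1 \<times> 'y2) fb_code" where
    v: "\<And>n. n \<ge> 1 \<Longrightarrow> valid_code 0 n p1 p2 (c n)" and
    lim: "(\<lambda>n. error_prob (enhanced W) n p1 p2 (c n)) \<longlonglongrightarrow> 0"
    using ach by (auto simp: achievable_def)
  have "\<forall>\<^sub>F n in sequentially. error_prob (enhanced W) n p1 p2 (c n) < \<epsilon> \<and> n \<ge> 1"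
    using order_tendstoD(2)[OF lim \<epsilon>] eventually_ge_at_top by (rule eventually_conj)
  moreover have "filterlim (\<lambda>N. nat \<lfloor>\<gamma> * real N\<rfloor>) at_top sequentially"
    using \<gamma> by real_asymp
  ultimately have "\<forall>\<^sub>F N in sequentially. error_prob (enhanced W) (nat \<lfloor>\<gamma> * real N\<rfloor>) p1 p2 (c (nat \<lfloor>\<gamma> * real N\<rfloor>)) < \<epsilon>
     \<and> nat \<lfloor>\<gamma> * real N\<rfloor> \<ge> 1"
    by (rule eventually_compose_filterlim)
  then show ?thesis
  proof eventually_elim
    case (elim N)
    define n where "n = nat \<lfloor>\<gamma> * real N\<rfloor>"
    have n: "n \<ge> 1" and err: "error_prob (enhanced W) n p1 p2 (c n) < \<epsilon>" using elim by (simp_all add: n_def)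
    let ?U = "pair_pmf (pmf_of_set (messages n p1)) (pmf_of_set (messages n p2))"
    let ?xE = "nofb_input (c n) n"
    let ?h = "\<lambda>(y1, y2). (y1, (y1, y2))"
    have "memoryless (enhanced W) xs = map_pmf (map ?h) (memoryless W xs)" for xs
      by (simp add: map_memoryless enhanced_def[abs_def])
    then have "messages_outputs (enhanced W) n p1 p2 (c n) =
        map_pmf (\<lambda>(m, y). (m, map ?h y)) (joint ?U (\<lambda>m. memoryless W (?xE (fst m) (snd m))))"
      unfolding messages_outputs_joint by (simp add: outputs_nofb[OF v[OF n]] joint_map_snd)
    then have "prob (joint ?U (\<lambda>m. memoryless W (?xE (fst m) (snd m)))) {((a1, a2), y). a1 \<noteq> dec1 (c n) (map fst y) \<or> a2 \<noteq> dec2 (c n) y}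
      = error_prob (enhanced W) n p1 p2 (c n)"
      unfolding error_prob_def
      by (intro prob_map_eq[where g = "\<lambda>(m, y). (m, map ?h y)"]) (auto simp: comp_def case_prod_unfold)
    then show ?case
      using err unfolding n_def[symmetric]
      by (intro exI[of _ ?xE] exI[of _ "dec1 (c n)"] exI[of _ "dec2 (c n)"]) (auto simp: nofb_input_def)
  qed
qed

subsection \<open>Capacity regions of strictly less-noisy channels\<close>

lemma C_FB_nonneg: "(a, b) \<in> C_FB W r \<Longrightarrow> a \<ge> 0 \<and> b \<ge> 0"
proof -
  assume ab: "(a, b) \<in> C_FB W r"
  have "closed ({0..} \<times> {0..} :: (real \<times> real) set)" by (intro closed_Times closed_atLeast)
  then have "C_FB W r \<subseteq> {0..} \<times> {0..}"
    unfolding C_FB_def by (intro closure_minimal) (auto simp: achievable_def)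
  then show ?thesis using ab by auto
qed

lemma C_NoFB_subset:
  assumes "R_FB \<ge> 0"
  shows "C_NoFB W \<subseteq> C_FB W R_FB"
proof -
  have "valid_code R_FB N R1 R2 c" if "valid_code 0 N R1 R2 c" for N R1 R2 and c :: "('a, 'b, 'c) fb_code"
    using that assms two_powr_mono[of 0 "real N * R_FB"] by (auto simp: valid_code_def intro: order_trans)
  then have "achievable W R_FB a b" if "achievable W 0 a b" for a b
    using that unfolding achievable_def by meson
  then show ?thesis
    unfolding C_NoFB_def C_FB_def by (intro closure_mono) auto
qed

lemma time_sharing_with_enhanced:
  fixes W :: "('x::finite, 'y1::finite, 'y2::finite) dmbc"
  assumes sln: "strictly_less_noisy W" and R_FB: "R_FB > 0" and R: "(R1, R2) \<in> C_NoFB W" "R1 > 0"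
  obtains \<gamma> where "0 < \<gamma>" "\<gamma> < 1"
    "\<And>P1 P2. (P1, P2) \<in> C_Enh W \<Longrightarrow> (\<gamma> * P1 + (1 - \<gamma>) * R1, \<gamma> * P2 + (1 - \<gamma>) * R2) \<in> C_FB W R_FB"
proof -
  have R2: "R2 \<ge> 0" using C_FB_nonneg R(1) by (auto simp: C_NoFB_def)
  \<comment> \<open>The level \<open>R1 / 2\<close> suffices: the laws below have
    \<open>I(U;Y1) \<ge> R1 - \<delta>\<close> with \<open>\<delta> \<le> R1 / 8\<close>.\<close>
  obtain \<kappa> where \<kappa>: "\<kappa> > 0" "\<And>\<mu>. finite (set_pmf \<mu>) \<Longrightarrow> I_U (out1 W) \<mu> \<ge> R1 / 2 \<Longrightarrow>
      I_U (out2 W) \<mu> \<ge> I_U (out1 W) \<mu> + \<kappa>"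
    by (rule uniform_gap[OF sln, of "R1 / 2"]) (use R in auto)
  define lC where "lC = log 2 (real CARD('y1))"
  have lC: "lC \<ge> 0" unfolding lC_def by (simp add: Suc_le_eq)
  \<comment> \<open>The second bound serves the feedback rate and the slack; the \<open>+ 1\<close>
    avoids division by 0 if \<open>Y1\<close> has one letter. By \<open>\<gamma> \<le> 1/2\<close>,
    passing to the rate per second-phase use at most doubles the cost.\<close>
  define \<gamma> where "\<gamma> = min (1/2) (min R_FB (\<kappa> / 4) / (lC + 1))"
  have "0 < \<gamma>" using R_FB \<kappa>(1) lC by (simp add: \<gamma>_def)
  moreover have "\<gamma> \<le> 1/2" unfolding \<gamma>_def by (rule min.cobounded1)
  ultimately have \<gamma>: "0 < \<gamma>" "\<gamma> \<le> 1/2" .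
  have "\<gamma> * lC \<le> \<gamma> * (lC + 1)" using \<gamma> by simp
  also have "\<dots> \<le> min R_FB (\<kappa> / 4) / (lC + 1) * (lC + 1)"
    using lC by (intro mult_right_mono) (auto simp: \<gamma>_def)
  also have "\<dots> = min R_FB (\<kappa> / 4)" using lC by simp
  finally have \<gamma>lC: "\<gamma> * lC \<le> R_FB" "\<gamma> * lC \<le> \<kappa> / 4" by auto
  have \<gamma>lC': "\<gamma> / (1 - \<gamma>) * lC \<le> \<kappa> / 2"
  proof -
    have "\<gamma> / (1 - \<gamma>) * lC = (\<gamma> * lC) / (1 - \<gamma>)" by simp
    also have "\<dots> \<le> (\<gamma> * lC) / (1/2)" using \<gamma> lC by (intro divide_left_mono) auto
    also have "\<dots> \<le> \<kappa> / 2" using \<gamma>lC by simp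
    finally show ?thesis .
  qed
  show thesis
  proof (rule that[of \<gamma>])
    fix P1 P2 assume P: "(P1, P2) \<in> C_Enh W"
    have P0: "P1 \<ge> 0" "P2 \<ge> 0" using C_FB_nonneg P by (auto simp: C_Enh_def C_NoFB_def)
    show "(\<gamma> * P1 + (1 - \<gamma>) * R1, \<gamma> * P2 + (1 - \<gamma>) * R2) \<in> C_FB W R_FB"
      unfolding C_FB_def closure_approachable
    proof (intro allI impI)
      fix \<eta> :: real assume \<eta>: "\<eta> > 0"
      \<comment> \<open>Dominates \<open>q + 3\<close> for either rate \<open>q\<close> of the
        enhanced code, as \<open>q\<close> exceeds \<open>P1 + P2\<close> by less than 1.\<close>
      define D where "D = P1 + P2 + 5"
      have D: "D > 0" using P0 by (simp add: D_def)
      \<comment> \<open>The three bounds make the final rates \<open>\<eta>\<close>-close, keep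
        \<open>\<gamma> - \<delta>\<close> positive and keep \<open>c1\<close> positive.\<close>
      define \<delta> where "\<delta> = min (\<eta> / (8 * D)) (min (\<gamma> / 2) (R1 / 8))"
      have \<delta>: "\<delta> > 0" "\<delta> \<le> \<gamma> / 2" "\<delta> \<le> R1 / 8" using \<eta> D \<gamma> R by (auto simp: \<delta>_def)
      have "\<delta> * D \<le> \<eta> / (8 * D) * D" using D by (intro mult_right_mono) (auto simp: \<delta>_def)
      then have \<delta>D: "\<delta> * D \<le> \<eta> / 8" using D by simp
      obtain p1 p2 where p: "achievable (enhanced W) 0 p1 p2" "\<bar>p1 - P1\<bar> < min 1 (\<eta> / 8)" "\<bar>p2 - P2\<bar> < min 1 (\<eta> / 8)"
        by (rule closure_approx[OF P[unfolded C_Enh_def C_NoFB_def C_FB_def], of "min 1 (\<eta> / 8)"]) (use \<eta> in auto)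
      have p0: "p1 \<ge> 0" "p2 \<ge> 0" using p(1) by (auto simp: achievable_def)
      obtain \<mu> where \<mu>: "finite (set_pmf \<mu>)" "I_U (out1 W) \<mu> \<ge> R1 - \<delta>" "I_X (out2 W) \<mu> \<ge> R2 - \<delta>"
        by (rule converse_NoFB[OF strictly_less_noisyD(1)[OF sln] R(1) \<delta>(1)])
      have gap: "I_U (out2 W) \<mu> \<ge> I_U (out1 W) \<mu> + \<kappa>"
        using \<mu>(2) \<delta>(3) R(2) by (intro \<kappa>(2) \<mu>(1)) linarith
      have IX: "I_X (out2 W) \<mu> \<ge> 0" by (rule I_X_nonneg[OF \<mu>(1)])
      \<comment> \<open>One \<open>\<delta>\<close> pays for the converse and two for the code.
        \<open>c2\<close> is truncated because \<open>R2\<close> may be smaller than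
        \<open>3 * \<delta>\<close>.\<close>
      define c1 where "c1 = R1 - 3 * \<delta>"
      define c2 where "c2 = max 0 (R2 - 3 * \<delta>)"
      have c0: "c1 \<ge> 0" "c2 \<ge> 0" using \<delta> R by (auto simp: c1_def c2_def)
      have c2_le: "c2 \<le> I_X (out2 W) \<mu>" using IX \<mu>(3) \<delta>(1) by (simp add: c2_def)
      have \<tau>: "\<forall>\<^sub>F N in sequentially. (\<gamma> - \<delta>) * real N \<le> real (nat \<lfloor>\<gamma> * real N\<rfloor>)"
      proof (rule eventually_mono[OF eventually_ge_at_top[of "nat \<lceil>1 / \<delta>\<rceil>"]])
        fix N assume "nat \<lceil>1 / \<delta>\<rceil> \<le> N"
        then have "1 / \<delta> \<le> real N" by linarith
        then have "1 \<le> \<delta> * real N" using \<delta> by (simp add: field_simps)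
        then have "(\<gamma> - \<delta>) * real N \<le> \<gamma> * real N - 1" by (simp add: algebra_simps)
        also have "\<dots> \<le> real (nat \<lfloor>\<gamma> * real N\<rfloor>)" by linarith
        finally show "(\<gamma> - \<delta>) * real N \<le> real (nat \<lfloor>\<gamma> * real N\<rfloor>)" .
      qed
      define Q1 where "Q1 = (\<gamma> - \<delta>) * p1 + (1 - \<gamma>) * c1"
      define Q2 where "Q2 = (\<gamma> - \<delta>) * p2 + (1 - \<gamma>) * c2"
      have Q0: "Q1 \<ge> 0" "Q2 \<ge> 0" using \<delta> \<gamma> p0 c0 by (auto simp: Q1_def Q2_def)
      have "achievable W R_FB Q1 Q2"
      proof (rule achievable_two_phase[OF \<mu>(1) \<delta>(1) _ _ p0 c0 Q0 _ enhanced_phase[OF p(1) \<gamma>(1)] \<tau>])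
        show "c1 + 2 * \<delta> \<le> I_U (out1 W) \<mu>" using \<mu>(2) by (simp add: c1_def)
        show "c2 = 0 \<or> c2 + 2 * \<delta> \<le> I_X (out2 W) \<mu>" using \<mu>(3) by (auto simp: c2_def max_def)
        \<comment> \<open>\<open>c1 + 2 * \<delta>\<close> is at most \<open>I(U;Y1)\<close>, hence
          at least \<open>\<kappa>\<close> below \<open>I(U;Y2)\<close>. The fed-back outputs take
          at most half of this slack, and \<open>c2\<close> is at most
          \<open>I(X;Y2|U)\<close>.\<close>
        show "c1 + \<gamma> / (1 - \<gamma>) * log 2 CARD('y1) + c2 + 2 * \<delta> \<le> I_U (out2 W) \<mu> + I_X (out2 W) \<mu>"
          using \<mu>(2) gap c2_le \<gamma>lC' \<kappa>(1) \<delta>(1) unfolding c1_def lC_def by linarith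
      qed (use \<gamma> \<gamma>lC R_FB in \<open>auto simp: Q1_def Q2_def lC_def\<close>)
      moreover have "dist (Q1, Q2) (\<gamma> * P1 + (1 - \<gamma>) * R1, \<gamma> * P2 + (1 - \<gamma>) * R2) < \<eta>"
      proof -
        have close: "\<bar>(\<gamma> - \<delta>) * q + (1 - \<gamma>) * c - (\<gamma> * Pi + (1 - \<gamma>) * Ri)\<bar> \<le> 3 * \<eta> / 8"
          if "\<bar>q - Pi\<bar> < min 1 (\<eta> / 8)" "\<bar>c - Ri\<bar> \<le> 3 * \<delta>" "q \<ge> 0" "Pi \<le> P1 + P2" for q c Pi Ri
        proof -
          have "(\<gamma> - \<delta>) * q + (1 - \<gamma>) * c - (\<gamma> * Pi + (1 - \<gamma>) * Ri) = \<gamma> * (q - Pi) - \<delta> * q + (1 - \<gamma>) * (c - Ri)"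
            by (simp add: algebra_simps)
          moreover have "\<bar>\<gamma> * (q - Pi)\<bar> \<le> \<eta> / 8"
            using that(1) \<gamma> mult_mono[of \<gamma> 1 "\<bar>q - Pi\<bar>" "\<eta> / 8"] \<eta> by (simp add: abs_mult)
          moreover have "\<bar>(1 - \<gamma>) * (c - Ri)\<bar> \<le> 3 * \<delta>"
            using that(2) \<gamma> mult_mono[of "1 - \<gamma>" 1 "\<bar>c - Ri\<bar>" "3 * \<delta>"] \<delta> by (simp add: abs_mult)
          moreover have "q + 3 \<le> D" using that(1,4) unfolding D_def by linarith
          then have "\<delta> * q + 3 * \<delta> \<le> \<delta> * D"
            using mult_left_mono[of "q + 3" D \<delta>] \<delta>(1) by (simp add: distrib_left mult.commute)
          moreover have "\<delta> * q \<ge> 0" using that(3) \<delta> by simp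
          ultimately show ?thesis using \<delta>D \<eta> by linarith
        qed
        have "dist (Q1, Q2) (\<gamma> * P1 + (1 - \<gamma>) * R1, \<gamma> * P2 + (1 - \<gamma>) * R2)
          \<le> \<bar>Q1 - (\<gamma> * P1 + (1 - \<gamma>) * R1)\<bar> + \<bar>Q2 - (\<gamma> * P2 + (1 - \<gamma>) * R2)\<bar>"
          unfolding dist_Pair_Pair dist_real_def by (rule order_trans[OF sqrt_sum_squares_le_sum_abs]) simp
        also have "\<dots> \<le> 3 * \<eta> / 8 + 3 * \<eta> / 8"
          unfolding Q1_def Q2_def using p p0 P0 \<delta> R2
          by (intro add_mono close) (auto simp: c1_def c2_def max_def)
        also have "\<dots> < \<eta>" using \<eta> by simp
        finally show ?thesis .
      qed
      ultimately show "\<exists>y\<in>{(R1, R2). achievable W R_FB R1 R2}. dist y (\<gamma> * P1 + (1 - \<gamma>) * R1, \<gamma> * P2 + (1 - \<gamma>) * R2) < \<eta>"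
        by (intro bexI[of _ "(Q1, Q2)"]) auto
    qed
  qed (use \<gamma> in auto)
qed

text \<open>A superposition code with empty first phase and one satellite, at half of a positive
  \<open>I(U;Y1)\<close>; taking a quarter of it for \<open>\<delta>\<close> uses up the rest. As
  \<open>I(U;Y2)\<close> is larger, Receiver 2 can decode the cloud centers too, as the construction
  demands.\<close>

lemma positive_rate_NoFB:
  fixes W :: "('x::finite, 'y1::finite, 'y2::finite) dmbc"
  assumes sln: "strictly_less_noisy W" and inf: "receiver1_informed W"
  obtains s where "s > 0" "(s, 0) \<in> C_NoFB W"
proof -
  obtain P :: "(nat \<times> 'x) pmf" where P: "finite (set_pmf P)" "I_U_Y1 P W > 0"
    using inf by (auto simp: receiver1_informed_def)
  obtain \<mu> where \<mu>: "finite (set_pmf \<mu>)" "I_U_Y1 P W = I_U (out1 W) \<mu>" "I_U_Y2 P W = I_U (out2 W) \<mu>"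
    by (rule I_U_Y_of_pmf[OF P(1)])
  define s where "s = I_U (out1 W) \<mu> / 2"
  have s: "s > 0" using P \<mu> by (simp add: s_def)
  have I2: "I_U (out2 W) \<mu> > I_U (out1 W) \<mu>"
    using P \<mu> by (intro strictly_less_noisyD(2)[OF sln]) auto
  have IX: "I_X (out2 W) \<mu> \<ge> 0" by (rule I_X_nonneg[OF \<mu>(1)])
  have "achievable W 0 s 0"
  proof (rule achievable_two_phase[where \<mu> = \<mu> and \<delta> = "s / 2" and \<gamma> = 0 and ?p1.0 = 0 and ?p2.0 = 0 and ?c1.0 = s and ?c2.0 = 0 and \<tau> = 0])
    fix \<epsilon> :: real assume "\<epsilon> > 0"
    have m: "messages n 0 = {1}" for n by (auto simp: messages_def)
    have "prob (joint (pair_pmf (pmf_of_set {1}) (pmf_of_set {1})) (\<lambda>a. memoryless W [])) {((a1, a2), y). a1 \<noteq> (1::nat) \<or> a2 \<noteq> (1::nat)} \<le> \<epsilon>"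
      using \<open>\<epsilon> > 0\<close> by (simp add: pmf_of_set_singleton joint_def bind_return_pmf)
    then show "\<forall>\<^sub>F N in sequentially. \<exists>xE g1 g2. (\<forall>a1 a2. length (xE a1 a2) = nat \<lfloor>0 * real N\<rfloor>) \<and>
      prob (joint (pair_pmf (pmf_of_set (messages (nat \<lfloor>0 * real N\<rfloor>) 0)) (pmf_of_set (messages (nat \<lfloor>0 * real N\<rfloor>) 0)))
        (\<lambda>a. memoryless W (xE (fst a) (snd a)))) {((a1, a2), y). a1 \<noteq> g1 (map fst y) \<or> a2 \<noteq> g2 y} \<le> \<epsilon>"
      by (intro always_eventually allI exI[of _ "\<lambda>_ _. []"] exI[of _ "\<lambda>_. 1"]) (simp add: m)
  qed (use s I2 IX \<mu> in \<open>auto simp: s_def\<close>)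
  then have "(s, 0) \<in> C_NoFB W"
    unfolding C_NoFB_def C_FB_def by (intro subsetD[OF closure_subset]) simp
  then show thesis using s by (rule that[rotated])
qed

theorem theorem3:
  fixes W :: "('x::finite, 'y1::finite, 'y2::finite) dmbc" and R_FB :: real
  assumes "R_FB > 0"
    and "strictly_less_noisy W"
  shows "(\<forall>R1 R2. R1 > 0 \<and> R2 > 0 \<and> (R1, R2) \<in> frontier (C_NoFB W) \<inter> interior (C_Enh W)
            \<longrightarrow> (R1, R2) \<in> interior (C_FB W R_FB))
       \<and> (receiver1_informed W \<longrightarrow> C_NoFB W \<subset> C_Enh W \<longrightarrow> C_NoFB W \<subset> C_FB W R_FB)"
proof (intro conjI allI impI)
  have closed: "closed (C_NoFB W)" by (simp add: C_NoFB_def C_FB_def)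
  {
    fix R1 R2 :: real
    assume "R1 > 0 \<and> R2 > 0 \<and> (R1, R2) \<in> frontier (C_NoFB W) \<inter> interior (C_Enh W)"
    then have R: "R1 > 0" "(R1, R2) \<in> C_NoFB W" "(R1, R2) \<in> interior (C_Enh W)"
      using frontier_subset_closed[OF closed] by auto
    obtain \<gamma> where \<gamma>: "0 < \<gamma>" "\<gamma> < 1"
      "\<And>P1 P2. (P1, P2) \<in> C_Enh W \<Longrightarrow> (\<gamma> * P1 + (1 - \<gamma>) * R1, \<gamma> * P2 + (1 - \<gamma>) * R2) \<in> C_FB W R_FB"
      using time_sharing_with_enhanced[OF assms(2,1) R(2,1)] by blast
    obtain \<rho> where \<rho>: "\<rho> > 0" "ball (R1, R2) \<rho> \<subseteq> C_Enh W"
      using R(3) by (auto simp: mem_interior)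
    have "ball (R1, R2) (\<gamma> * \<rho>) \<subseteq> C_FB W R_FB"
    proof
      fix q assume q: "q \<in> ball (R1, R2) (\<gamma> * \<rho>)"
      \<comment> \<open>The homothety with center \<open>(R1, R2)\<close> and factor
        \<open>1 / \<gamma>\<close> sends \<open>q\<close> to \<open>p\<close>, so that
        \<open>q\<close> is \<open>\<gamma>\<close> times \<open>p\<close> plus
        \<open>1 - \<gamma>\<close> times the center.\<close>
      define p where "p = (R1, R2) + (q - (R1, R2)) /\<^sub>R \<gamma>"
      have "dist (R1, R2) p = norm (q - (R1, R2)) / \<gamma>"
        using \<gamma> by (simp add: p_def dist_norm norm_minus_commute divide_inverse mult.commute)
      also have "\<dots> < \<rho>"
        using q \<gamma> by (simp add: dist_norm norm_minus_commute pos_divide_less_eq mult.commute)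
      finally have "(fst p, snd p) \<in> C_Enh W" using \<rho> by auto
      from \<gamma>(3)[OF this] show "q \<in> C_FB W R_FB"
        using \<gamma> by (cases q) (simp add: p_def algebra_simps)
    qed
    then show "(R1, R2) \<in> interior (C_FB W R_FB)"
      using \<gamma> \<rho> by (auto simp: mem_interior intro!: exI[of _ "\<gamma> * \<rho>"])
  }
  assume inf: "receiver1_informed W" and sub: "C_NoFB W \<subset> C_Enh W"
  obtain p where p: "p \<in> C_Enh W" "p \<notin> C_NoFB W" using sub by auto
  obtain s where s: "s > 0" "(s, 0) \<in> C_NoFB W" by (rule positive_rate_NoFB[OF assms(2) inf])
  \<comment> \<open>The segment from \<open>(s, 0)\<close> to \<open>p\<close>; since
    \<open>s > 0\<close>, the first rate is positive everywhere before its end.\<close>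
  define f where "f t = ((1 - t) * s + t * fst p, t * snd p)" for t :: real
  define T where "T = {0..1} \<inter> f -` C_NoFB W"
  have "continuous_on {0..1} f" unfolding f_def by (intro continuous_intros)
  then have "closed T" unfolding T_def by (intro continuous_closed_preimage closed) auto
  then have "compact ({0..1} \<inter> T)" by (intro compact_Int_closed compact_Icc)
  then have "compact T" by (simp add: T_def)
  moreover have "0 \<in> T" using s by (simp add: T_def f_def)
  ultimately obtain t where t: "t \<in> T" and max: "\<And>t'. t' \<in> T \<Longrightarrow> t' \<le> t"
    using compact_attains_sup[of T] by auto
  have f1: "f 1 = p" by (simp add: f_def)
  have t01: "0 \<le> t" "t < 1" "f t \<in> C_NoFB W"
    using t f1 p by (auto simp: T_def less_le)
  have "fst p \<ge> 0" using C_FB_nonneg[of "fst p" "snd p"] p(1) by (auto simp: C_Enh_def C_NoFB_def)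
  then have pos: "fst (f t) > 0" using t01 s by (auto simp: f_def intro!: add_pos_nonneg)
  have ft: "(fst (f t), snd (f t)) \<in> C_NoFB W" using t01(3) by simp
  obtain \<gamma> where \<gamma>: "0 < \<gamma>" "\<gamma> < 1"
    "\<And>P1 P2. (P1, P2) \<in> C_Enh W \<Longrightarrow> (\<gamma> * P1 + (1 - \<gamma>) * fst (f t), \<gamma> * P2 + (1 - \<gamma>) * snd (f t)) \<in> C_FB W R_FB"
    using time_sharing_with_enhanced[OF assms(2,1) ft pos] by blast
  \<comment> \<open>As \<open>f\<close> is affine, mixing \<open>f 1 = p\<close> with
    \<open>f t\<close> gives \<open>f t'\<close>, which lies beyond the last point of the segment in
    the no-feedback region.\<close>
  define t' where "t' = \<gamma> + (1 - \<gamma>) * t"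
  have "t' = t + \<gamma> * (1 - t)" "t' = 1 - (1 - \<gamma>) * (1 - t)" by (simp_all add: t'_def algebra_simps)
  moreover have "\<gamma> * (1 - t) > 0" "(1 - \<gamma>) * (1 - t) \<ge> 0" using \<gamma> t01 by simp_all
  ultimately have t': "t < t'" "t' \<le> 1" by simp_all
  then have "f t' \<notin> C_NoFB W" using max[of t'] t01 by (auto simp: T_def)
  moreover have "f t' \<in> C_FB W R_FB"
    using \<gamma>(3)[of "fst p" "snd p"] p by (simp add: f_def t'_def algebra_simps)
  moreover have "C_NoFB W \<subseteq> C_FB W R_FB" using assms by (intro C_NoFB_subset) simp
  ultimately show "C_NoFB W \<subset> C_FB W R_FB" by auto
qed

end
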